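(* Consider a purely kinetic Chaplygin system with symmetry group $G$ and bundle $\pi:Q\to Q/G$. Given $f\in C^\infty(Q/G)$, the following statements are equivalent: (i) $f$ satisfies condition $(A')^G$ (i.e. the couple $(\overline g_{ai}=-G_{ai},F=f\circ\pi)$ is a $(V\pi,\mathcal D)$-orthogonal projective geodesic extension), namely $$G_{bk}R^k_{ac}+G_{ak}R^k_{bc}+g_{bc}\frac{\partial f}{\partial q^a}+g_{ac}\frac{\partial f}{\partial q^b}-2g_{ab}\frac{\partial f}{\partial q^c}=0\quad\text{for all }a,b,c;$$ (ii) $f$ satisfies $df\wedge\theta_l=\gamma^G$, where $\gamma^G=\frac16\left(-G_{bk}R^k_{ac}+G_{ck}R^k_{ab}-2G_{ak}R^k_{bc}\right)\dot q^a\,dq^b\wedge dq^c$.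
   Context: Setting: $Q$ is an $n$-dimensional manifold with Riemannian metric $g$, $\mathcal D\subset TQ$ is a distribution of rank $m$, $L(v)=\frac12g(v,v)$. The system $(L,\mathcal D)$ is a (purely kinetic) Chaplygin system: a Lie group $G$ acts freely and properly on $Q$, $\pi:Q\to Q/G$ is the principal bundle, $g$ and $\mathcal D$ are $G$-invariant, and $\mathcal D$ is the horizontal distribution of a principal connection on $\pi$ (so $TQ=\mathcal D\oplus V\pi$, with $V\pi=\ker T\pi$, and $\dim Q/G=m$). Indices $a,b,c,d=1,\dots,m$; $i,j,k=1,\dots,n-m$. Summation convention is used. Frames: $V_i$ are the infinitesimal generators of a basis of the Lie algebra of $G$; $X_a$ are the horizontal lifts of the coordinate fields $\partial/\partial q^a$ on $Q/G$. Set $G_{ab}=g(X_a,X_b)$ (inverse $G^{ab}$), $G_{ai}=g(X_a,V_i)$, $K^b_i=-G^{ab}G_{ai}$, $X_i=V_i+K^b_iX_b$ (so $\{X_i\}$ spans the $g$-orthogonal complement of $\mathcal D$). Write $[X_\alpha,X_\beta]=R^\gamma_{\alpha\beta}X_\gamma$ in the frame $\{X_a,X_i\}$ and $g_{ab}=G_{ab}$. The functions $g_{ab}$, $R^c_{ab}$ and $G_{ak}R^k_{bc}$ are $G$-invariant and are regarded as functions on $Q/G$. On $T(Q/G)$, with coordinates $(q^a,\dot q^a)$, $\theta_l=g_{ab}\dot q^a dq^b$; $f$ is pulled back to $T(Q/G)$. Terminology: for a symmetric $(0,2)$-tensor field $\overline g$ with $\overline g|_{\mathcal D\times\mathcal D}=g|_{\mathcal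 D\times\mathcal D}$ and components $\overline g_{ai}=\overline g(X_a,X_i)$, and $F\in C^\infty(Q)$, the couple $(\overline g_{ai},F)$ is a projective geodesic extension if, with $\theta_i=\overline g_{ai}v^a$, for all $v^a$, $(A')$: $g_{bd}(\delta_a^dX_c(F)-\delta_c^dX_a(F))v^av^b+\theta_kR^k_{ac}v^a=0$ for all $c$, and $(B')$: $\Gamma^{nh}(\theta_i)+\lambda_i+\theta_k(R^k_{ia}+\delta^k_iX_a(F))v^a-g_{ab}X_i(F)v^av^b=0$ for all $i$. Here $\nabla_{X_a}X_b=\Gamma^c_{ab}X_c+\Gamma^i_{ab}X_i$ for the Levi-Civita connection of $g$, $\lambda_i=g(X_k,X_i)\Gamma^k_{ab}v^av^b$ and $\Gamma^{nh}(\theta_bv^b)=(X_a(\theta_b)-\theta_d\Gamma^d_{ab})v^av^b$. It is $(V\pi,\mathcal D)$-orthogonal when $\overline g|_{V\pi\times\mathcal D}=0$, equivalently $\overline g_{ai}=-G_{ai}$. With $\overline g_{ai}=-G_{ai}$ and $F=f\circ\pi$, $(A')$ is the condition $(A')^G$, and $(A')^G$ already implies $(B')$. *)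

theory Defs
  imports "HOL-Analysis.Analysis" "HOL-Algebra.Group_Action"
begin

section \<open>Smooth manifolds\<close>

text \<open>Only meant for open sets \<open>S\<close> of finite-dimensional spaces.\<close>

primrec Ck_on ::
  "nat \<Rightarrow> 'a::real_normed_vector set \<Rightarrow> ('a \<Rightarrow> 'b::real_normed_vector) \<Rightarrow> bool" where
  "Ck_on 0 S f \<longleftrightarrow> continuous_on S f"
| "Ck_on (Suc k) S f \<longleftrightarrow> (\<forall>x\<in>S. f differentiable (at x)) \<and>
     (\<forall>v. Ck_on k S (\<lambda>x. frechet_derivative f (at x) v))"

definition smooth_on ::
  "'a::real_normed_vector set \<Rightarrow> ('a \<Rightarrow> 'b::real_normed_vector) \<Rightarrow> bool" where
  "smooth_on S f \<longleftrightarrow> (\<forall>k. Ck_on k S f)"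

text \<open>A manifold is given by an atlas: a set of pairs of a chart domain and a chart map (whose
  values outside the domain are irrelevant). The underlying set and the topology are read off from
  the atlas.\<close>

type_synonym ('p, 'e) atlas = "('p set \<times> ('p \<Rightarrow> 'e)) set"

definition mcarrier :: "('p, 'e) atlas \<Rightarrow> 'p set" where
  "mcarrier A = (\<Union>(U, \<phi>)\<in>A. U)"

definition mtopology :: "('p, 'e::euclidean_space) atlas \<Rightarrow> 'p topology" where
  "mtopology A =
     topology (\<lambda>S. S \<subseteq> mcarrier A \<and> (\<forall>(U, \<phi>)\<in>A. open (\<phi> ` (S \<inter> U))))"

definition smooth_manifold :: "('p, 'e::euclidean_space) atlas \<Rightarrow> bool" where
  "smooth_manifold A \<longleftrightarrow>
     (\<forall>(U, \<phi>)\<in>A. inj_on \<phi> U \<and> open (\<phi> ` U)) \<and>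
     (\<forall>(U, \<phi>)\<in>A. \<forall>(V, \<psi>)\<in>A.
        open (\<phi> ` (U \<inter> V)) \<and> smooth_on (\<phi> ` (U \<inter> V)) (\<psi> \<circ> inv_into U \<phi>)) \<and>
     Hausdorff_space (mtopology A) \<and> second_countable (mtopology A)"

definition restrict_atlas :: "('p, 'e) atlas \<Rightarrow> 'p set \<Rightarrow> ('p, 'e) atlas" where
  "restrict_atlas A W = (\<lambda>(U, \<phi>). (U \<inter> W, \<phi>)) ` A"

definition prod_atlas :: "('p, 'e) atlas \<Rightarrow> ('q, 'f) atlas \<Rightarrow> ('p \<times> 'q, 'e \<times> 'f) atlas" where
  "prod_atlas A B = (\<lambda>((U, \<phi>), (V, \<psi>)). (U \<times> V, map_prod \<phi> \<psi>)) ` (A \<times> B)"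

definition smooth_map ::
  "('p, 'e::euclidean_space) atlas \<Rightarrow> ('q, 'f::euclidean_space) atlas \<Rightarrow> ('p \<Rightarrow> 'q) \<Rightarrow> bool" where
  "smooth_map A B h \<longleftrightarrow> continuous_map (mtopology A) (mtopology B) h \<and>
     (\<forall>(U, \<phi>)\<in>A. \<forall>(V, \<psi>)\<in>B. smooth_on (\<phi> ` (U \<inter> h -` V)) (\<psi> \<circ> h \<circ> inv_into U \<phi>))"

definition diffeo ::
  "('p, 'e::euclidean_space) atlas \<Rightarrow> ('q, 'f::euclidean_space) atlas \<Rightarrow> ('p \<Rightarrow> 'q) \<Rightarrow> bool" where
  "diffeo A B h \<longleftrightarrow> bij_betw h (mcarrier A) (mcarrier B) \<and> smooth_map A B h \<and>
     smooth_map B A (inv_into (mcarrier A) h)"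

definition smooth_fun ::
  "('p, 'e::euclidean_space) atlas \<Rightarrow> 'p set \<Rightarrow> ('p \<Rightarrow> real) \<Rightarrow> bool" where
  "smooth_fun A W f \<longleftrightarrow> openin (mtopology A) W \<and>
     (\<forall>(U, \<phi>)\<in>A. smooth_on (\<phi> ` (U \<inter> W)) (f \<circ> inv_into U \<phi>))"

definition smooth_at ::
  "('p, 'e::euclidean_space) atlas \<Rightarrow> 'p \<Rightarrow> ('p \<Rightarrow> real) \<Rightarrow> bool" where
  "smooth_at A p f \<longleftrightarrow> (\<exists>W. p \<in> W \<and> smooth_fun A W f)"


section \<open>Tangent vectors and tensors\<close>

text \<open>A tangent vector at \<open>p\<close> is the operator of directional derivative acting on functions that are
  smooth near \<open>p\<close>. It is made to vanish on all other functions, so that equality of operators is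
  equality of tangent vectors.\<close>

type_synonym 'p tvec = "('p \<Rightarrow> real) \<Rightarrow> real"
type_synonym 'p vfield = "'p \<Rightarrow> 'p tvec"

definition dir_deriv ::
  "('p, 'e::euclidean_space) atlas \<Rightarrow> 'p set \<Rightarrow> ('p \<Rightarrow> 'e) \<Rightarrow> 'p \<Rightarrow> 'e \<Rightarrow> 'p tvec" where
  "dir_deriv A U \<phi> p w =
     (\<lambda>f. if smooth_at A p f then frechet_derivative (f \<circ> inv_into U \<phi>) (at (\<phi> p)) w else 0)"

definition tangent_space :: "('p, 'e::euclidean_space) atlas \<Rightarrow> 'p \<Rightarrow> 'p tvec set" where
  "tangent_space A p = {dir_deriv A U \<phi> p w |U \<phi> w. (U, \<phi>) \<in> A \<and> p \<in> U}"

definition coord_vf ::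
  "('p, real^'m) atlas \<Rightarrow> 'p set \<Rightarrow> ('p \<Rightarrow> real^'m) \<Rightarrow> 'm \<Rightarrow> 'p vfield" where
  "coord_vf A U \<phi> a = (\<lambda>p. dir_deriv A U \<phi> p (axis a 1))"

text \<open>The image of \<open>v\<close>, tangent at \<open>p\<close>, under the tangent map of \<open>h\<close>; \<open>B\<close> is the target atlas.\<close>

definition push ::
  "('q, 'f::euclidean_space) atlas \<Rightarrow> ('p \<Rightarrow> 'q) \<Rightarrow> 'p \<Rightarrow> 'p tvec \<Rightarrow> 'q tvec" where
  "push B h p v = (\<lambda>f. if smooth_at B (h p) f then v (f \<circ> h) else 0)"

definition tangent_atlas ::
  "('p, 'e::euclidean_space) atlas \<Rightarrow> ('p \<times> 'p tvec, 'e \<times> 'e) atlas" where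
  "tangent_atlas A =
     (\<lambda>(U, \<phi>). (Sigma U (tangent_space A),
        \<lambda>(x, v). (\<phi> x, \<Sum>b\<in>Basis. v (\<lambda>y. \<phi> y \<bullet> b) *\<^sub>R b))) ` A"

definition lincomb :: "'i set \<Rightarrow> ('i \<Rightarrow> real) \<Rightarrow> ('i \<Rightarrow> 'p tvec) \<Rightarrow> 'p tvec" where
  "lincomb I c E = (\<lambda>f. \<Sum>i\<in>I. c i * E i f)"

definition tbasis :: "'i set \<Rightarrow> ('i \<Rightarrow> 'p tvec) \<Rightarrow> 'p tvec set \<Rightarrow> bool" where
  "tbasis I E S \<longleftrightarrow> finite I \<and> S = range (\<lambda>c. lincomb I c E) \<and>
     (\<forall>c. lincomb I c E = (\<lambda>_. 0) \<longrightarrow> (\<forall>i\<in>I. c i = 0))"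

definition smooth_vf ::
  "('p, 'e::euclidean_space) atlas \<Rightarrow> 'p set \<Rightarrow> 'p vfield \<Rightarrow> bool" where
  "smooth_vf A W X \<longleftrightarrow> openin (mtopology A) W \<and> (\<forall>p\<in>W. X p \<in> tangent_space A p) \<and>
     (\<forall>W' f. W' \<subseteq> W \<and> smooth_fun A W' f \<longrightarrow> smooth_fun A W' (\<lambda>p. X p f))"

definition vf_add :: "'p vfield \<Rightarrow> 'p vfield \<Rightarrow> 'p vfield" where
  "vf_add X Y = (\<lambda>p f. X p f + Y p f)"

definition vf_scale :: "('p \<Rightarrow> real) \<Rightarrow> 'p vfield \<Rightarrow> 'p vfield" where
  "vf_scale F X = (\<lambda>p f. F p * X p f)"

definition lie_bracket ::
  "('p, 'e::euclidean_space) atlas \<Rightarrow> 'p vfield \<Rightarrow> 'p vfield \<Rightarrow> 'p vfield" where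
  "lie_bracket A X Y =
     (\<lambda>p f. if smooth_at A p f then X p (\<lambda>q. Y q f) - Y p (\<lambda>q. X q f) else 0)"

definition sym_tensor2 ::
  "('p, 'e::euclidean_space) atlas \<Rightarrow> 'p set \<Rightarrow> ('p \<Rightarrow> 'p tvec \<Rightarrow> 'p tvec \<Rightarrow> real) \<Rightarrow> bool" where
  "sym_tensor2 A W h \<longleftrightarrow>
     (\<forall>p\<in>W. \<forall>u\<in>tangent_space A p. \<forall>v\<in>tangent_space A p.
        h p u v = h p v u \<and>
        (\<forall>w\<in>tangent_space A p. \<forall>r. h p (\<lambda>f. r * u f + v f) w = r * h p u w + h p v w)) \<and>
     (\<forall>W' X Y. W' \<subseteq> W \<and> smooth_vf A W' X \<and> smooth_vf A W' Y \<longrightarrow>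
        smooth_fun A W' (\<lambda>p. h p (X p) (Y p)))"

definition riemannian_metric ::
  "('p, 'e::euclidean_space) atlas \<Rightarrow> ('p \<Rightarrow> 'p tvec \<Rightarrow> 'p tvec \<Rightarrow> real) \<Rightarrow> bool" where
  "riemannian_metric A g \<longleftrightarrow> sym_tensor2 A (mcarrier A) g \<and>
     (\<forall>p\<in>mcarrier A. \<forall>u\<in>tangent_space A p. u \<noteq> (\<lambda>_. 0) \<longrightarrow> g p u u > 0)"

text \<open>The Levi-Civita connection on the open submanifold \<open>W\<close>.\<close>

definition levi_civita ::
  "('p, 'e::euclidean_space) atlas \<Rightarrow> 'p set \<Rightarrow> ('p \<Rightarrow> 'p tvec \<Rightarrow> 'p tvec \<Rightarrow> real) \<Rightarrow>
   ('p vfield \<Rightarrow> 'p vfield \<Rightarrow> 'p vfield) \<Rightarrow> bool" where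
  "levi_civita A W g nabla \<longleftrightarrow>
     (\<forall>X Y Z F. smooth_vf A W X \<and> smooth_vf A W Y \<and> smooth_vf A W Z \<and> smooth_fun A W F \<longrightarrow>
        smooth_vf A W (nabla X Y) \<and>
        (\<forall>p\<in>W.
           nabla (vf_add X Y) Z p = vf_add (nabla X Z) (nabla Y Z) p \<and>
           nabla (vf_scale F X) Y p = vf_scale F (nabla X Y) p \<and>
           nabla X (vf_add Y Z) p = vf_add (nabla X Y) (nabla X Z) p \<and>
           nabla X (vf_scale F Y) p =
             vf_add (vf_scale (\<lambda>q. X q F) Y) (vf_scale F (nabla X Y)) p \<and>
           (\<forall>f. nabla X Y p f - nabla Y X p f = lie_bracket A X Y p f) \<and>
           X p (\<lambda>q. g q (Y q) (Z q)) = g p (nabla X Y p) (Z p) + g p (Y p) (nabla X Z p)))"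

definition distribution ::
  "('p, 'e::euclidean_space) atlas \<Rightarrow> nat \<Rightarrow> ('p \<Rightarrow> 'p tvec set) \<Rightarrow> bool" where
  "distribution A r D \<longleftrightarrow>
     (\<forall>p\<in>mcarrier A. \<exists>W Y. p \<in> W \<and> (\<forall>i<r. smooth_vf A W (Y i)) \<and>
        (\<forall>q\<in>W. tbasis {..<r} (\<lambda>i. Y i q) (D q)))"

definition structure_functions ::
  "('p, 'e::euclidean_space) atlas \<Rightarrow> 'p set \<Rightarrow> ('i::finite \<Rightarrow> 'p vfield) \<Rightarrow>
   ('i \<Rightarrow> 'i \<Rightarrow> 'i \<Rightarrow> 'p \<Rightarrow> real) \<Rightarrow> bool" where
  "structure_functions A W E R \<longleftrightarrow>
     (\<forall>p\<in>W. \<forall>\<alpha> \<beta>.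
        lie_bracket A (E \<alpha>) (E \<beta>) p = lincomb UNIV (\<lambda>\<gamma>. R \<gamma> \<alpha> \<beta> p) (\<lambda>\<gamma>. E \<gamma> p))"


section \<open>Differential forms\<close>

definition ext_d :: "('p \<Rightarrow> real) \<Rightarrow> 'p \<Rightarrow> 'p tvec \<Rightarrow> real" where
  "ext_d f = (\<lambda>p v. v f)"

definition wedge ::
  "('p \<Rightarrow> 'p tvec \<Rightarrow> real) \<Rightarrow> ('p \<Rightarrow> 'p tvec \<Rightarrow> real) \<Rightarrow> 'p \<Rightarrow> 'p tvec \<Rightarrow> 'p tvec \<Rightarrow> real" where
  "wedge \<alpha> \<beta> = (\<lambda>p u v. \<alpha> p u * \<beta> p v - \<alpha> p v * \<beta> p u)"


section \<open>Chaplygin systems\<close>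

locale lie_group = group G for G :: "('g, 'c) monoid_scheme" (structure) +
  fixes AG :: "('g, 'k::euclidean_space) atlas"
  assumes manifold: "smooth_manifold AG"
    and carrier: "mcarrier AG = carrier G"
    and smooth_mult: "smooth_map (prod_atlas AG AG) AG (\<lambda>(x, y). x \<otimes> y)"
    and smooth_inv: "smooth_map AG AG (\<lambda>x. inv x)"

text \<open>The points of \<open>Q/G\<close> are the orbits; the atlas \<open>AB\<close> carries the smooth structure of \<open>Q/G\<close>.
  The bundle projection is \<open>orbit G act\<close>. The base \<open>Q/G\<close> and the structure group are modelled on
  \<open>real^'m\<close> and \<open>real^'k\<close>.\<close>

locale principal_bundle = lie_group G AG + group_action G "mcarrier AQ" act
  for G :: "('g, 'c) monoid_scheme" (structure)
    and AG :: "('g, real^'k) atlas"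
    and AQ :: "('q, 'e::euclidean_space) atlas"
    and act :: "'g \<Rightarrow> 'q \<Rightarrow> 'q" +
  fixes AB :: "('q set, real^'m) atlas"
  assumes manifold_Q: "smooth_manifold AQ"
    and manifold_B: "smooth_manifold AB"
    and smooth_act: "smooth_map (prod_atlas AG AQ) AQ (\<lambda>(h, q). act h q)"
    and free: "q \<in> mcarrier AQ \<Longrightarrow> stabilizer G act q = {\<one>}"
    and proper: "proper_map (prod_topology (mtopology AG) (mtopology AQ))
                   (prod_topology (mtopology AQ) (mtopology AQ)) (\<lambda>(h, q). (act h q, q))"
    and carrier_B: "mcarrier AB = orbits G (mcarrier AQ) act"
    and smooth_proj: "smooth_map AQ AB (orbit G act)"
    and local_triv: "x \<in> mcarrier AB \<Longrightarrow>
      \<exists>U s. x \<in> U \<and> openin (mtopology AB) U \<and>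
        (\<forall>h\<in>carrier G. \<forall>q\<in>mcarrier AQ. orbit G act q \<in> U \<longrightarrow> s (act h q) = h \<otimes> s q) \<and>
        diffeo (restrict_atlas AQ {q \<in> mcarrier AQ. orbit G act q \<in> U})
               (prod_atlas (restrict_atlas AB U) AG)
               (\<lambda>q. (orbit G act q, s q))"

definition vertical_space ::
  "('p, 'e::euclidean_space) atlas \<Rightarrow> ('b, 'f::euclidean_space) atlas \<Rightarrow> ('p \<Rightarrow> 'b) \<Rightarrow>
   'p \<Rightarrow> 'p tvec set" where
  "vertical_space A B \<pi> p = {u \<in> tangent_space A p. push B \<pi> p u = (\<lambda>_. 0)}"

text \<open>The principal connection is given by its horizontal distribution.\<close>

locale chaplygin_system = principal_bundle G AG AQ act AB
  for G :: "('g, 'c) monoid_scheme" (structure)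
    and AG :: "('g, real^'k) atlas"
    and AQ :: "('q, 'e::euclidean_space) atlas"
    and act :: "'g \<Rightarrow> 'q \<Rightarrow> 'q"
    and AB :: "('q set, real^'m) atlas" +
  fixes g :: "'q \<Rightarrow> 'q tvec \<Rightarrow> 'q tvec \<Rightarrow> real"
    and D :: "'q \<Rightarrow> 'q tvec set"
  assumes metric: "riemannian_metric AQ g"
    and distribution_D: "distribution AQ CARD('m) D"
    and metric_invariant: "\<lbrakk>h \<in> carrier G; q \<in> mcarrier AQ;
        u \<in> tangent_space AQ q; v \<in> tangent_space AQ q\<rbrakk> \<Longrightarrow>
      g (act h q) (push AQ (act h) q u) (push AQ (act h) q v) = g q u v"
    and D_invariant: "\<lbrakk>h \<in> carrier G; q \<in> mcarrier AQ\<rbrakk> \<Longrightarrow>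
      push AQ (act h) q ` D q = D (act h q)"
    and D_vertical_sum: "q \<in> mcarrier AQ \<Longrightarrow>
      tangent_space AQ q =
        {\<lambda>f. u f + w f |u w. u \<in> D q \<and> w \<in> vertical_space AQ AB (orbit G act) q}"
    and D_vertical_inter: "q \<in> mcarrier AQ \<Longrightarrow>
      D q \<inter> vertical_space AQ AB (orbit G act) q = {\<lambda>_. 0}"

text \<open>The infinitesimal generator of \<open>\<xi>\<close> in the Lie algebra, that is, in the tangent space at the
  unit.\<close>

definition inf_generator ::
  "('g, 'c) monoid_scheme \<Rightarrow> ('q, 'e::euclidean_space) atlas \<Rightarrow> ('g \<Rightarrow> 'q \<Rightarrow> 'q) \<Rightarrow>
   'g tvec \<Rightarrow> 'q vfield" where
  "inf_generator G AQ act \<xi> = (\<lambda>q. push AQ (\<lambda>h. act h q) \<one>\<^bsub>G\<^esub> \<xi>)"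

definition horizontal_lift ::
  "('q, 'e::euclidean_space) atlas \<Rightarrow> ('b, 'f::euclidean_space) atlas \<Rightarrow> ('q \<Rightarrow> 'b) \<Rightarrow>
   ('q \<Rightarrow> 'q tvec set) \<Rightarrow> 'q set \<Rightarrow> 'b vfield \<Rightarrow> 'q vfield \<Rightarrow> bool" where
  "horizontal_lift AQ AB \<pi> D W Z X \<longleftrightarrow> smooth_vf AQ W X \<and>
     (\<forall>q\<in>W. X q \<in> D q \<and> push AB \<pi> q (X q) = Z (\<pi> q))"

text \<open>\<open>gcomp g X X\<close> is $G_{ab}$ and \<open>gcomp g X V\<close> is $G_{ai}$.\<close>

definition gcomp ::
  "('q \<Rightarrow> 'q tvec \<Rightarrow> 'q tvec \<Rightarrow> real) \<Rightarrow> ('i \<Rightarrow> 'q vfield) \<Rightarrow> ('j \<Rightarrow> 'q vfield) \<Rightarrow>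
   'i \<Rightarrow> 'j \<Rightarrow> 'q \<Rightarrow> real" where
  "gcomp g Y Z i j = (\<lambda>q. g q (Y i q) (Z j q))"

definition Kcoef ::
  "('q \<Rightarrow> 'q tvec \<Rightarrow> 'q tvec \<Rightarrow> real) \<Rightarrow> ('m::finite \<Rightarrow> 'q vfield) \<Rightarrow> ('k \<Rightarrow> 'q vfield) \<Rightarrow>
   'm \<Rightarrow> 'k \<Rightarrow> 'q \<Rightarrow> real" where
  "Kcoef g X V b i =
     (\<lambda>q. - (\<Sum>a\<in>UNIV. matrix_inv (\<chi> c e. gcomp g X X c e q) $ a $ b * gcomp g X V a i q))"

definition orth_frame ::
  "('q \<Rightarrow> 'q tvec \<Rightarrow> 'q tvec \<Rightarrow> real) \<Rightarrow> ('m::finite \<Rightarrow> 'q vfield) \<Rightarrow> ('k \<Rightarrow> 'q vfield) \<Rightarrow>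
   'k \<Rightarrow> 'q vfield" where
  "orth_frame g X V i = (\<lambda>q f. V i q f + (\<Sum>b\<in>UNIV. Kcoef g X V b i q * X b q f))"

text \<open>The frame $\{X_a, X_i\}$: \<open>Inl a\<close> stands for the index $a$ and \<open>Inr i\<close> for the index $i$.\<close>

definition adapted_frame ::
  "('q \<Rightarrow> 'q tvec \<Rightarrow> 'q tvec \<Rightarrow> real) \<Rightarrow> ('m::finite \<Rightarrow> 'q vfield) \<Rightarrow> ('k \<Rightarrow> 'q vfield) \<Rightarrow>
   'm + 'k \<Rightarrow> 'q vfield" where
  "adapted_frame g X V = case_sum X (orth_frame g X V)"


section \<open>Projective geodesic extensions\<close>

text \<open>In the conditions below \<open>E\<close> is an adapted frame on \<open>W\<close>, \<open>R\<close> are its structure functions, and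
  \<open>Gam\<close> are the coefficients $\Gamma^\gamma_{ab}$ of $\nabla_{X_a} X_b$; the function
  \<open>gb a i\<close> is $\overline g_{ai}$ and \<open>theta gb i q v\<close> is $\theta_i$ at the point \<open>q\<close>.\<close>

definition theta :: "('m::finite \<Rightarrow> 'k \<Rightarrow> 'q \<Rightarrow> real) \<Rightarrow> 'k \<Rightarrow> 'q \<Rightarrow> ('m \<Rightarrow> real) \<Rightarrow> real" where
  "theta gb i q v = (\<Sum>a\<in>UNIV. gb a i q * v a)"

definition cond_A ::
  "'q set \<Rightarrow> ('q \<Rightarrow> 'q tvec \<Rightarrow> 'q tvec \<Rightarrow> real) \<Rightarrow>
   (('m::finite) + ('k::finite) \<Rightarrow> 'q vfield) \<Rightarrow>
   ('m + 'k \<Rightarrow> 'm + 'k \<Rightarrow> 'm + 'k \<Rightarrow> 'q \<Rightarrow> real) \<Rightarrow>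
   ('m \<Rightarrow> 'k \<Rightarrow> 'q \<Rightarrow> real) \<Rightarrow> ('q \<Rightarrow> real) \<Rightarrow> bool" where
  "cond_A W g E R gb F \<longleftrightarrow>
     (\<forall>q\<in>W. \<forall>v c.
        (\<Sum>a\<in>UNIV. \<Sum>b\<in>UNIV. \<Sum>e\<in>UNIV.
           g q (E (Inl b) q) (E (Inl e) q) *
           (of_bool (a = e) * E (Inl c) q F - of_bool (c = e) * E (Inl a) q F) * v a * v b) +
        (\<Sum>a\<in>UNIV. \<Sum>k\<in>UNIV. theta gb k q v * R (Inr k) (Inl a) (Inl c) q * v a) = 0)"

definition lambda_i ::
  "('q \<Rightarrow> 'q tvec \<Rightarrow> 'q tvec \<Rightarrow> real) \<Rightarrow> (('m::finite) + ('k::finite) \<Rightarrow> 'q vfield) \<Rightarrow>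
   ('m + 'k \<Rightarrow> 'm \<Rightarrow> 'm \<Rightarrow> 'q \<Rightarrow> real) \<Rightarrow> 'k \<Rightarrow> 'q \<Rightarrow> ('m \<Rightarrow> real) \<Rightarrow> real" where
  "lambda_i g E Gam i q v =
     (\<Sum>a\<in>UNIV. \<Sum>b\<in>UNIV. \<Sum>k\<in>UNIV.
        g q (E (Inr k) q) (E (Inr i) q) * Gam (Inr k) a b q * v a * v b)"

text \<open>$\Gamma^{nh}(t_b v^b)$\<close>

definition Gamma_nh ::
  "(('m::finite) + 'k \<Rightarrow> 'q vfield) \<Rightarrow> ('m + 'k \<Rightarrow> 'm \<Rightarrow> 'm \<Rightarrow> 'q \<Rightarrow> real) \<Rightarrow>
   ('m \<Rightarrow> 'q \<Rightarrow> real) \<Rightarrow> 'q \<Rightarrow> ('m \<Rightarrow> real) \<Rightarrow> real" where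
  "Gamma_nh E Gam t q v =
     (\<Sum>a\<in>UNIV. \<Sum>b\<in>UNIV.
        (E (Inl a) q (t b) - (\<Sum>e\<in>UNIV. t e q * Gam (Inl e) a b q)) * v a * v b)"

definition cond_B ::
  "'q set \<Rightarrow> ('q \<Rightarrow> 'q tvec \<Rightarrow> 'q tvec \<Rightarrow> real) \<Rightarrow>
   (('m::finite) + ('k::finite) \<Rightarrow> 'q vfield) \<Rightarrow>
   ('m + 'k \<Rightarrow> 'm + 'k \<Rightarrow> 'm + 'k \<Rightarrow> 'q \<Rightarrow> real) \<Rightarrow>
   ('m + 'k \<Rightarrow> 'm \<Rightarrow> 'm \<Rightarrow> 'q \<Rightarrow> real) \<Rightarrow>
   ('m \<Rightarrow> 'k \<Rightarrow> 'q \<Rightarrow> real) \<Rightarrow> ('q \<Rightarrow> real) \<Rightarrow> bool" where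
  "cond_B W g E R Gam gb F \<longleftrightarrow>
     (\<forall>q\<in>W. \<forall>v i.
        Gamma_nh E Gam (\<lambda>b. gb b i) q v + lambda_i g E Gam i q v +
        (\<Sum>a\<in>UNIV. \<Sum>k\<in>UNIV. theta gb k q v *
           (R (Inr k) (Inr i) (Inl a) q + of_bool (k = i) * E (Inl a) q F) * v a) -
        (\<Sum>a\<in>UNIV. \<Sum>b\<in>UNIV.
           g q (E (Inl a) q) (E (Inl b) q) * E (Inr i) q F * v a * v b) = 0)"

definition projective_geodesic_extension ::
  "'q set \<Rightarrow> ('q \<Rightarrow> 'q tvec \<Rightarrow> 'q tvec \<Rightarrow> real) \<Rightarrow>
   (('m::finite) + ('k::finite) \<Rightarrow> 'q vfield) \<Rightarrow>
   ('m + 'k \<Rightarrow> 'm + 'k \<Rightarrow> 'm + 'k \<Rightarrow> 'q \<Rightarrow> real) \<Rightarrow>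
   ('m + 'k \<Rightarrow> 'm \<Rightarrow> 'm \<Rightarrow> 'q \<Rightarrow> real) \<Rightarrow>
   ('m \<Rightarrow> 'k \<Rightarrow> 'q \<Rightarrow> real) \<Rightarrow> ('q \<Rightarrow> real) \<Rightarrow> bool" where
  "projective_geodesic_extension W g E R Gam gb F \<longleftrightarrow>
     cond_A W g E R gb F \<and> cond_B W g E R Gam gb F"

definition VD_orthogonal ::
  "'q set \<Rightarrow> ('q \<Rightarrow> 'q tvec set) \<Rightarrow> ('q \<Rightarrow> 'q tvec set) \<Rightarrow>
   ('q \<Rightarrow> 'q tvec \<Rightarrow> 'q tvec \<Rightarrow> real) \<Rightarrow> bool" where
  "VD_orthogonal W V D gbar \<longleftrightarrow> (\<forall>q\<in>W. \<forall>u\<in>V q. \<forall>w\<in>D q. gbar q u w = 0)"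


section \<open>The reduced conditions\<close>

text \<open>An invariant function on \<open>Q\<close>, regarded as a function on \<open>Q/G\<close>: its value at an orbit is the
  only value it takes there.\<close>

definition on_quotient :: "('q \<Rightarrow> real) \<Rightarrow> 'q set \<Rightarrow> real" where
  "on_quotient F = (\<lambda>x. the_elem (F ` x))"

text \<open>$g_{ab}$ and $G_{ak} R^k_{bc}$ on \<open>Q/G\<close>\<close>

definition red_metric ::
  "('q \<Rightarrow> 'q tvec \<Rightarrow> 'q tvec \<Rightarrow> real) \<Rightarrow> ('m \<Rightarrow> 'q vfield) \<Rightarrow> 'm \<Rightarrow> 'm \<Rightarrow> 'q set \<Rightarrow> real" where
  "red_metric g X a b = on_quotient (gcomp g X X a b)"

definition GR ::
  "('q \<Rightarrow> 'q tvec \<Rightarrow> 'q tvec \<Rightarrow> real) \<Rightarrow> ('m::finite \<Rightarrow> 'q vfield) \<Rightarrow>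
   ('k::finite \<Rightarrow> 'q vfield) \<Rightarrow>
   ('m + 'k \<Rightarrow> 'm + 'k \<Rightarrow> 'm + 'k \<Rightarrow> 'q \<Rightarrow> real) \<Rightarrow> 'm \<Rightarrow> 'm \<Rightarrow> 'm \<Rightarrow> 'q set \<Rightarrow> real" where
  "GR g X V R a b c =
     on_quotient (\<lambda>q. \<Sum>k\<in>UNIV. gcomp g X V a k q * R (Inr k) (Inl b) (Inl c) q)"

definition cond_AG ::
  "('q set, real^'m) atlas \<Rightarrow> 'q set set \<Rightarrow> ('q set \<Rightarrow> real^'m) \<Rightarrow>
   ('q \<Rightarrow> 'q tvec \<Rightarrow> 'q tvec \<Rightarrow> real) \<Rightarrow> ('m \<Rightarrow> 'q vfield) \<Rightarrow> ('k::finite \<Rightarrow> 'q vfield) \<Rightarrow>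
   ('m + 'k \<Rightarrow> 'm + 'k \<Rightarrow> 'm + 'k \<Rightarrow> 'q \<Rightarrow> real) \<Rightarrow> ('q set \<Rightarrow> real) \<Rightarrow> bool" where
  "cond_AG AB U \<phi> g X V R f \<longleftrightarrow>
     (\<forall>x\<in>U. \<forall>a b c.
        GR g X V R b a c x + GR g X V R a b c x +
        red_metric g X b c x * coord_vf AB U \<phi> a x f +
        red_metric g X a c x * coord_vf AB U \<phi> b x f -
        2 * red_metric g X a b x * coord_vf AB U \<phi> c x f = 0)"

text \<open>Coordinates $q^a$ and $\dot q^a$ on \<open>T(Q/G)\<close> induced by the chart \<open>\<phi>\<close>.\<close>

definition qco :: "('b \<Rightarrow> real^'m) \<Rightarrow> 'm \<Rightarrow> 'b \<times> 'b tvec \<Rightarrow> real" where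
  "qco \<phi> a = (\<lambda>(x, v). \<phi> x $ a)"

definition qdot :: "('b \<Rightarrow> real^'m) \<Rightarrow> 'm \<Rightarrow> 'b \<times> 'b tvec \<Rightarrow> real" where
  "qdot \<phi> a = (\<lambda>(x, v). v (\<lambda>y. \<phi> y $ a))"

definition theta_l ::
  "('q set \<Rightarrow> real^'m) \<Rightarrow> ('q \<Rightarrow> 'q tvec \<Rightarrow> 'q tvec \<Rightarrow> real) \<Rightarrow> ('m \<Rightarrow> 'q vfield) \<Rightarrow>
   'q set \<times> 'q set tvec \<Rightarrow> ('q set \<times> 'q set tvec) tvec \<Rightarrow> real" where
  "theta_l \<phi> g X =
     (\<lambda>P u. \<Sum>a\<in>UNIV. \<Sum>b\<in>UNIV. red_metric g X a b (fst P) * qdot \<phi> a P * ext_d (qco \<phi> b) P u)"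

definition gamma_G ::
  "('q set \<Rightarrow> real^'m) \<Rightarrow> ('q \<Rightarrow> 'q tvec \<Rightarrow> 'q tvec \<Rightarrow> real) \<Rightarrow> ('m \<Rightarrow> 'q vfield) \<Rightarrow>
   ('k::finite \<Rightarrow> 'q vfield) \<Rightarrow> ('m + 'k \<Rightarrow> 'm + 'k \<Rightarrow> 'm + 'k \<Rightarrow> 'q \<Rightarrow> real) \<Rightarrow>
   'q set \<times> 'q set tvec \<Rightarrow> ('q set \<times> 'q set tvec) tvec \<Rightarrow> ('q set \<times> 'q set tvec) tvec \<Rightarrow> real"
  where
  "gamma_G \<phi> g X V R =
     (\<lambda>P u w. 1 / 6 * (\<Sum>a\<in>UNIV. \<Sum>b\<in>UNIV. \<Sum>c\<in>UNIV.
        (- GR g X V R b a c (fst P) + GR g X V R c a b (fst P) - 2 * GR g X V R a b c (fst P)) *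
        qdot \<phi> a P * wedge (ext_d (qco \<phi> b)) (ext_d (qco \<phi> c)) P u w))"

end

theory Submission
  imports Defs
begin

text \<open>Tangent vectors are operators on functions, so a map is handled through its pullback of functions
  that are smooth near a point, and push-forward, Lie brackets and invariance become statements
  about pullbacks.

  The fields \<open>X a\<close> are determined by their projections to \<open>Q/G\<close>, hence invariant; their brackets
  project to 0, hence $[X_b, X_c] = R^k_{bc} V_k$, and $g_{ab}$ and
  $G_{ak} R^k_{bc} = g(X_a, [X_b, X_c])$ are invariant too. Pulling \<open>(A')\<close> down to \<open>Q/G\<close> and
  polarising the quadratic form in $v$ gives \<open>(i)\<close>; the left-hand side of \<open>(i)\<close> is symmetric in two
  indices with vanishing cyclic sum, so it is equivalent to its antisymmetrisation, which is \<open>(ii)\<close>.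

  For \<open>(B')\<close>, symmetry of the second derivatives of $f(h q)$ on $G \times Q$ gives $[X_a, V_i] = 0$,
  and $V_i(g_{ab}) = 0$, so that $g(X_b, \nabla_{X_a} V_i)$ is antisymmetric in $a, b$ and the terms
  $\Gamma^{nh}(\theta_i) + \lambda_i$ cancel; the other terms are $K^d_i$ times \<open>(A')\<close>.\<close>

text \<open>A tangent operator returns 0 on functions that are not smooth at its base point, and
  only germs are available: nothing is extended to a global function. Each evaluation therefore
  needs a smoothness proof, often on a smaller neighbourhood, and many equalities of operators split
  on \<open>smooth_at\<close>. In return, push-forward is plain composition, and charts serve mainly
  for the chain rule and for Schwarz's theorem.

  That [X_b, X_c] is a combination of the V_k has two sources: the structure functions make it a
  tangent vector, and the local trivialisation shows that generators exhaust the vertical vectors.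

  The forms on T(Q/G) see only the base component of a vector tangent to T(Q/G), so (ii) is an
  identity in three free vectors of R^m, alternating in two of them.

  The constant 1/6 is 1/3 times 1/2. Let I_abc be the left-hand side of (i) and f_b the partial
  derivatives. Then I_abc - I_acb is 3 (g_ac f_b - g_ab f_c) plus terms in \<open>GR\<close>, so
  division by 3 isolates the coefficients of the wedge of df and \<open>theta_l\<close>; and the sum
  over all b, c counts each pair dq^b, dq^c twice.\<close>

section \<open>Smooth functions on open sets\<close>

lemma Ck_on_cong:
  assumes "open S" "\<And>x. x \<in> S \<Longrightarrow> f x = g x"
  shows "Ck_on k S f \<longleftrightarrow> Ck_on k S g"
  using assms(2)
proof (induction k arbitrary: f g)
  case 0
  then show ?case by (simp cong: continuous_on_cong)
next
  case (Suc k)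
  have "(f has_derivative D) (at x) \<longleftrightarrow> (g has_derivative D) (at x)" if "x \<in> S" for x D
    using has_derivative_transform_within_open[OF _ assms(1) that] Suc.prems by (metis (no_types))
  then have d: "f differentiable at x \<longleftrightarrow> g differentiable at x" if "x \<in> S" for x
    using that by (simp add: differentiable_def)
  have e: "frechet_derivative f (at x) = frechet_derivative g (at x)"
    if "x \<in> S" "f differentiable at x" for x
    using frechet_derivative_transform_within_open[OF that(2) assms(1) that(1)] Suc.prems by blast
  show ?case
  \<comment> \<open>Where \<open>f\<close> is not differentiable, \<open>frechet_derivative\<close>
    is an arbitrary choice, so the induction hypothesis is usable only if \<open>f\<close> is
    differentiable on all of \<open>S\<close>; otherwise both sides are false.\<close>
  proof (cases "\<forall>x\<in>S. f differentiable at x")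
    case True
    have "Ck_on k S (\<lambda>x. frechet_derivative f (at x) v) \<longleftrightarrow>
          Ck_on k S (\<lambda>x. frechet_derivative g (at x) v)" for v
      by (rule Suc.IH) (use e True in auto)
    then show ?thesis using True d by simp
  next
    case False
    then show ?thesis using d by auto
  qed
qed

text \<open>Lets a known derivative \<open>D\<close> stand in for the choice operator inside
  \<open>frechet_derivative\<close>.\<close>

lemma Ck_on_SucI:
  assumes "open S" "\<And>x. x \<in> S \<Longrightarrow> (f has_derivative D x) (at x)"
    and "\<And>v. Ck_on k S (\<lambda>x. D x v)"
  shows "Ck_on (Suc k) S f"
proof -
  have "frechet_derivative f (at x) v = D x v" if "x \<in> S" for x v
    using frechet_derivative_at[OF assms(2)[OF that]] by simp
  then have "Ck_on k S (\<lambda>x. frechet_derivative f (at x) v)" for v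
    using assms(3) by (subst Ck_on_cong[OF assms(1)])
  then show ?thesis using assms(2) by (auto simp: differentiable_def)
qed

lemma Ck_on_subset: "Ck_on k S f \<Longrightarrow> T \<subseteq> S \<Longrightarrow> Ck_on k T f"
  by (induction k arbitrary: f) (auto intro: continuous_on_subset)

lemma Ck_on_Suc_imp_Ck_on: "Ck_on (Suc k) S f \<Longrightarrow> Ck_on k S f"
proof (induction k arbitrary: f)
  case 0
  then show ?case
    by (auto intro!: continuous_at_imp_continuous_on differentiable_imp_continuous_within)
next
  case (Suc k)
  then show ?case by (auto simp del: Ck_on.simps(2) simp: Ck_on.simps(2)[of k] Ck_on.simps(2)[of "Suc k"])
qed

lemma Ck_on_locally:
  assumes "\<And>x. x \<in> S \<Longrightarrow> \<exists>N. open N \<and> x \<in> N \<and> Ck_on k N f"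
  shows "Ck_on k S f"
  using assms
proof (induction k arbitrary: f)
  case 0
  then show ?case
    by (auto intro!: continuous_at_imp_continuous_on) (metis continuous_on_eq_continuous_at)
next
  case (Suc k)
  then show ?case by (metis Ck_on.simps(2))
qed

lemma Ck_on_const: "Ck_on k S (\<lambda>x. c)"
  by (induction k arbitrary: c) auto

lemma Ck_on_bounded_linear:
  assumes "open S" "bounded_linear L" "Ck_on k S f"
  shows "Ck_on k S (\<lambda>x. L (f x))"
  using assms(3)
proof (induction k arbitrary: f)
  case 0
  then show ?case using assms(2) by (auto intro: bounded_linear.continuous_on)
next
  case (Suc k)
  have D: "((\<lambda>x. L (f x)) has_derivative (\<lambda>v. L (frechet_derivative f (at x) v))) (at x)"
    if "x \<in> S" for x
    using bounded_linear.has_derivative[OF assms(2)] frechet_derivative_works Suc.prems that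
    by fastforce
  have "Ck_on k S (\<lambda>x. L (frechet_derivative f (at x) v))" for v
    by (rule Suc.IH) (use Suc.prems in auto)
  then show ?case using D by (intro Ck_on_SucI[OF assms(1)])
qed

lemma Ck_on_add:
  assumes "open S" "Ck_on k S f" "Ck_on k S g"
  shows "Ck_on k S (\<lambda>x. f x + g x)"
  using assms(2,3)
proof (induction k arbitrary: f g)
  case 0
  then show ?case by (auto intro: continuous_on_add)
next
  case (Suc k)
  have D: "((\<lambda>x. f x + g x) has_derivative
      (\<lambda>v. frechet_derivative f (at x) v + frechet_derivative g (at x) v)) (at x)"
    if "x \<in> S" for x
    using Suc.prems that by (intro has_derivative_add) (auto simp: frechet_derivative_works)
  have "Ck_on k S (\<lambda>x. frechet_derivative f (at x) v + frechet_derivative g (at x) v)" for v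
    by (rule Suc.IH) (use Suc.prems in auto)
  then show ?case using D by (intro Ck_on_SucI[OF assms(1)])
qed

lemma Ck_on_sum:
  assumes "open S" "\<And>i. i \<in> I \<Longrightarrow> Ck_on k S (f i)"
  shows "Ck_on k S (\<lambda>x. \<Sum>i\<in>I. f i x)"
  using assms(2) by (induction I rule: infinite_finite_induct) (auto intro: Ck_on_const Ck_on_add assms(1))

lemma Ck_on_scaleR:
  fixes f :: "_ \<Rightarrow> real"
  assumes "open S" "Ck_on k S f" "Ck_on k S g"
  shows "Ck_on k S (\<lambda>x. f x *\<^sub>R g x)"
  using assms(2,3)
proof (induction k arbitrary: f g)
  case 0
  then show ?case by (auto intro: continuous_on_scaleR)
next
  case (Suc k)
  have D: "((\<lambda>x. f x *\<^sub>R g x) has_derivative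
      (\<lambda>v. f x *\<^sub>R frechet_derivative g (at x) v + frechet_derivative f (at x) v *\<^sub>R g x)) (at x)"
    if "x \<in> S" for x
    using Suc.prems that by (intro has_derivative_scaleR) (auto simp: frechet_derivative_works)
  have "Ck_on k S f" "Ck_on k S g"
    using Suc.prems by (auto intro: Ck_on_Suc_imp_Ck_on simp del: Ck_on.simps)
  then have "Ck_on k S (\<lambda>x. f x *\<^sub>R frechet_derivative g (at x) v + frechet_derivative f (at x) v *\<^sub>R g x)" for v
    by (intro Ck_on_add[OF assms(1)] Suc.IH) (use Suc.prems in auto)
  then show ?case using D by (intro Ck_on_SucI[OF assms(1)])
qed

text \<open>The chain rule yields the derivative of \<open>g\<close> applied to a vector that itself
  varies with x, whereas \<open>Ck_on\<close> speaks of derivatives along fixed vectors. Expanding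
  that vector over \<open>Basis\<close> leaves scalar coefficients times derivatives of
  \<open>g\<close> along fixed directions, to which sums, products and the induction hypothesis
  apply.\<close>

lemma Ck_on_compose:
  fixes f :: "'a::real_normed_vector \<Rightarrow> 'b::euclidean_space"
  assumes "open S" "open T" "\<And>x. x \<in> S \<Longrightarrow> f x \<in> T" "Ck_on k S f" "Ck_on k T g"
  shows "Ck_on k S (\<lambda>x. g (f x))"
  using assms(4,5)
proof (induction k arbitrary: g)
  case 0
  then show ?case using assms(3) by (auto intro: continuous_on_compose2)
next
  case (Suc k)
  have D: "((\<lambda>x. g (f x)) has_derivative
      (\<lambda>v. frechet_derivative g (at (f x)) (frechet_derivative f (at x) v))) (at x)"
    if "x \<in> S" for x
  proof -
    have "(f has_derivative frechet_derivative f (at x)) (at x)"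
      "(g has_derivative frechet_derivative g (at (f x))) (at (f x))"
      using Suc.prems that assms(3)[OF that] by (simp_all add: frechet_derivative_works)
    then show ?thesis by (rule has_derivative_compose)
  qed
  have lin: "linear (frechet_derivative g (at (f x)))" if "x \<in> S" for x
    using Suc.prems assms(3)[OF that] by (intro linear_frechet_derivative) simp
  have E: "frechet_derivative g (at (f x)) (frechet_derivative f (at x) v) =
      (\<Sum>b\<in>Basis. (frechet_derivative f (at x) v \<bullet> b) *\<^sub>R frechet_derivative g (at (f x)) b)"
    if "x \<in> S" for x v
  proof -
    have "frechet_derivative f (at x) v =
        (\<Sum>b\<in>Basis. (frechet_derivative f (at x) v \<bullet> b) *\<^sub>R b)"
      by (simp add: euclidean_representation)
    then have "frechet_derivative g (at (f x)) (frechet_derivative f (at x) v) =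
      frechet_derivative g (at (f x)) (\<Sum>b\<in>Basis. (frechet_derivative f (at x) v \<bullet> b) *\<^sub>R b)"
      by presburger
    also have "\<dots> =
      (\<Sum>b\<in>Basis. (frechet_derivative f (at x) v \<bullet> b) *\<^sub>R frechet_derivative g (at (f x)) b)"
      by (simp only: linear_sum[OF lin[OF that]] linear_scale[OF lin[OF that]])
    finally show ?thesis .
  qed
  have "Ck_on k S f"
    using Suc.prems by (auto intro: Ck_on_Suc_imp_Ck_on simp del: Ck_on.simps)
  then have "Ck_on k S (\<lambda>x. \<Sum>b\<in>Basis. (frechet_derivative f (at x) v \<bullet> b) *\<^sub>R
           frechet_derivative g (at (f x)) b)" for v
    by (intro Ck_on_sum Ck_on_scaleR assms(1) Suc.IH Ck_on_bounded_linear[OF _ bounded_linear_inner_left])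
      (use Suc.prems in auto)
  then have "Ck_on k S (\<lambda>x. frechet_derivative g (at (f x)) (frechet_derivative f (at x) v))" for v
    by (subst Ck_on_cong[OF assms(1) E])
  then show ?case using D by (intro Ck_on_SucI[OF assms(1)])
qed

text \<open>The derivative of \<open>inverse\<close> is again a polynomial in
  \<open>inverse\<close>, so each order of differentiability yields the next.\<close>

lemma Ck_on_inverse: "Ck_on k (- {0::real}) inverse"
proof (induction k)
  case 0
  then show ?case by (auto intro!: continuous_intros)
next
  case (Suc k)
  have o: "open (- {0::real})" by auto
  have D: "(inverse has_derivative (\<lambda>v. - (inverse x * v * inverse x))) (at x)"
    if "x \<noteq> 0" for x :: real
    using has_derivative_inverse'[OF that] by simp
  have E: "frechet_derivative inverse (at x) v = - (inverse x * v * inverse x)"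
    if "x \<noteq> 0" for x v :: real
    using frechet_derivative_at[OF D[OF that]] by metis
  have "Ck_on k (- {0::real}) (\<lambda>x. (- v) *\<^sub>R inverse x *\<^sub>R inverse x)" for v
    using Suc by (intro Ck_on_scaleR o Ck_on_const)
  then have "Ck_on k (- {0::real}) (\<lambda>x. frechet_derivative inverse (at x) v)" for v
    by (subst Ck_on_cong[OF o, where g = "\<lambda>x. (- v) *\<^sub>R inverse x *\<^sub>R inverse x"])
      (auto simp: E algebra_simps)
  then show ?case using D by (auto simp: differentiable_def)
qed

lemma smooth_on_cong:
  "open S \<Longrightarrow> (\<And>x. x \<in> S \<Longrightarrow> f x = g x) \<Longrightarrow> smooth_on S f \<longleftrightarrow> smooth_on S g"
  unfolding smooth_on_def using Ck_on_cong by metis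

lemma smooth_on_subset: "smooth_on S f \<Longrightarrow> T \<subseteq> S \<Longrightarrow> smooth_on T f"
  unfolding smooth_on_def using Ck_on_subset by metis

lemma smooth_on_differentiable: "smooth_on S f \<Longrightarrow> x \<in> S \<Longrightarrow> f differentiable at x"
  unfolding smooth_on_def by (metis Ck_on.simps(2))

lemma smooth_on_has_derivative:
  "smooth_on S f \<Longrightarrow> x \<in> S \<Longrightarrow> (f has_derivative frechet_derivative f (at x)) (at x)"
  using smooth_on_differentiable frechet_derivative_works by blast

lemma smooth_on_frechet_derivative:
  "smooth_on S f \<Longrightarrow> smooth_on S (\<lambda>x. frechet_derivative f (at x) v)"
  unfolding smooth_on_def by (metis Ck_on.simps(2))

lemma smooth_on_continuous_on: "smooth_on S f \<Longrightarrow> continuous_on S f"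
  unfolding smooth_on_def by (metis Ck_on.simps(1))

lemma smooth_on_locally:
  "(\<And>x. x \<in> S \<Longrightarrow> \<exists>N. open N \<and> x \<in> N \<and> smooth_on N f) \<Longrightarrow> smooth_on S f"
  unfolding smooth_on_def using Ck_on_locally by metis

lemma smooth_on_const: "smooth_on S (\<lambda>x. c)"
  by (simp add: smooth_on_def Ck_on_const)

lemma smooth_on_ident: "smooth_on S (\<lambda>x. x)"
proof -
  have "Ck_on k S (\<lambda>x. x)" for k
    by (cases k) (auto simp: Ck_on_const)
  then show ?thesis by (simp add: smooth_on_def)
qed

lemma smooth_on_bounded_linear:
  "open S \<Longrightarrow> bounded_linear L \<Longrightarrow> smooth_on S f \<Longrightarrow> smooth_on S (\<lambda>x. L (f x))"
  by (simp add: smooth_on_def Ck_on_bounded_linear)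

lemma smooth_on_add: "open S \<Longrightarrow> smooth_on S f \<Longrightarrow> smooth_on S g \<Longrightarrow> smooth_on S (\<lambda>x. f x + g x)"
  by (simp add: smooth_on_def Ck_on_add)

lemma smooth_on_sum:
  "open S \<Longrightarrow> (\<And>i. i \<in> I \<Longrightarrow> smooth_on S (f i)) \<Longrightarrow> smooth_on S (\<lambda>x. \<Sum>i\<in>I. f i x)"
  by (simp add: smooth_on_def Ck_on_sum)

lemma smooth_on_scaleR:
  fixes f :: "_ \<Rightarrow> real"
  shows "open S \<Longrightarrow> smooth_on S f \<Longrightarrow> smooth_on S g \<Longrightarrow> smooth_on S (\<lambda>x. f x *\<^sub>R g x)"
  by (simp add: smooth_on_def Ck_on_scaleR)

lemma smooth_on_mult:
  fixes f g :: "_ \<Rightarrow> real"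
  shows "open S \<Longrightarrow> smooth_on S f \<Longrightarrow> smooth_on S g \<Longrightarrow> smooth_on S (\<lambda>x. f x * g x)"
  using smooth_on_scaleR[of S f g] by simp

lemma smooth_on_compose:
  fixes f :: "'a::real_normed_vector \<Rightarrow> 'b::euclidean_space"
  assumes "open S" "open T" "\<And>x. x \<in> S \<Longrightarrow> f x \<in> T" "smooth_on S f" "smooth_on T g"
  shows "smooth_on S (\<lambda>x. g (f x))"
  using assms Ck_on_compose unfolding smooth_on_def by blast

lemma smooth_on_inverse:
  fixes f :: "'a::real_normed_vector \<Rightarrow> real"
  assumes "open S" "smooth_on S f" "\<And>x. x \<in> S \<Longrightarrow> f x \<noteq> 0"
  shows "smooth_on S (\<lambda>x. inverse (f x))"
  by (rule smooth_on_compose[OF assms(1), of "- {0}"])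
    (use assms Ck_on_inverse in \<open>auto simp: smooth_on_def\<close>)

lemma smooth_on_Pair:
  assumes "open S" "smooth_on S f" "smooth_on S g"
  shows "smooth_on S (\<lambda>x. (f x, g x))"
proof -
  have l: "bounded_linear (\<lambda>x. (x, 0))" "bounded_linear (\<lambda>x. (0, x))"
    by (auto intro: bounded_linear_Pair bounded_linear_ident bounded_linear_zero)
  have "smooth_on S (\<lambda>x. (f x, 0) + (0, g x))"
    by (intro smooth_on_add smooth_on_bounded_linear[OF _ l(1)] smooth_on_bounded_linear[OF _ l(2)] assms)
  then show ?thesis by simp
qed

lemma smooth_on_slices:
  fixes G :: "'a::euclidean_space \<times> 'b::euclidean_space \<Rightarrow> 'c::real_normed_vector"
  assumes "open N" "open M" "smooth_on (N \<times> M) G"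
  shows "z \<in> M \<Longrightarrow> smooth_on N (\<lambda>y. G (y, z))" "y \<in> N \<Longrightarrow> smooth_on M (\<lambda>z. G (y, z))"
proof -
  have o: "open (N \<times> M)" using assms by (intro open_Times)
  show "smooth_on N (\<lambda>y. G (y, z))" if "z \<in> M"
    by (rule smooth_on_compose[OF assms(1) o _ smooth_on_Pair[OF assms(1) smooth_on_ident smooth_on_const] assms(3)])
      (use that in auto)
  show "smooth_on M (\<lambda>z. G (y, z))" if "y \<in> N"
    by (rule smooth_on_compose[OF assms(2) o _ smooth_on_Pair[OF assms(2) smooth_on_const smooth_on_ident] assms(3)])
      (use that in auto)
qed

lemma has_derivative_slices:
  fixes G :: "'a::real_normed_vector \<times> 'b::real_normed_vector \<Rightarrow> 'c::real_normed_vector"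
  assumes "smooth_on S G" "(y, z) \<in> S"
  shows "((\<lambda>y. G (y, z)) has_derivative (\<lambda>w. frechet_derivative G (at (y, z)) (w, 0))) (at y)"
    "((\<lambda>z. G (y, z)) has_derivative (\<lambda>w. frechet_derivative G (at (y, z)) (0, w))) (at z)"
proof -
  have G: "(G has_derivative frechet_derivative G (at (y, z))) (at (y, z))"
    using smooth_on_has_derivative[OF assms] .
  have "((\<lambda>y. (y, z)) has_derivative (\<lambda>w. (w, 0))) (at y)"
    "((\<lambda>z. (y, z)) has_derivative (\<lambda>w. (0, w))) (at z)"
    by (auto intro!: derivative_eq_intros)
  from has_derivative_compose[OF this(1) G] has_derivative_compose[OF this(2) G]
  show "((\<lambda>y. G (y, z)) has_derivative (\<lambda>w. frechet_derivative G (at (y, z)) (w, 0))) (at y)"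
    "((\<lambda>z. G (y, z)) has_derivative (\<lambda>w. frechet_derivative G (at (y, z)) (0, w))) (at z)"
    by simp_all
qed

subsection \<open>Symmetry of second derivatives\<close>

lemma has_real_derivative_along_line:
  assumes "f differentiable at (x + s *\<^sub>R u)"
  shows "((\<lambda>s. f (x + s *\<^sub>R u)) has_real_derivative frechet_derivative f (at (x + s *\<^sub>R u)) u) (at s)"
proof -
  let ?D = "frechet_derivative f (at (x + s *\<^sub>R u))"
  have "((\<lambda>s. x + s *\<^sub>R u) has_derivative (\<lambda>r. r *\<^sub>R u)) (at s)"
    by (auto intro!: derivative_eq_intros)
  then have "((\<lambda>s. f (x + s *\<^sub>R u)) has_derivative (\<lambda>r. ?D (r *\<^sub>R u))) (at s)"
    using assms frechet_derivative_works has_derivative_compose by fastforce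
  moreover have "?D (r *\<^sub>R u) = ?D u * r" for r
    using linear_scale[OF linear_frechet_derivative[OF assms]] by simp
  ultimately show ?thesis by (simp add: has_field_derivative_def)
qed

text \<open>Two mean value theorems: the second difference is the increment over [0, h] of a
  function of s, and the derivative of that function is itself an increment, in the direction v, of
  the derivative of \<open>f\<close> along u.\<close>

lemma second_difference_mean_value:
  fixes f :: "'a::real_normed_vector \<Rightarrow> real"
  assumes "smooth_on S f" "0 < h"
    and S: "\<And>s t. 0 \<le> s \<Longrightarrow> s \<le> h \<Longrightarrow> 0 \<le> t \<Longrightarrow> t \<le> h \<Longrightarrow> x + s *\<^sub>R u + t *\<^sub>R v \<in> S"
  shows "\<exists>s t. 0 < s \<and> s < h \<and> 0 < t \<and> t < h \<and>
    f (x + h *\<^sub>R u + h *\<^sub>R v) - f (x + h *\<^sub>R u) - f (x + h *\<^sub>R v) + f x =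
    h * (h * frechet_derivative (\<lambda>y. frechet_derivative f (at y) u)
                (at (x + s *\<^sub>R u + t *\<^sub>R v)) v)"
proof -
  let ?D = "\<lambda>y. frechet_derivative f (at y) u"
  have d: "f differentiable at (x + t *\<^sub>R v + s *\<^sub>R u)" "?D differentiable at (x + s *\<^sub>R u + t *\<^sub>R v)"
    if "0 \<le> s" "s \<le> h" "0 \<le> t" "t \<le> h" for s t
  proof -
    have "x + t *\<^sub>R v + s *\<^sub>R u = x + s *\<^sub>R u + t *\<^sub>R v" by simp
    then show "f differentiable at (x + t *\<^sub>R v + s *\<^sub>R u)"
      using S[OF that] smooth_on_differentiable[OF assms(1)] by metis
    show "?D differentiable at (x + s *\<^sub>R u + t *\<^sub>R v)"
      using S[OF that] by (rule smooth_on_differentiable[OF smooth_on_frechet_derivative[OF assms(1)]])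
  qed
  \<comment> \<open>The term \<open>0 *\<^sub>R v\<close> gives both summands the shape that
    \<open>d\<close> treats.\<close>
  define k where "k s = f (x + h *\<^sub>R v + s *\<^sub>R u) - f (x + 0 *\<^sub>R v + s *\<^sub>R u)" for s
  have "\<exists>s>0. s < h \<and> k h - k 0 = (h - 0) * (?D (x + h *\<^sub>R v + s *\<^sub>R u) - ?D (x + 0 *\<^sub>R v + s *\<^sub>R u))"
  proof (rule MVT2[OF assms(2)])
    fix s assume "0 \<le> s" "s \<le> h"
    then show "(k has_real_derivative ?D (x + h *\<^sub>R v + s *\<^sub>R u) - ?D (x + 0 *\<^sub>R v + s *\<^sub>R u)) (at s)"
      unfolding k_def using assms(2) by (intro DERIV_diff has_real_derivative_along_line d) simp_all
  qed
  then obtain s where s: "0 < s" "s < h"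
    "k h - k 0 = h * (?D (x + h *\<^sub>R v + s *\<^sub>R u) - ?D (x + s *\<^sub>R u))" by auto
  have "\<exists>t>0. t < h \<and> ?D (x + s *\<^sub>R u + h *\<^sub>R v) - ?D (x + s *\<^sub>R u + 0 *\<^sub>R v) =
     (h - 0) * frechet_derivative ?D (at (x + s *\<^sub>R u + t *\<^sub>R v)) v"
  proof (rule MVT2[OF assms(2)])
    fix t assume "0 \<le> t" "t \<le> h"
    then show "((\<lambda>t. ?D (x + s *\<^sub>R u + t *\<^sub>R v)) has_real_derivative
        frechet_derivative ?D (at (x + s *\<^sub>R u + t *\<^sub>R v)) v) (at t)"
      using s by (intro has_real_derivative_along_line d) simp_all
  qed
  then obtain t where t: "0 < t" "t < h" "?D (x + s *\<^sub>R u + h *\<^sub>R v) - ?D (x + s *\<^sub>R u) =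
     h * frechet_derivative ?D (at (x + s *\<^sub>R u + t *\<^sub>R v)) v" by auto
  have "k h - k 0 = f (x + h *\<^sub>R u + h *\<^sub>R v) - f (x + h *\<^sub>R u) - f (x + h *\<^sub>R v) + f x"
    by (simp add: k_def algebra_simps)
  moreover have "x + h *\<^sub>R v + s *\<^sub>R u = x + s *\<^sub>R u + h *\<^sub>R v" by simp
  ultimately show ?thesis using s t by (intro exI[of _ s] exI[of _ t]) auto
qed

text \<open>Schwarz's theorem. The second difference is symmetric in u and v, so reading it in both
  orders equates the two mixed derivatives at two points near x; their continuity moves the equality
  to x up to any e.\<close>

lemma frechet_derivative_commute:
  fixes f :: "'a::real_normed_vector \<Rightarrow> real"
  assumes "open S" "smooth_on S f" "x \<in> S"
  shows "frechet_derivative (\<lambda>y. frechet_derivative f (at y) u) (at x) v =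
         frechet_derivative (\<lambda>y. frechet_derivative f (at y) v) (at x) u"
proof -
  define P where "P u v y = frechet_derivative (\<lambda>y. frechet_derivative f (at y) u) (at y) v" for u v y
  have cont: "isCont (P u v) x" for u v
    using smooth_on_continuous_on[OF smooth_on_frechet_derivative[OF smooth_on_frechet_derivative[OF assms(2)]]]
      assms(1,3) continuous_on_eq_continuous_at unfolding P_def by blast
  have "\<bar>P u v x - P v u x\<bar> \<le> e" if "e > 0" for e
  proof -
    have e: "e / 2 > 0" using that by simp
    obtain d1 where d1: "d1 > 0" "\<And>y. dist y x < d1 \<Longrightarrow> dist (P u v y) (P u v x) < e / 2"
      using cont[of u v, unfolded continuous_at_eps_delta, rule_format, OF e] by blast
    obtain d2 where d2: "d2 > 0" "\<And>y. dist y x < d2 \<Longrightarrow> dist (P v u y) (P v u x) < e / 2"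
      using cont[of v u, unfolded continuous_at_eps_delta, rule_format, OF e] by blast
    obtain d3 where d3: "d3 > 0" "\<And>y. dist y x < d3 \<Longrightarrow> y \<in> S"
      using assms(1,3) open_dist by metis
    define d where "d = min d1 (min d2 d3)"
    \<comment> \<open>The summand 1 keeps the denominator positive when u and v vanish; the factor 2
      makes the bound by \<open>d\<close> strict.\<close>
    define h where "h = d / (2 * (norm u + norm v + 1))"
    have d: "d > 0" using d1 d2 d3 by (simp add: d_def)
    have p: "2 * (norm u + norm v + 1) > 0" by (simp add: add_nonneg_pos)
    have h: "h > 0" using d p unfolding h_def by (rule divide_pos_pos)
    have h2: "h * (norm u + norm v) < d"
    proof -
      have "h * (2 * (norm u + norm v + 1)) = d" using p unfolding h_def by simp
      moreover have "h * (norm u + norm v) < h * (2 * (norm u + norm v + 1))"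
        using p by (intro mult_strict_left_mono h) simp
      ultimately show ?thesis by simp
    qed
    have near: "dist (x + s *\<^sub>R u + t *\<^sub>R v) x < d" if "0 \<le> s" "s \<le> h" "0 \<le> t" "t \<le> h" for s t
    proof -
      have "dist (x + s *\<^sub>R u + t *\<^sub>R v) x \<le> s * norm u + t * norm v"
        using norm_triangle_ineq[of "s *\<^sub>R u" "t *\<^sub>R v"] that by (simp add: dist_norm)
      also have "\<dots> \<le> h * norm u + h * norm v"
        using that by (intro add_mono mult_right_mono) auto
      finally show ?thesis using h2 by (simp add: algebra_simps)
    qed
    have near': "dist (x + s *\<^sub>R v + t *\<^sub>R u) x < d" if "0 \<le> s" "s \<le> h" "0 \<le> t" "t \<le> h" for s t
      using near[OF that(3,4,1,2)] by (simp add: algebra_simps)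
    let ?\<Delta> = "f (x + h *\<^sub>R u + h *\<^sub>R v) - f (x + h *\<^sub>R u) - f (x + h *\<^sub>R v) + f x"
    obtain s t where 1: "0 < s" "s < h" "0 < t" "t < h" "?\<Delta> = h * (h * P u v (x + s *\<^sub>R u + t *\<^sub>R v))"
      using second_difference_mean_value[OF assms(2) h, of x u v] near d3 unfolding P_def d_def by force
    obtain s' t' where 2: "0 < s'" "s' < h" "0 < t'" "t' < h"
      "f (x + h *\<^sub>R v + h *\<^sub>R u) - f (x + h *\<^sub>R v) - f (x + h *\<^sub>R u) + f x =
       h * (h * P v u (x + s' *\<^sub>R v + t' *\<^sub>R u))"
      using second_difference_mean_value[OF assms(2) h, of x v u] near' d3 unfolding P_def d_def by force
    have "f (x + h *\<^sub>R v + h *\<^sub>R u) = f (x + h *\<^sub>R u + h *\<^sub>R v)"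
      by (rule arg_cong[of _ _ f]) simp
    then have "h * (h * P v u (x + s' *\<^sub>R v + t' *\<^sub>R u)) = h * (h * P u v (x + s *\<^sub>R u + t *\<^sub>R v))"
      using 1(5) 2(5) by linarith
    then have eq: "P v u (x + s' *\<^sub>R v + t' *\<^sub>R u) = P u v (x + s *\<^sub>R u + t *\<^sub>R v)"
      using h by simp
    have "dist (P u v (x + s *\<^sub>R u + t *\<^sub>R v)) (P u v x) < e / 2"
      using near[of s t] 1 by (intro d1) (auto simp: d_def)
    moreover have "dist (P v u (x + s' *\<^sub>R v + t' *\<^sub>R u)) (P v u x) < e / 2"
      using near'[of s' t'] 2 by (intro d2) (auto simp: d_def)
    ultimately show ?thesis unfolding dist_real_def eq by linarith
  qed
  then have "\<bar>P u v x - P v u x\<bar> \<le> 0" by (rule field_le_epsilon) simp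
  then show ?thesis by (simp add: P_def)
qed

section \<open>Smooth functions on manifolds\<close>

text \<open>The calculus is built on compatibility of charts alone, so that open subsets, products
  and tangent bundles become instances as soon as their charts are checked.\<close>

locale smooth_atlas =
  fixes A :: "('p, 'e::euclidean_space) atlas"
  assumes inj_chart: "(U, \<phi>) \<in> A \<Longrightarrow> inj_on \<phi> U"
    and open_overlap: "(U, \<phi>) \<in> A \<Longrightarrow> (V, \<psi>) \<in> A \<Longrightarrow> open (\<phi> ` (U \<inter> V))"
    and smooth_transition:
      "(U, \<phi>) \<in> A \<Longrightarrow> (V, \<psi>) \<in> A \<Longrightarrow> smooth_on (\<phi> ` (U \<inter> V)) (\<psi> \<circ> inv_into U \<phi>)"

lemma smooth_manifold_smooth_atlas: "smooth_manifold A \<Longrightarrow> smooth_atlas A"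
  unfolding smooth_manifold_def smooth_atlas_def by fast

context smooth_atlas
begin

lemma open_chart_image: "(U, \<phi>) \<in> A \<Longrightarrow> open (\<phi> ` U)"
  using open_overlap[of U \<phi> U \<phi>] by simp

text \<open>\<open>mtopology\<close> can be unfolded only once its family of sets is known to be a
  topology. Closure under intersection is where injectivity of the charts enters: images then
  commute with intersections.\<close>

lemma openin_iff:
  "openin (mtopology A) S \<longleftrightarrow> S \<subseteq> mcarrier A \<and> (\<forall>(U, \<phi>)\<in>A. open (\<phi> ` (S \<inter> U)))"
proof -
  have "istopology (\<lambda>S. S \<subseteq> mcarrier A \<and> (\<forall>(U, \<phi>)\<in>A. open (\<phi> ` (S \<inter> U))))"
    unfolding istopology_def
  proof (intro conjI allI impI ballI, goal_cases)
    case (2 S T x)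
    have "open (\<phi> ` (S \<inter> T \<inter> U))" if "(U, \<phi>) \<in> A" for U \<phi>
    proof -
      have "\<phi> ` (S \<inter> T \<inter> U) = \<phi> ` (S \<inter> U) \<inter> \<phi> ` (T \<inter> U)"
        using inj_chart[OF that] by (auto simp: inj_on_def)
      then show ?thesis using 2 that by auto
    qed
    then show ?case using 2 by (cases x) auto
  next
    case (4 K x)
    have "open (\<phi> ` (\<Union>K \<inter> U))" if "(U, \<phi>) \<in> A" for U \<phi>
    proof -
      have "\<phi> ` (\<Union>K \<inter> U) = (\<Union>S\<in>K. \<phi> ` (S \<inter> U))" by auto
      moreover have "open (\<phi> ` (S \<inter> U))" if "S \<in> K" for S
        using 4(1) \<open>(U, \<phi>) \<in> A\<close> that by blast
      ultimately show ?thesis by auto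
    qed
    then show ?case using 4 by (cases x) auto
  qed auto
  then show ?thesis unfolding mtopology_def by (simp add: topology_inverse')
qed

lemma openin_image: "(U, \<phi>) \<in> A \<Longrightarrow> openin (mtopology A) W \<Longrightarrow> open (\<phi> ` (U \<inter> W))"
  unfolding openin_iff by (auto simp: Int_commute)

lemma chart_subset: "(U, \<phi>) \<in> A \<Longrightarrow> U \<subseteq> mcarrier A"
  by (auto simp: mcarrier_def)

lemma openin_chart: "(U, \<phi>) \<in> A \<Longrightarrow> openin (mtopology A) U"
  unfolding openin_iff using open_overlap chart_subset by (auto simp: Int_commute)

lemma openin_mcarrier: "openin (mtopology A) (mcarrier A)"
proof -
  have "mcarrier A \<inter> U = U" if "(U, \<phi>) \<in> A" for U and \<phi> :: "'p \<Rightarrow> 'e"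
    using chart_subset[OF that] by auto
  then show ?thesis unfolding openin_iff using open_chart_image by auto
qed

lemma topspace_mtopology: "topspace (mtopology A) = mcarrier A"
  using openin_mcarrier openin_iff by (metis openin_subset openin_topspace subset_antisym)

lemma openin_subset_mcarrier: "openin (mtopology A) W \<Longrightarrow> W \<subseteq> mcarrier A"
  unfolding openin_iff by simp

lemma ex_chart: "p \<in> mcarrier A \<Longrightarrow> \<exists>U \<phi>. (U, \<phi>) \<in> A \<and> p \<in> U"
  by (auto simp: mcarrier_def)

lemma inv_chart: "(U, \<phi>) \<in> A \<Longrightarrow> x \<in> U \<Longrightarrow> inv_into U \<phi> (\<phi> x) = x"
  using inj_chart by (simp add: inv_into_f_f)

text \<open>Seen in another chart, the set is the preimage of \<open>N\<close> under a transition
  map, which is continuous on an open set.\<close>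

lemma openin_inv_chart:
  assumes "(U, \<phi>) \<in> A" "open N" "N \<subseteq> \<phi> ` U"
  shows "openin (mtopology A) (inv_into U \<phi> ` N)"
  unfolding openin_iff
proof (intro conjI ballI, goal_cases)
  case 1
  have "inv_into U \<phi> ` N \<subseteq> U" using assms(3) by (auto intro: inv_into_into)
  then show ?case using chart_subset[OF assms(1)] by auto
next
  case (2 z)
  obtain V \<psi> where z: "z = (V, \<psi>)" by force
  with 2 have V: "(V, \<psi>) \<in> A" by simp
  have "\<psi> ` (inv_into U \<phi> ` N \<inter> V) = \<psi> ` (V \<inter> U) \<inter> (\<phi> \<circ> inv_into V \<psi>) -` N"
  proof (intro equalityI subsetI, goal_cases)
    case (1 y)
    then obtain n where "n \<in> N" "inv_into U \<phi> n \<in> V" "y = \<psi> (inv_into U \<phi> n)" by auto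
    moreover have "inv_into U \<phi> n \<in> U" "\<phi> (inv_into U \<phi> n) = n"
      using \<open>n \<in> N\<close> assms(3) by (auto intro: inv_into_into f_inv_into_f)
    ultimately show ?case by (auto simp: inv_chart[OF V])
  next
    case (2 y)
    then obtain x where "x \<in> V" "x \<in> U" "y = \<psi> x" "\<phi> x \<in> N" by (auto simp: inv_chart[OF V])
    then show ?case using inv_chart[OF assms(1) \<open>x \<in> U\<close>] by (metis IntI image_eqI)
  qed
  moreover have "open (\<psi> ` (V \<inter> U) \<inter> (\<phi> \<circ> inv_into V \<psi>) -` N)"
    using smooth_transition[OF V assms(1)] open_overlap[OF V assms(1)] assms(2)
    by (intro continuous_open_preimage smooth_on_continuous_on)
  ultimately show ?case by (simp add: z)
qed

text \<open>One chart is enough, because the expressions in all other charts arise by composition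
  with smooth transition maps. Smoothness at a point is established and used in this form.\<close>

lemma smooth_at_iff_chart:
  assumes "(U, \<phi>) \<in> A" "p \<in> U"
  shows "smooth_at A p f \<longleftrightarrow>
    (\<exists>N. open N \<and> \<phi> p \<in> N \<and> N \<subseteq> \<phi> ` U \<and> smooth_on N (f \<circ> inv_into U \<phi>))"
proof
  assume "smooth_at A p f"
  then obtain W where "p \<in> W" "smooth_fun A W f" by (auto simp: smooth_at_def)
  then show "\<exists>N. open N \<and> \<phi> p \<in> N \<and> N \<subseteq> \<phi> ` U \<and> smooth_on N (f \<circ> inv_into U \<phi>)"
    using assms openin_image[OF assms(1)]
    by (intro exI[of _ "\<phi> ` (U \<inter> W)"]) (auto simp: smooth_fun_def)
next
  assume "\<exists>N. open N \<and> \<phi> p \<in> N \<and> N \<subseteq> \<phi> ` U \<and> smooth_on N (f \<circ> inv_into U \<phi>)"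
  then obtain N where N: "open N" "\<phi> p \<in> N" "N \<subseteq> \<phi> ` U" "smooth_on N (f \<circ> inv_into U \<phi>)" by auto
  let ?W = "inv_into U \<phi> ` N"
  have W: "openin (mtopology A) ?W" using openin_inv_chart[OF assms(1) N(1,3)] .
  have WU: "?W \<subseteq> U" using N(3) by (auto intro: inv_into_into)
  have "smooth_on (\<psi> ` (V \<inter> ?W)) (f \<circ> inv_into V \<psi>)" if V: "(V, \<psi>) \<in> A" for V \<psi>
  proof -
    have o: "open (\<psi> ` (V \<inter> ?W))" using openin_image[OF V W] .
    have in_N: "\<phi> x \<in> N" if "x \<in> ?W" for x using that N(3) by (auto simp: f_inv_into_f subset_iff)
    have "smooth_on (\<psi> ` (V \<inter> ?W)) (\<lambda>y. (f \<circ> inv_into U \<phi>) ((\<phi> \<circ> inv_into V \<psi>) y))"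
    proof (rule smooth_on_compose[OF o N(1)])
      show "smooth_on (\<psi> ` (V \<inter> ?W)) (\<phi> \<circ> inv_into V \<psi>)"
        using WU by (intro smooth_on_subset[OF smooth_transition[OF V assms(1)]]) auto
    qed (use in_N inv_chart[OF V] N(4)[unfolded o_def] in \<open>auto simp: o_def\<close>)
    moreover have "(f \<circ> inv_into U \<phi>) ((\<phi> \<circ> inv_into V \<psi>) y) = (f \<circ> inv_into V \<psi>) y"
      if "y \<in> \<psi> ` (V \<inter> ?W)" for y
      using that WU inv_chart[OF V] inv_chart[OF assms(1)] by (auto simp: subset_iff)
    ultimately show ?thesis using smooth_on_cong[OF o] by (metis (no_types, lifting))
  qed
  then have "smooth_fun A ?W f" using W by (auto simp: smooth_fun_def)
  moreover have "p \<in> ?W" using N(2) inv_chart[OF assms] by (metis image_eqI)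
  ultimately show "smooth_at A p f" by (auto simp: smooth_at_def)
qed

lemma smooth_fun_subset:
  assumes "smooth_fun A W f" "openin (mtopology A) W'" "W' \<subseteq> W"
  shows "smooth_fun A W' f"
  using assms unfolding smooth_fun_def by (fastforce intro: smooth_on_subset)

lemma smooth_fun_cong:
  assumes "\<And>x. x \<in> W \<Longrightarrow> f x = g x"
  shows "smooth_fun A W f \<longleftrightarrow> smooth_fun A W g"
proof (cases "openin (mtopology A) W")
  case True
  have "smooth_on (\<phi> ` (U \<inter> W)) (f \<circ> inv_into U \<phi>) \<longleftrightarrow> smooth_on (\<phi> ` (U \<inter> W)) (g \<circ> inv_into U \<phi>)"
    if "(U, \<phi>) \<in> A" for U \<phi>
    using assms by (intro smooth_on_cong openin_image[OF that True]) (auto simp: inv_chart[OF that])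
  then show ?thesis unfolding smooth_fun_def by fast
qed (simp add: smooth_fun_def)

lemma smooth_at_cong:
  assumes "openin (mtopology A) W" "p \<in> W" "\<And>x. x \<in> W \<Longrightarrow> f x = g x"
  shows "smooth_at A p f \<longleftrightarrow> smooth_at A p g"
proof -
  have "smooth_at A p k" if h: "smooth_at A p h" and eq: "\<And>x. x \<in> W \<Longrightarrow> h x = k x" for h k
  proof -
    obtain W' where W': "p \<in> W'" "smooth_fun A W' h" using h by (auto simp: smooth_at_def)
    then have "openin (mtopology A) (W' \<inter> W)" using assms(1) by (auto simp: smooth_fun_def)
    then have "smooth_fun A (W' \<inter> W) h" using W'(2) smooth_fun_subset by blast
    then have "smooth_fun A (W' \<inter> W) k" using smooth_fun_cong[of "W' \<inter> W" h k] eq by auto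
    then show ?thesis using W' assms(2) by (auto simp: smooth_at_def)
  qed
  then show ?thesis using assms(3) by metis
qed

lemma smooth_fun_iff_smooth_at:
  assumes "openin (mtopology A) W"
  shows "smooth_fun A W f \<longleftrightarrow> (\<forall>p\<in>W. smooth_at A p f)"
proof
  assume *: "\<forall>p\<in>W. smooth_at A p f"
  have "smooth_on (\<phi> ` (U \<inter> W)) (f \<circ> inv_into U \<phi>)" if U: "(U, \<phi>) \<in> A" for U \<phi>
  proof (rule smooth_on_locally)
    fix y assume "y \<in> \<phi> ` (U \<inter> W)"
    then obtain p where p: "p \<in> U" "p \<in> W" "y = \<phi> p" by auto
    then show "\<exists>N. open N \<and> y \<in> N \<and> smooth_on N (f \<circ> inv_into U \<phi>)"
      using * smooth_at_iff_chart[OF U p(1)] by blast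
  qed
  then show "smooth_fun A W f" using assms by (auto simp: smooth_fun_def)
qed (auto simp: smooth_at_def)

lemma smooth_at_nhd:
  assumes "smooth_at A p f"
  obtains W where "openin (mtopology A) W" "p \<in> W" "\<And>x. x \<in> W \<Longrightarrow> smooth_at A x f"
  using assms unfolding smooth_at_def by (metis smooth_fun_def)

lemma smooth_at_mcarrier: "smooth_at A p f \<Longrightarrow> p \<in> mcarrier A"
  using openin_subset_mcarrier by (auto simp: smooth_at_def smooth_fun_def)

lemma smooth_at_chart_coord:
  assumes "(U, \<phi>) \<in> A" "p \<in> U"
  shows "smooth_at A p (\<lambda>x. \<phi> x \<bullet> b)"
proof -
  have o: "open (\<phi> ` U)" using open_chart_image[OF assms(1)] .
  have "smooth_on (\<phi> ` U) (\<lambda>y. y \<bullet> b)"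
    by (rule smooth_on_bounded_linear[OF o bounded_linear_inner_left smooth_on_ident])
  then have "smooth_on (\<phi> ` U) ((\<lambda>x. \<phi> x \<bullet> b) \<circ> inv_into U \<phi>)"
    by (subst smooth_on_cong[OF o]) (auto simp: f_inv_into_f)
  then show ?thesis using smooth_at_iff_chart[OF assms] o assms(2) by blast
qed

lemma smooth_at_const:
  assumes "p \<in> mcarrier A"
  shows "smooth_at A p (\<lambda>x. c)"
proof -
  obtain U \<phi> where U: "(U, \<phi>) \<in> A" "p \<in> U" using ex_chart[OF assms] by blast
  have "smooth_on (\<phi> ` U) ((\<lambda>x. c) \<circ> inv_into U \<phi>)" by (simp add: o_def smooth_on_const)
  then show ?thesis using smooth_at_iff_chart[OF U] open_chart_image[OF U(1)] U(2) by blast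
qed

text \<open>The two germs live on different neighbourhoods; the operation is carried out on the
  intersection, in one common chart.\<close>

lemma smooth_at_binop:
  assumes "smooth_at A p f" "smooth_at A p g"
    and "\<And>N f g :: 'e \<Rightarrow> real. open N \<Longrightarrow> smooth_on N f \<Longrightarrow> smooth_on N g \<Longrightarrow> smooth_on N (\<lambda>x. op (f x) (g x))"
  shows "smooth_at A p (\<lambda>x. op (f x) (g x))"
proof -
  obtain U \<phi> where U: "(U, \<phi>) \<in> A" "p \<in> U" using ex_chart[OF smooth_at_mcarrier[OF assms(1)]] by blast
  obtain N M where "open N" "\<phi> p \<in> N" "N \<subseteq> \<phi> ` U" "smooth_on N (f \<circ> inv_into U \<phi>)"
    "open M" "\<phi> p \<in> M" "smooth_on M (g \<circ> inv_into U \<phi>)"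
    using assms smooth_at_iff_chart[OF U] by meson
  then have "open (N \<inter> M)" "\<phi> p \<in> N \<inter> M" "N \<inter> M \<subseteq> \<phi> ` U"
    "smooth_on (N \<inter> M) (f \<circ> inv_into U \<phi>)" "smooth_on (N \<inter> M) (g \<circ> inv_into U \<phi>)"
    by (auto intro: smooth_on_subset)
  moreover from this have "smooth_on (N \<inter> M) (\<lambda>x. op ((f \<circ> inv_into U \<phi>) x) ((g \<circ> inv_into U \<phi>) x))"
    by (intro assms(3))
  ultimately show ?thesis using smooth_at_iff_chart[OF U] by (auto simp: o_def)
qed

lemma smooth_at_add: "smooth_at A p f \<Longrightarrow> smooth_at A p g \<Longrightarrow> smooth_at A p (\<lambda>x. f x + g x)"
  by (rule smooth_at_binop[where op = "(+)"]) (auto intro: smooth_on_add)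

lemma smooth_at_mult: "smooth_at A p f \<Longrightarrow> smooth_at A p g \<Longrightarrow> smooth_at A p (\<lambda>x. f x * g x)"
  by (rule smooth_at_binop[where op = "(*)"]) (auto intro: smooth_on_mult)

lemma smooth_at_sum:
  "p \<in> mcarrier A \<Longrightarrow> (\<And>i. i \<in> I \<Longrightarrow> smooth_at A p (f i)) \<Longrightarrow> smooth_at A p (\<lambda>x. \<Sum>i\<in>I. f i x)"
  by (induction I rule: infinite_finite_induct) (auto intro: smooth_at_const smooth_at_add)

lemma smooth_at_prod:
  "p \<in> mcarrier A \<Longrightarrow> (\<And>i. i \<in> I \<Longrightarrow> smooth_at A p (f i)) \<Longrightarrow> smooth_at A p (\<lambda>x. \<Prod>i\<in>I. f i x)"
  by (induction I rule: infinite_finite_induct) (auto intro: smooth_at_const smooth_at_mult)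

lemma smooth_at_minus: "smooth_at A p f \<Longrightarrow> smooth_at A p (\<lambda>x. - f x)"
  using smooth_at_mult[OF smooth_at_const[of p "-1"]] smooth_at_mcarrier by force

lemma smooth_at_inverse:
  assumes "smooth_at A p f" "f p \<noteq> 0"
  shows "smooth_at A p (\<lambda>x. inverse (f x))"
proof -
  obtain U \<phi> where U: "(U, \<phi>) \<in> A" "p \<in> U" using ex_chart[OF smooth_at_mcarrier[OF assms(1)]] by blast
  obtain N where N: "open N" "\<phi> p \<in> N" "N \<subseteq> \<phi> ` U" "smooth_on N (f \<circ> inv_into U \<phi>)"
    using assms(1) smooth_at_iff_chart[OF U] by meson
  define M where "M = N \<inter> (f \<circ> inv_into U \<phi>) -` (- {0})"
  have "open M" unfolding M_def
    using N by (intro continuous_open_preimage smooth_on_continuous_on) auto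
  moreover have "\<phi> p \<in> M" "M \<subseteq> \<phi> ` U" using N assms(2) inv_chart[OF U] by (auto simp: M_def)
  moreover have "smooth_on M (f \<circ> inv_into U \<phi>)"
    using N(4) by (rule smooth_on_subset) (auto simp: M_def)
  then have "smooth_on M (\<lambda>x. inverse ((f \<circ> inv_into U \<phi>) x))"
    by (rule smooth_on_inverse[OF \<open>open M\<close>]) (auto simp: M_def)
  ultimately show ?thesis using smooth_at_iff_chart[OF U] by (auto simp: o_def)
qed

subsection \<open>Tangent vectors\<close>

lemma dir_deriv_smooth:
  "smooth_at A p f \<Longrightarrow>
    dir_deriv A U \<phi> p w f = frechet_derivative (f \<circ> inv_into U \<phi>) (at (\<phi> p)) w"
  by (simp add: dir_deriv_def)

lemma smooth_at_has_derivative: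
  assumes "(U, \<phi>) \<in> A" "p \<in> U" "smooth_at A p f"
  shows "((f \<circ> inv_into U \<phi>) has_derivative (\<lambda>w. dir_deriv A U \<phi> p w f)) (at (\<phi> p))"
  using smooth_at_iff_chart[OF assms(1,2)] assms(3) smooth_on_has_derivative
  by (fastforce simp: dir_deriv_smooth)

lemma dir_deriv_eqI:
  assumes "(U, \<phi>) \<in> A" "p \<in> U" "smooth_at A p f"
    "((f \<circ> inv_into U \<phi>) has_derivative D) (at (\<phi> p))"
  shows "dir_deriv A U \<phi> p w f = D w"
  using has_derivative_unique[OF smooth_at_has_derivative[OF assms(1-3)] assms(4)] by metis

text \<open>The chain rule through the transition map turns a vector given in any chart at p into
  one given in the chosen chart. This makes linear algebra possible, since
  \<open>tangent_space\<close> ranges over all charts.\<close>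

lemma tangent_space_chart:
  assumes U: "(U, \<phi>) \<in> A" "p \<in> U"
  shows "tangent_space A p = range (dir_deriv A U \<phi> p)"
proof
  show "range (dir_deriv A U \<phi> p) \<subseteq> tangent_space A p"
    using assms by (auto simp: tangent_space_def)
next
  show "tangent_space A p \<subseteq> range (dir_deriv A U \<phi> p)"
  proof
    fix u assume "u \<in> tangent_space A p"
    then obtain V \<psi> w where V: "(V, \<psi>) \<in> A" "p \<in> V" and u: "u = dir_deriv A V \<psi> p w"
      by (auto simp: tangent_space_def)
    let ?t = "\<phi> \<circ> inv_into V \<psi>"
    let ?w = "frechet_derivative ?t (at (\<psi> p)) w"
    have o: "open (\<psi> ` (V \<inter> U))" using open_overlap V U by blast
    have t: "(?t has_derivative frechet_derivative ?t (at (\<psi> p))) (at (\<psi> p))"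
      using smooth_transition[OF V(1) U(1)] V U by (intro smooth_on_has_derivative) auto
    have "u f = dir_deriv A U \<phi> p ?w f" for f
    proof (cases "smooth_at A p f")
      case True
      have "?t (\<psi> p) = \<phi> p" using inv_chart[OF V] by simp
      then have "((f \<circ> inv_into U \<phi>) has_derivative (\<lambda>w. dir_deriv A U \<phi> p w f)) (at (?t (\<psi> p)))"
        using smooth_at_has_derivative[OF U True] by simp
      then have "((\<lambda>y. (f \<circ> inv_into U \<phi>) (?t y)) has_derivative
          (\<lambda>w. dir_deriv A U \<phi> p (frechet_derivative ?t (at (\<psi> p)) w) f)) (at (\<psi> p))"
        by (rule has_derivative_compose[OF t])
      then have "((f \<circ> inv_into V \<psi>) has_derivative
          (\<lambda>w. dir_deriv A U \<phi> p (frechet_derivative ?t (at (\<psi> p)) w) f)) (at (\<psi> p))"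
        by (rule has_derivative_transform_within_open[OF _ o])
          (use U V in \<open>auto simp: inv_chart[OF V(1)] inv_chart[OF U(1)]\<close>)
      then show ?thesis unfolding u by (rule dir_deriv_eqI[OF V True])
    next
      case False
      then show ?thesis by (simp add: u dir_deriv_def)
    qed
    then show "u \<in> range (dir_deriv A U \<phi> p)" by blast
  qed
qed

lemma tangent_mcarrier: "u \<in> tangent_space A p \<Longrightarrow> p \<in> mcarrier A"
  by (auto simp: tangent_space_def mcarrier_def)

lemma tangent_nonsmooth: "u \<in> tangent_space A p \<Longrightarrow> \<not> smooth_at A p f \<Longrightarrow> u f = 0"
  by (auto simp: tangent_space_def dir_deriv_def)

lemma tangentE:
  assumes "u \<in> tangent_space A p"
  obtains U \<phi> w where "(U, \<phi>) \<in> A" "p \<in> U" "u = dir_deriv A U \<phi> p w"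
  using assms by (auto simp: tangent_space_def)

lemma dir_deriv_linear:
  assumes "(U, \<phi>) \<in> A" "p \<in> U"
  shows "dir_deriv A U \<phi> p (\<Sum>i\<in>I. c i *\<^sub>R w i) f = (\<Sum>i\<in>I. c i * dir_deriv A U \<phi> p (w i) f)"
proof (cases "smooth_at A p f")
  case True
  then have "linear (\<lambda>w. dir_deriv A U \<phi> p w f)"
    using smooth_at_has_derivative[OF assms] has_derivative_linear by blast
  then show ?thesis by (simp only: linear_sum[OF \<open>linear _\<close>] linear_scale[OF \<open>linear _\<close>] real_scaleR_def)
qed (simp add: dir_deriv_def)

lemma lincomb_tangent:
  assumes "p \<in> mcarrier A" "\<And>i. i \<in> I \<Longrightarrow> E i \<in> tangent_space A p"
  shows "lincomb I c E \<in> tangent_space A p"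
proof -
  obtain U \<phi> where U: "(U, \<phi>) \<in> A" "p \<in> U" using ex_chart[OF assms(1)] by blast
  then have "\<forall>i\<in>I. \<exists>w. E i = dir_deriv A U \<phi> p w"
    using assms(2) tangent_space_chart[OF U] by auto
  then obtain w where w: "\<And>i. i \<in> I \<Longrightarrow> E i = dir_deriv A U \<phi> p (w i)" by metis
  have "lincomb I c E f = dir_deriv A U \<phi> p (\<Sum>i\<in>I. c i *\<^sub>R w i) f" for f
    unfolding lincomb_def dir_deriv_linear[OF U] using w by simp
  then have "lincomb I c E = dir_deriv A U \<phi> p (\<Sum>i\<in>I. c i *\<^sub>R w i)" by blast
  then show ?thesis using tangent_space_chart[OF U] by blast
qed

lemma zero_tangent: "p \<in> mcarrier A \<Longrightarrow> (\<lambda>_. 0) \<in> tangent_space A p"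
  using lincomb_tangent[of p "{}"] by (simp add: lincomb_def)

text \<open>Tangent vectors act on germs. Smoothness at p is itself a property of the germ, so the
  default value 0 respects this as well.\<close>

lemma tangent_local:
  assumes "u \<in> tangent_space A p" "openin (mtopology A) W" "p \<in> W" "\<And>x. x \<in> W \<Longrightarrow> f x = g x"
  shows "u f = u g"
proof -
  have iff: "smooth_at A p f \<longleftrightarrow> smooth_at A p g" by (rule smooth_at_cong[OF assms(2-4)])
  show ?thesis
  proof (cases "smooth_at A p f")
    case True
    obtain U \<phi> w where U: "(U, \<phi>) \<in> A" "p \<in> U" and u: "u = dir_deriv A U \<phi> p w"
      using tangentE[OF assms(1)] by blast
    have "((g \<circ> inv_into U \<phi>) has_derivative (\<lambda>w. dir_deriv A U \<phi> p w f)) (at (\<phi> p))"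
      by (rule has_derivative_transform_within_open[OF smooth_at_has_derivative[OF U True]
            openin_image[OF U(1) assms(2)]])
        (use U assms in \<open>auto simp: inv_chart[OF U(1)]\<close>)
    then show ?thesis unfolding u using dir_deriv_eqI[OF U] True iff by metis
  next
    case False
    then show ?thesis using iff tangent_nonsmooth[OF assms(1)] by metis
  qed
qed

lemma tangent_const:
  assumes "u \<in> tangent_space A p" shows "u (\<lambda>x. c) = 0"
proof -
  obtain U \<phi> w where U: "(U, \<phi>) \<in> A" "p \<in> U" and u: "u = dir_deriv A U \<phi> p w"
    using tangentE[OF assms(1)] by blast
  show ?thesis unfolding u
    by (subst dir_deriv_eqI[OF U smooth_at_const, of _ "\<lambda>_. 0"])
      (use assms tangent_mcarrier in \<open>auto simp: o_def\<close>)
qed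

lemma tangent_add:
  assumes "u \<in> tangent_space A p" "smooth_at A p f" "smooth_at A p g"
  shows "u (\<lambda>x. f x + g x) = u f + u g"
proof -
  obtain U \<phi> w where U: "(U, \<phi>) \<in> A" "p \<in> U" and u: "u = dir_deriv A U \<phi> p w"
    using tangentE[OF assms(1)] by blast
  have "((\<lambda>y. (f \<circ> inv_into U \<phi>) y + (g \<circ> inv_into U \<phi>) y) has_derivative
      (\<lambda>w. dir_deriv A U \<phi> p w f + dir_deriv A U \<phi> p w g)) (at (\<phi> p))"
    by (intro has_derivative_add smooth_at_has_derivative U assms)
  then show ?thesis unfolding u
    using dir_deriv_eqI[OF U smooth_at_add[OF assms(2,3)]] by (simp add: o_def)
qed

lemma tangent_mult:
  assumes "u \<in> tangent_space A p" "smooth_at A p f" "smooth_at A p g"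
  shows "u (\<lambda>x. f x * g x) = f p * u g + u f * g p"
proof -
  obtain U \<phi> w where U: "(U, \<phi>) \<in> A" "p \<in> U" and u: "u = dir_deriv A U \<phi> p w"
    using tangentE[OF assms(1)] by blast
  have "((\<lambda>y. (f \<circ> inv_into U \<phi>) y * (g \<circ> inv_into U \<phi>) y) has_derivative
      (\<lambda>w. (f \<circ> inv_into U \<phi>) (\<phi> p) * dir_deriv A U \<phi> p w g +
           dir_deriv A U \<phi> p w f * (g \<circ> inv_into U \<phi>) (\<phi> p))) (at (\<phi> p))"
    by (intro has_derivative_mult smooth_at_has_derivative U assms)
  then show ?thesis unfolding u
    using dir_deriv_eqI[OF U smooth_at_mult[OF assms(2,3)]] by (simp add: o_def inv_chart[OF U])
qed

lemma tangent_minus: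
  assumes "u \<in> tangent_space A p" "smooth_at A p f"
  shows "u (\<lambda>x. - f x) = - u f"
  using tangent_mult[OF assms(1) smooth_at_const[OF tangent_mcarrier[OF assms(1)], of "-1"] assms(2)]
    tangent_const[OF assms(1)] by simp

lemma tangent_sum:
  assumes "u \<in> tangent_space A p" "\<And>i. i \<in> I \<Longrightarrow> smooth_at A p (f i)"
  shows "u (\<lambda>x. \<Sum>i\<in>I. f i x) = (\<Sum>i\<in>I. u (f i))"
  using assms(2)
proof (induction I rule: infinite_finite_induct)
  case (insert i I)
  then show ?case
    using tangent_add[OF assms(1), of "f i" "\<lambda>x. \<Sum>i\<in>I. f i x"] tangent_mcarrier[OF assms(1)]
    by (simp add: smooth_at_sum)
qed (simp_all add: tangent_const[OF assms(1)])

lemma dir_deriv_coord: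
  assumes "(U, \<phi>) \<in> A" "p \<in> U"
  shows "dir_deriv A U \<phi> p w (\<lambda>x. \<phi> x \<bullet> b) = w \<bullet> b"
proof (rule dir_deriv_eqI[OF assms smooth_at_chart_coord[OF assms]])
  have "((\<lambda>y. y \<bullet> b) has_derivative (\<lambda>w. w \<bullet> b)) (at (\<phi> p))"
    by (auto intro!: derivative_eq_intros)
  then show "((\<lambda>x. \<phi> x \<bullet> b) \<circ> inv_into U \<phi> has_derivative (\<lambda>w. w \<bullet> b)) (at (\<phi> p))"
    by (rule has_derivative_transform_within_open[OF _ open_chart_image[OF assms(1)]])
      (use assms in \<open>auto simp: inv_chart[OF assms(1)]\<close>)
qed

end

subsection \<open>Second derivatives along charts\<close>

context smooth_atlas
begin

lemma dir_deriv_smooth_chart: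
  assumes "(U, \<phi>) \<in> A" "p \<in> U" "smooth_at A p f"
  obtains N where "open N" "\<phi> p \<in> N" "N \<subseteq> \<phi> ` U" "smooth_on N (f \<circ> inv_into U \<phi>)"
    "\<And>y w. y \<in> N \<Longrightarrow> dir_deriv A U \<phi> (inv_into U \<phi> y) w f = frechet_derivative (f \<circ> inv_into U \<phi>) (at y) w"
proof -
  obtain N where N: "open N" "\<phi> p \<in> N" "N \<subseteq> \<phi> ` U" "smooth_on N (f \<circ> inv_into U \<phi>)"
    using smooth_at_iff_chart[OF assms(1,2)] assms(3) by meson
  have "dir_deriv A U \<phi> (inv_into U \<phi> y) w f = frechet_derivative (f \<circ> inv_into U \<phi>) (at y) w"
    if y: "y \<in> N" for y w
  proof -
    have p: "inv_into U \<phi> y \<in> U" "\<phi> (inv_into U \<phi> y) = y"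
      using y N(3) by (auto intro: inv_into_into f_inv_into_f)
    have "smooth_at A (inv_into U \<phi> y) f"
      using smooth_at_iff_chart[OF assms(1) p(1)] N y p(2) by metis
    then show ?thesis using p(2) by (simp add: dir_deriv_smooth)
  qed
  then show thesis using N that by blast
qed

lemma smooth_at_dir_deriv:
  assumes "(U, \<phi>) \<in> A" "p \<in> U" "smooth_at A p f"
  shows "smooth_at A p (\<lambda>x. dir_deriv A U \<phi> x w f)"
proof -
  obtain N where N: "open N" "\<phi> p \<in> N" "N \<subseteq> \<phi> ` U" "smooth_on N (f \<circ> inv_into U \<phi>)"
    "\<And>y w. y \<in> N \<Longrightarrow> dir_deriv A U \<phi> (inv_into U \<phi> y) w f = frechet_derivative (f \<circ> inv_into U \<phi>) (at y) w"
    using dir_deriv_smooth_chart[OF assms] by blast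
  have "smooth_on N ((\<lambda>x. dir_deriv A U \<phi> x w f) \<circ> inv_into U \<phi>)"
    using smooth_on_frechet_derivative[OF N(4)] by (subst smooth_on_cong[OF N(1)]) (auto simp: N(5))
  then show ?thesis using N smooth_at_iff_chart[OF assms(1,2)] by blast
qed

text \<open>Schwarz's theorem in the chart: constant coordinate fields commute. Brackets of
  horizontal lifts are vertical for this reason.\<close>

lemma dir_deriv_commute:
  assumes "(U, \<phi>) \<in> A" "p \<in> U" "smooth_at A p f"
  shows "dir_deriv A U \<phi> p v (\<lambda>x. dir_deriv A U \<phi> x w f) =
         dir_deriv A U \<phi> p w (\<lambda>x. dir_deriv A U \<phi> x v f)"
proof -
  obtain N where N: "open N" "\<phi> p \<in> N" "N \<subseteq> \<phi> ` U" "smooth_on N (f \<circ> inv_into U \<phi>)"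
    "\<And>y w. y \<in> N \<Longrightarrow> dir_deriv A U \<phi> (inv_into U \<phi> y) w f = frechet_derivative (f \<circ> inv_into U \<phi>) (at y) w"
    using dir_deriv_smooth_chart[OF assms] by blast
  have "dir_deriv A U \<phi> p v (\<lambda>x. dir_deriv A U \<phi> x w f) =
      frechet_derivative (\<lambda>y. frechet_derivative (f \<circ> inv_into U \<phi>) (at y) w) (at (\<phi> p)) v" for v w
  proof (rule dir_deriv_eqI[OF assms(1,2) smooth_at_dir_deriv[OF assms]])
    have "((\<lambda>y. frechet_derivative (f \<circ> inv_into U \<phi>) (at y) w) has_derivative
       frechet_derivative (\<lambda>y. frechet_derivative (f \<circ> inv_into U \<phi>) (at y) w) (at (\<phi> p))) (at (\<phi> p))"
      using smooth_on_frechet_derivative[OF N(4)] N(2) by (rule smooth_on_has_derivative)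
    then show "((\<lambda>x. dir_deriv A U \<phi> x w f) \<circ> inv_into U \<phi> has_derivative
       frechet_derivative (\<lambda>y. frechet_derivative (f \<circ> inv_into U \<phi>) (at y) w) (at (\<phi> p))) (at (\<phi> p))"
      by (rule has_derivative_transform_within_open[OF _ N(1,2)]) (simp add: N(5))
  qed
  then show ?thesis using frechet_derivative_commute[OF N(1,4,2)] by simp
qed

end

subsection \<open>Germs of smooth maps\<close>

text \<open>Pullback of functions is all that \<open>push\<close> uses, so smoothness of a map at a
  point is tested on functions. Composition becomes immediate; chart expressions are recovered in
  \<open>smooth_germ_chart\<close> where a derivative is wanted.\<close>

definition smooth_germ ::
  "('p, 'e::euclidean_space) atlas \<Rightarrow> ('q, 'f::euclidean_space) atlas \<Rightarrow> ('p \<Rightarrow> 'q) \<Rightarrow> 'p \<Rightarrow> bool" where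
  "smooth_germ A B h p \<longleftrightarrow> (\<forall>f. smooth_at B (h p) f \<longrightarrow> smooth_at A p (f \<circ> h))"

lemma smooth_germD: "smooth_germ A B h p \<Longrightarrow> smooth_at B (h p) f \<Longrightarrow> smooth_at A p (\<lambda>x. f (h x))"
  by (simp add: smooth_germ_def o_def)

lemma smooth_germ_compose:
  "smooth_germ A B h p \<Longrightarrow> smooth_germ B C k (h p) \<Longrightarrow> smooth_germ A C (\<lambda>x. k (h x)) p"
proof -
  assume h: "smooth_germ A B h p" and k: "smooth_germ B C k (h p)"
  have "smooth_at A p (\<lambda>x. f (k (h x)))" if "smooth_at C (k (h p)) f" for f
    using smooth_germD[OF h smooth_germD[OF k that]] .
  then show ?thesis by (simp add: smooth_germ_def o_def)
qed

lemma smooth_germ_ident: "smooth_germ A A (\<lambda>x. x) p"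
  by (simp add: smooth_germ_def o_def)

lemma (in smooth_atlas) smooth_germ_const: "p \<in> mcarrier A \<Longrightarrow> smooth_germ A B (\<lambda>x. c) p"
  by (simp add: smooth_germ_def o_def smooth_at_const)

locale smooth_atlas_pair = A: smooth_atlas A + B: smooth_atlas B
  for A :: "('p, 'e::euclidean_space) atlas" and B :: "('q, 'f::euclidean_space) atlas"
begin

lemma smooth_map_image: "smooth_map A B h \<Longrightarrow> p \<in> mcarrier A \<Longrightarrow> h p \<in> mcarrier B"
  by (auto simp: smooth_map_def continuous_map_def A.topspace_mtopology B.topspace_mtopology)

lemma openin_preimage:
  assumes "smooth_map A B h" "openin (mtopology B) W"
  shows "openin (mtopology A) {x \<in> mcarrier A. h x \<in> W}"
  using assms by (auto simp: smooth_map_def continuous_map_def A.topspace_mtopology)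

lemma smooth_map_germ:
  assumes "smooth_map A B h" "p \<in> mcarrier A"
  shows "smooth_germ A B h p"
  unfolding smooth_germ_def
proof (intro allI impI)
  fix f assume f: "smooth_at B (h p) f"
  obtain U \<phi> where U: "(U, \<phi>) \<in> A" "p \<in> U" using A.ex_chart[OF assms(2)] by blast
  obtain V \<psi> where V: "(V, \<psi>) \<in> B" "h p \<in> V"
    using B.ex_chart[OF smooth_map_image[OF assms]] by blast
  obtain M where M: "open M" "\<psi> (h p) \<in> M" "M \<subseteq> \<psi> ` V" "smooth_on M (f \<circ> inv_into V \<psi>)"
    using f B.smooth_at_iff_chart[OF V] by meson
  define W where "W = {x \<in> mcarrier A. h x \<in> inv_into V \<psi> ` M}"
  have W: "openin (mtopology A) W"
    unfolding W_def using openin_preimage[OF assms(1) B.openin_inv_chart[OF V(1) M(1,3)]] .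
  have "inv_into V \<psi> ` M \<subseteq> V" using M(3) by (auto intro: inv_into_into)
  then have hW: "h x \<in> V" "\<psi> (h x) \<in> M" if "x \<in> W" for x
    using that M(3) by (auto simp: W_def f_inv_into_f subset_iff)
  have "h p \<in> inv_into V \<psi> ` M"
    using imageI[OF M(2), of "inv_into V \<psi>"] B.inv_chart[OF V] by simp
  then have pW: "p \<in> W" using assms(2) by (simp add: W_def)
  have o: "open (\<phi> ` (U \<inter> W))" using A.openin_image[OF U(1) W] .
  have "smooth_on (\<phi> ` (U \<inter> h -` V)) (\<psi> \<circ> h \<circ> inv_into U \<phi>)"
    using assms(1) U(1) V(1) by (auto simp: smooth_map_def)
  then have s: "smooth_on (\<phi> ` (U \<inter> W)) (\<psi> \<circ> h \<circ> inv_into U \<phi>)"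
    by (rule smooth_on_subset) (use hW in auto)
  have "smooth_on (\<phi> ` (U \<inter> W)) (\<lambda>y. (f \<circ> inv_into V \<psi>) ((\<psi> \<circ> h \<circ> inv_into U \<phi>) y))"
    by (rule smooth_on_compose[OF o M(1) _ s M(4)]) (use hW A.inv_chart[OF U(1)] in auto)
  then have "smooth_on (\<phi> ` (U \<inter> W)) ((f \<circ> h) \<circ> inv_into U \<phi>)"
    by (subst (asm) smooth_on_cong[OF o, where g = "(f \<circ> h) \<circ> inv_into U \<phi>"])
      (use hW in \<open>auto simp: A.inv_chart[OF U(1)] B.inv_chart[OF V(1)]\<close>)
  then show "smooth_at A p (f \<circ> h)"
    using A.smooth_at_iff_chart[OF U] o U(2) pW by blast
qed

text \<open>The function which is 0 on a neighbourhood \<open>V\<close> of \<open>h p\<close> and 1 elsewhere is smooth at \<open>h p\<close>, so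
  its pullback is continuous: germs of smooth maps are continuous although this is not required.\<close>

lemma smooth_germ_continuous:
  assumes "smooth_germ A B h p" "openin (mtopology B) V" "h p \<in> V"
  obtains W where "openin (mtopology A) W" "p \<in> W" "\<And>x. x \<in> W \<Longrightarrow> h x \<in> V"
proof -
  define f where "f y = (if y \<in> V then 0 else 1 :: real)" for y
  have "smooth_at B (h p) (\<lambda>_. 0)" using assms B.openin_subset_mcarrier by (blast intro: B.smooth_at_const)
  then have "smooth_at B (h p) f"
    using B.smooth_at_cong[OF assms(2,3), of f "\<lambda>_. 0"] by (simp add: f_def)
  then have s: "smooth_at A p (f \<circ> h)" using assms(1) by (simp add: smooth_germ_def)
  obtain U \<phi> where U: "(U, \<phi>) \<in> A" "p \<in> U" using A.ex_chart[OF A.smooth_at_mcarrier[OF s]] by blast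
  obtain N where N: "open N" "\<phi> p \<in> N" "N \<subseteq> \<phi> ` U" "smooth_on N ((f \<circ> h) \<circ> inv_into U \<phi>)"
    using s A.smooth_at_iff_chart[OF U] by meson
  define M where "M = N \<inter> ((f \<circ> h) \<circ> inv_into U \<phi>) -` {..<1}"
  have "open M" unfolding M_def
    using N by (intro continuous_open_preimage smooth_on_continuous_on) auto
  then have "openin (mtopology A) (inv_into U \<phi> ` M)"
    using N(3) by (intro A.openin_inv_chart[OF U(1)]) (auto simp: M_def)
  moreover have "\<phi> p \<in> M" using N(2) assms(3) by (simp add: M_def A.inv_chart[OF U] f_def)
  then have "p \<in> inv_into U \<phi> ` M" using A.inv_chart[OF U] by (metis image_eqI)
  moreover have "h x \<in> V" if "x \<in> inv_into U \<phi> ` M" for x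
    using that by (auto simp: M_def f_def split: if_splits)
  ultimately show thesis using that by blast
qed

text \<open>The coordinates of the target chart are functions smooth at \<open>h p\<close>, so each
  has a smooth pullback; finitely many neighbourhoods are intersected and the components reassembled
  over \<open>Basis\<close>.\<close>

lemma smooth_germ_chart:
  assumes h: "smooth_germ A B h p" and U: "(U, \<phi>) \<in> A" "p \<in> U" and V: "(V, \<psi>) \<in> B" "h p \<in> V"
  obtains N where "open N" "\<phi> p \<in> N" "N \<subseteq> \<phi> ` U" "\<And>y. y \<in> N \<Longrightarrow> h (inv_into U \<phi> y) \<in> V"
    "smooth_on N (\<psi> \<circ> h \<circ> inv_into U \<phi>)"
proof -
  obtain W where W: "openin (mtopology A) W" "p \<in> W" "\<And>x. x \<in> W \<Longrightarrow> h x \<in> V"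
    using smooth_germ_continuous[OF h B.openin_chart[OF V(1)] V(2)] by blast
  have "\<forall>b. \<exists>N. open N \<and> \<phi> p \<in> N \<and> N \<subseteq> \<phi> ` U \<and> smooth_on N ((\<lambda>x. \<psi> (h x) \<bullet> b) \<circ> inv_into U \<phi>)"
    using smooth_germD[OF h B.smooth_at_chart_coord[OF V]] A.smooth_at_iff_chart[OF U] by blast
  then obtain N where N: "\<And>b. open (N b)" "\<And>b. \<phi> p \<in> N b"
    "\<And>b. smooth_on (N b) ((\<lambda>x. \<psi> (h x) \<bullet> b) \<circ> inv_into U \<phi>)"
    by metis
  define M where "M = (\<Inter>b\<in>Basis. N b) \<inter> \<phi> ` (U \<inter> W)"
  have o: "open M" unfolding M_def
    using N(1) A.openin_image[OF U(1) W(1)] by (intro open_Int open_INT) auto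
  have "smooth_on M ((\<lambda>x. \<psi> (h x) \<bullet> b) \<circ> inv_into U \<phi>)" if "b \<in> Basis" for b
    using N(3) by (rule smooth_on_subset) (use that in \<open>auto simp: M_def\<close>)
  then have "smooth_on M (\<lambda>y. \<Sum>b\<in>Basis. ((\<lambda>x. \<psi> (h x) \<bullet> b) \<circ> inv_into U \<phi>) y *\<^sub>R b)"
    by (intro smooth_on_sum smooth_on_scaleR o smooth_on_const)
  then have "smooth_on M (\<psi> \<circ> h \<circ> inv_into U \<phi>)" by (simp add: euclidean_representation o_def)
  moreover have "\<phi> p \<in> M" using N(2) W(2) U(2) by (auto simp: M_def)
  moreover have "M \<subseteq> \<phi> ` U" "\<And>y. y \<in> M \<Longrightarrow> h (inv_into U \<phi> y) \<in> V"
    using W(3) by (auto simp: M_def A.inv_chart[OF U(1)])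
  ultimately show thesis using o that by blast
qed

text \<open>The derivative of the chart expression of \<open>h\<close> carries the coordinate vector
  of \<open>u\<close> to a coordinate vector of the image.\<close>

lemma push_tangent:
  assumes h: "smooth_germ A B h p" and u: "u \<in> tangent_space A p" and hp: "h p \<in> mcarrier B"
  shows "push B h p u \<in> tangent_space B (h p)"
proof -
  obtain U \<phi> w where U: "(U, \<phi>) \<in> A" "p \<in> U" and u: "u = dir_deriv A U \<phi> p w"
    using A.tangentE[OF u] by blast
  obtain V \<psi> where V: "(V, \<psi>) \<in> B" "h p \<in> V" using B.ex_chart[OF hp] by blast
  obtain N where N: "open N" "\<phi> p \<in> N" "N \<subseteq> \<phi> ` U" "\<And>y. y \<in> N \<Longrightarrow> h (inv_into U \<phi> y) \<in> V"
    "smooth_on N (\<psi> \<circ> h \<circ> inv_into U \<phi>)"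
    using smooth_germ_chart[OF h U V] by blast
  let ?t = "\<psi> \<circ> h \<circ> inv_into U \<phi>"
  let ?D = "frechet_derivative ?t (at (\<phi> p))"
  have t: "(?t has_derivative ?D) (at (\<phi> p))" using smooth_on_has_derivative[OF N(5,2)] .
  have "push B h p u f = dir_deriv B V \<psi> (h p) (?D w) f" for f
  proof (cases "smooth_at B (h p) f")
    case True
    have "((f \<circ> inv_into V \<psi>) has_derivative (\<lambda>w. dir_deriv B V \<psi> (h p) w f)) (at (?t (\<phi> p)))"
      using B.smooth_at_has_derivative[OF V True] by (simp add: A.inv_chart[OF U])
    then have "((\<lambda>y. (f \<circ> inv_into V \<psi>) (?t y)) has_derivative
        (\<lambda>w. dir_deriv B V \<psi> (h p) (?D w) f)) (at (\<phi> p))"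
      by (rule has_derivative_compose[OF t])
    then have "(((f \<circ> h) \<circ> inv_into U \<phi>) has_derivative
        (\<lambda>w. dir_deriv B V \<psi> (h p) (?D w) f)) (at (\<phi> p))"
      by (rule has_derivative_transform_within_open[OF _ N(1,2)])
        (simp add: B.inv_chart[OF V(1) N(4)])
    moreover have "smooth_at A p (f \<circ> h)" using h True by (simp add: smooth_germ_def)
    ultimately show ?thesis using A.dir_deriv_eqI[OF U] True u by (simp add: push_def)
  qed (simp add: push_def dir_deriv_def)
  then have "push B h p u = dir_deriv B V \<psi> (h p) (?D w)" by blast
  then show ?thesis using B.tangent_space_chart[OF V] by blast
qed

end

subsection \<open>Open submanifolds and products\<close>

context smooth_atlas
begin

lemma mcarrier_restrict_atlas: "mcarrier (restrict_atlas A W) = mcarrier A \<inter> W"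
  by (auto simp: mcarrier_def restrict_atlas_def)

lemma smooth_atlas_restrict:
  assumes "openin (mtopology A) W"
  shows "smooth_atlas (restrict_atlas A W)"
proof
  have *: "\<exists>U'. U = U' \<inter> W \<and> (U', \<phi>) \<in> A" if "(U, \<phi>) \<in> restrict_atlas A W" for U \<phi>
    using that by (auto simp: restrict_atlas_def)
  fix U \<phi> assume "(U, \<phi>) \<in> restrict_atlas A W"
  then obtain U' where U: "U = U' \<inter> W" "(U', \<phi>) \<in> A" using * by blast
  show inj: "inj_on \<phi> U" using inj_chart[OF U(2)] U(1) by (auto intro: inj_on_subset)
  fix V \<psi> assume "(V, \<psi>) \<in> restrict_atlas A W"
  then obtain V' where V: "V = V' \<inter> W" "(V', \<psi>) \<in> A" using * by blast
  have "openin (mtopology A) (V' \<inter> W)" using openin_chart[OF V(2)] assms by auto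
  then have o: "open (\<phi> ` (U' \<inter> (V' \<inter> W)))" using openin_image[OF U(2)] by blast
  have eq: "U \<inter> V = U' \<inter> (V' \<inter> W)" using U V by auto
  show "open (\<phi> ` (U \<inter> V))" using o eq by simp
  have "smooth_on (\<phi> ` (U \<inter> V)) (\<psi> \<circ> inv_into U' \<phi>)"
    using smooth_transition[OF U(2) V(2)] by (rule smooth_on_subset) (auto simp: eq)
  then show "smooth_on (\<phi> ` (U \<inter> V)) (\<psi> \<circ> inv_into U \<phi>)"
    by (subst (asm) smooth_on_cong[where g = "\<psi> \<circ> inv_into U \<phi>"])
      (use o eq inv_chart[OF U(2)] inj U(1) in \<open>auto simp: inv_into_f_f\<close>)
qed

text \<open>Shrinking a chart domain changes the function \<open>inv_into\<close>, but the two
  inverses agree on the image of the smaller domain.\<close>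

lemma smooth_at_restrict_atlas:
  assumes "openin (mtopology A) W" "p \<in> W"
  shows "smooth_at (restrict_atlas A W) p f \<longleftrightarrow> smooth_at A p f"
proof -
  interpret R: smooth_atlas "restrict_atlas A W" using smooth_atlas_restrict[OF assms(1)] .
  obtain U \<phi> where U: "(U, \<phi>) \<in> A" "p \<in> U"
    using ex_chart assms openin_subset_mcarrier by blast
  then have UW: "(U \<inter> W, \<phi>) \<in> restrict_atlas A W" "p \<in> U \<inter> W"
    using assms(2) by (auto simp: restrict_atlas_def)
  have o: "open (\<phi> ` (U \<inter> W))" using openin_image[OF U(1) assms(1)] .
  have eq: "smooth_on N (f \<circ> inv_into U \<phi>) \<longleftrightarrow> smooth_on N (f \<circ> inv_into (U \<inter> W) \<phi>)"
    if N: "open N" "N \<subseteq> \<phi> ` (U \<inter> W)" for N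
    by (rule smooth_on_cong[OF N(1)])
      (use N(2) inv_chart[OF U(1)] R.inv_chart[OF UW(1)] in \<open>auto simp: subset_iff\<close>)
  show ?thesis
  proof
    assume "smooth_at A p f"
    then obtain N where N: "open N" "\<phi> p \<in> N" "N \<subseteq> \<phi> ` U" "smooth_on N (f \<circ> inv_into U \<phi>)"
      using smooth_at_iff_chart[OF U] by meson
    have "smooth_on (N \<inter> \<phi> ` (U \<inter> W)) (f \<circ> inv_into (U \<inter> W) \<phi>)"
      using eq[of "N \<inter> \<phi> ` (U \<inter> W)"] N o by (auto intro: smooth_on_subset)
    then show "smooth_at (restrict_atlas A W) p f"
      using R.smooth_at_iff_chart[OF UW] N UW o by (meson IntI Int_lower2 imageI open_Int)
  next
    assume "smooth_at (restrict_atlas A W) p f"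
    then obtain N where N: "open N" "\<phi> p \<in> N" "N \<subseteq> \<phi> ` (U \<inter> W)"
      "smooth_on N (f \<circ> inv_into (U \<inter> W) \<phi>)"
      using R.smooth_at_iff_chart[OF UW] by meson
    then have "smooth_on N (f \<circ> inv_into U \<phi>)" "N \<subseteq> \<phi> ` U" using eq[of N] by auto
    then show "smooth_at A p f" using smooth_at_iff_chart[OF U] N by blast
  qed
qed

end

lemma inv_into_map_prod:
  assumes "inj_on \<phi> U" "inj_on \<psi> V" "y \<in> \<phi> ` U" "z \<in> \<psi> ` V"
  shows "inv_into (U \<times> V) (map_prod \<phi> \<psi>) (y, z) = (inv_into U \<phi> y, inv_into V \<psi> z)"
proof -
  obtain x w where "x \<in> U" "w \<in> V" "y = \<phi> x" "z = \<psi> w" using assms by auto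
  moreover have "inj_on (map_prod \<phi> \<psi>) (U \<times> V)" using assms by (simp add: map_prod_inj_on)
  ultimately show ?thesis using assms inv_into_f_f[of "map_prod \<phi> \<psi>" "U \<times> V" "(x, w)"]
    by (simp add: inv_into_f_f)
qed

lemma mcarrier_prod_atlas: "mcarrier (prod_atlas A B) = mcarrier A \<times> mcarrier B"
  by (force simp: mcarrier_def prod_atlas_def)

context smooth_atlas_pair
begin

lemma prod_chart: "(U, \<phi>) \<in> A \<Longrightarrow> (V, \<psi>) \<in> B \<Longrightarrow> (U \<times> V, map_prod \<phi> \<psi>) \<in> prod_atlas A B"
  by (force simp: prod_atlas_def)

lemma inv_prod_chart:
  assumes "(U, \<phi>) \<in> A" "(V, \<psi>) \<in> B" "y \<in> \<phi> ` U" "z \<in> \<psi> ` V"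
  shows "inv_into (U \<times> V) (map_prod \<phi> \<psi>) (y, z) = (inv_into U \<phi> y, inv_into V \<psi> z)"
  using assms by (intro inv_into_map_prod A.inj_chart B.inj_chart)

lemma smooth_atlas_prod: "smooth_atlas (prod_atlas A B)"
proof
  fix X \<zeta> assume "(X, \<zeta>) \<in> prod_atlas A B"
  then obtain U V \<phi> \<psi> where X: "X = U \<times> V" "\<zeta> = map_prod \<phi> \<psi>" "(U, \<phi>) \<in> A" "(V, \<psi>) \<in> B"
    by (auto simp: prod_atlas_def)
  show "inj_on \<zeta> X" using X A.inj_chart B.inj_chart by (simp add: map_prod_inj_on)
  fix X' \<zeta>' assume "(X', \<zeta>') \<in> prod_atlas A B"
  then obtain U' V' \<phi>' \<psi>'
    where X': "X' = U' \<times> V'" "\<zeta>' = map_prod \<phi>' \<psi>'" "(U', \<phi>') \<in> A" "(V', \<psi>') \<in> B"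
    by (auto simp: prod_atlas_def)
  have im: "\<zeta> ` (X \<inter> X') = \<phi> ` (U \<inter> U') \<times> \<psi> ` (V \<inter> V')"
    by (force simp: X X')
  show o: "open (\<zeta> ` (X \<inter> X'))"
    unfolding im using A.open_overlap X X' B.open_overlap by (intro open_Times) auto
  have "smooth_on (\<zeta> ` (X \<inter> X'))
      (\<lambda>y. ((\<phi>' \<circ> inv_into U \<phi>) (fst y), (\<psi>' \<circ> inv_into V \<psi>) (snd y)))"
  proof (rule smooth_on_Pair[OF o])
    show "smooth_on (\<zeta> ` (X \<inter> X')) (\<lambda>y. (\<phi>' \<circ> inv_into U \<phi>) (fst y))"
      by (rule smooth_on_compose[OF o A.open_overlap[OF X(3) X'(3)] _
           smooth_on_bounded_linear[OF o bounded_linear_fst smooth_on_ident] A.smooth_transition[OF X(3) X'(3)]])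
        (auto simp: im)
    show "smooth_on (\<zeta> ` (X \<inter> X')) (\<lambda>y. (\<psi>' \<circ> inv_into V \<psi>) (snd y))"
      by (rule smooth_on_compose[OF o B.open_overlap[OF X(4) X'(4)] _
           smooth_on_bounded_linear[OF o bounded_linear_snd smooth_on_ident] B.smooth_transition[OF X(4) X'(4)]])
        (auto simp: im)
  qed
  then show "smooth_on (\<zeta> ` (X \<inter> X')) (\<zeta>' \<circ> inv_into X \<zeta>)"
    by (subst (asm) smooth_on_cong[OF o, where g = "\<zeta>' \<circ> inv_into X \<zeta>"])
      (auto simp: im X(1,2) X'(2) inv_prod_chart[OF X(3,4)])
qed

sublocale P: smooth_atlas "prod_atlas A B" by (rule smooth_atlas_prod)

lemma smooth_germ_fst:
  assumes "z \<in> mcarrier (prod_atlas A B)"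
  shows "smooth_germ (prod_atlas A B) A fst z"
  unfolding smooth_germ_def
proof (intro allI impI)
  fix f assume f: "smooth_at A (fst z) f"
  have z: "fst z \<in> mcarrier A" "snd z \<in> mcarrier B"
    using assms by (auto simp: mcarrier_prod_atlas)
  obtain U \<phi> where U: "(U, \<phi>) \<in> A" "fst z \<in> U" using A.ex_chart[OF z(1)] by blast
  obtain V \<psi> where V: "(V, \<psi>) \<in> B" "snd z \<in> V" using B.ex_chart[OF z(2)] by blast
  obtain N where N: "open N" "\<phi> (fst z) \<in> N" "N \<subseteq> \<phi> ` U" "smooth_on N (f \<circ> inv_into U \<phi>)"
    using f A.smooth_at_iff_chart[OF U] by meson
  have o: "open (N \<times> \<psi> ` V)" using N(1) B.open_chart_image[OF V(1)] by (rule open_Times)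
  have "smooth_on (N \<times> \<psi> ` V) (\<lambda>y. (f \<circ> inv_into U \<phi>) (fst y))"
    by (rule smooth_on_compose[OF o N(1) _
           smooth_on_bounded_linear[OF o bounded_linear_fst smooth_on_ident] N(4)]) auto
  then have "smooth_on (N \<times> \<psi> ` V) ((f \<circ> fst) \<circ> inv_into (U \<times> V) (map_prod \<phi> \<psi>))"
    by (subst (asm) smooth_on_cong[OF o, where g = "(f \<circ> fst) \<circ> inv_into (U \<times> V) (map_prod \<phi> \<psi>)"])
      (use N(3) inv_prod_chart[OF U(1) V(1)] in \<open>auto simp: subset_iff\<close>)
  moreover have z': "z \<in> U \<times> V" using U V by (auto simp: mem_Times_iff)
  moreover have "map_prod \<phi> \<psi> z \<in> N \<times> \<psi> ` V" using U V N(2) by (cases z) auto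
  moreover have "N \<times> \<psi> ` V \<subseteq> map_prod \<phi> \<psi> ` (U \<times> V)" using N(3) by auto
  ultimately show "smooth_at (prod_atlas A B) z (f \<circ> fst)"
    unfolding P.smooth_at_iff_chart[OF prod_chart[OF U(1) V(1)] z']
    using o by (intro exI[of _ "N \<times> \<psi> ` V"] conjI)
qed

lemma smooth_germ_snd:
  assumes "z \<in> mcarrier (prod_atlas A B)"
  shows "smooth_germ (prod_atlas A B) B snd z"
  unfolding smooth_germ_def
proof (intro allI impI)
  fix f assume f: "smooth_at B (snd z) f"
  have z: "fst z \<in> mcarrier A" "snd z \<in> mcarrier B"
    using assms by (auto simp: mcarrier_prod_atlas)
  obtain U \<phi> where U: "(U, \<phi>) \<in> A" "fst z \<in> U" using A.ex_chart[OF z(1)] by blast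
  obtain V \<psi> where V: "(V, \<psi>) \<in> B" "snd z \<in> V" using B.ex_chart[OF z(2)] by blast
  obtain N where N: "open N" "\<psi> (snd z) \<in> N" "N \<subseteq> \<psi> ` V" "smooth_on N (f \<circ> inv_into V \<psi>)"
    using f B.smooth_at_iff_chart[OF V] by meson
  have o: "open (\<phi> ` U \<times> N)" using A.open_chart_image[OF U(1)] N(1) by (rule open_Times)
  have "smooth_on (\<phi> ` U \<times> N) (\<lambda>y. (f \<circ> inv_into V \<psi>) (snd y))"
    by (rule smooth_on_compose[OF o N(1) _
           smooth_on_bounded_linear[OF o bounded_linear_snd smooth_on_ident] N(4)]) auto
  then have "smooth_on (\<phi> ` U \<times> N) ((f \<circ> snd) \<circ> inv_into (U \<times> V) (map_prod \<phi> \<psi>))"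
    by (subst (asm) smooth_on_cong[OF o, where g = "(f \<circ> snd) \<circ> inv_into (U \<times> V) (map_prod \<phi> \<psi>)"])
      (use N(3) inv_prod_chart[OF U(1) V(1)] in \<open>auto simp: subset_iff\<close>)
  moreover have z': "z \<in> U \<times> V" using U V by (auto simp: mem_Times_iff)
  moreover have "map_prod \<phi> \<psi> z \<in> \<phi> ` U \<times> N" using U V N(2) by (cases z) auto
  moreover have "\<phi> ` U \<times> N \<subseteq> map_prod \<phi> \<psi> ` (U \<times> V)" using N(3) by auto
  ultimately show "smooth_at (prod_atlas A B) z (f \<circ> snd)"
    unfolding P.smooth_at_iff_chart[OF prod_chart[OF U(1) V(1)] z']
    using o by (intro exI[of _ "\<phi> ` U \<times> N"] conjI)
qed

text \<open>A smooth function on a product is not assembled from functions on the factors, so the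
  two pullback hypotheses do not combine directly; both maps are first brought into charts.\<close>

lemma smooth_germ_Pair:
  assumes C: "smooth_atlas C" and p: "p \<in> mcarrier C" "h p \<in> mcarrier A" "k p \<in> mcarrier B"
    and h: "smooth_germ C A h p" and k: "smooth_germ C B k p"
  shows "smooth_germ C (prod_atlas A B) (\<lambda>x. (h x, k x)) p"
  unfolding smooth_germ_def
proof (intro allI impI)
  interpret C: smooth_atlas C by fact
  interpret CA: smooth_atlas_pair C A ..
  interpret CB: smooth_atlas_pair C B ..
  fix f assume f: "smooth_at (prod_atlas A B) (h p, k p) f"
  obtain U \<phi> where U: "(U, \<phi>) \<in> C" "p \<in> U" using C.ex_chart p by blast
  obtain V \<psi> where V: "(V, \<psi>) \<in> A" "h p \<in> V" using A.ex_chart p by blast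
  obtain W \<zeta> where W: "(W, \<zeta>) \<in> B" "k p \<in> W" using B.ex_chart p by blast
  obtain N where N: "open N" "(\<psi> (h p), \<zeta> (k p)) \<in> N" "N \<subseteq> map_prod \<psi> \<zeta> ` (V \<times> W)"
    "smooth_on N (f \<circ> inv_into (V \<times> W) (map_prod \<psi> \<zeta>))"
    using f P.smooth_at_iff_chart[OF prod_chart[OF V(1) W(1)], of "(h p, k p)"] V W by auto
  obtain N1 where N1: "open N1" "\<phi> p \<in> N1" "N1 \<subseteq> \<phi> ` U" "\<And>y. y \<in> N1 \<Longrightarrow> h (inv_into U \<phi> y) \<in> V"
    "smooth_on N1 (\<psi> \<circ> h \<circ> inv_into U \<phi>)"
    using CA.smooth_germ_chart[OF h U V] by blast
  obtain N2 where N2: "open N2" "\<phi> p \<in> N2" "N2 \<subseteq> \<phi> ` U" "\<And>y. y \<in> N2 \<Longrightarrow> k (inv_into U \<phi> y) \<in> W"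
    "smooth_on N2 (\<zeta> \<circ> k \<circ> inv_into U \<phi>)"
    using CB.smooth_germ_chart[OF k U W] by blast
  let ?t = "\<lambda>y. ((\<psi> \<circ> h \<circ> inv_into U \<phi>) y, (\<zeta> \<circ> k \<circ> inv_into U \<phi>) y)"
  have o12: "open (N1 \<inter> N2)" using N1 N2 by auto
  have s12: "smooth_on (N1 \<inter> N2) ?t"
    by (rule smooth_on_Pair[OF o12]) (rule smooth_on_subset[OF N1(5)] smooth_on_subset[OF N2(5)], blast)+
  define M where "M = (N1 \<inter> N2) \<inter> ?t -` N"
  have o: "open M" unfolding M_def
    using N(1) smooth_on_continuous_on[OF s12] o12 by (intro continuous_open_preimage)
  have "smooth_on M (\<lambda>y. (f \<circ> inv_into (V \<times> W) (map_prod \<psi> \<zeta>)) (?t y))"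
    by (rule smooth_on_compose[OF o N(1) _ smooth_on_subset[OF s12] N(4)]) (auto simp: M_def)
  then have "smooth_on M ((f \<circ> (\<lambda>x. (h x, k x))) \<circ> inv_into U \<phi>)"
    by (subst (asm) smooth_on_cong[OF o, where g = "(f \<circ> (\<lambda>x. (h x, k x))) \<circ> inv_into U \<phi>"])
      (use N1(4) N2(4) A.inv_chart[OF V(1)] B.inv_chart[OF W(1)] inv_prod_chart[OF V(1) W(1)]
        in \<open>auto simp: M_def\<close>)
  moreover have "\<phi> p \<in> M" using N1(2) N2(2) N(2) by (simp add: M_def C.inv_chart[OF U])
  moreover have "M \<subseteq> \<phi> ` U" using N1(3) by (auto simp: M_def)
  ultimately show "smooth_at C p (f \<circ> (\<lambda>x. (h x, k x)))"
    using C.smooth_at_iff_chart[OF U] o by blast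
qed

lemma smooth_germ_Pair_left:
  assumes "a \<in> mcarrier A" "b \<in> mcarrier B"
  shows "smooth_germ A (prod_atlas A B) (\<lambda>x. (x, b)) a"
  using smooth_germ_Pair[OF A.smooth_atlas_axioms, of a "\<lambda>x. x" "\<lambda>x. b"] assms
  by (simp add: smooth_germ_ident A.smooth_germ_const)

lemma smooth_germ_Pair_right:
  assumes "a \<in> mcarrier A" "b \<in> mcarrier B"
  shows "smooth_germ B (prod_atlas A B) (\<lambda>y. (a, y)) b"
  using smooth_germ_Pair[OF B.smooth_atlas_axioms, of b "\<lambda>y. a" "\<lambda>y. y"] assms
  by (simp add: smooth_germ_ident B.smooth_germ_const)

end

text \<open>Column j of the inverse solves the linear system with right-hand side
  \<open>axis j 1\<close>. As quotients of determinants the entries are visibly smooth in those of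
  \<open>M\<close>, which the definition of \<open>matrix_inv\<close> by choice does not
  show.\<close>

lemma matrix_inv_cramer:
  fixes M :: "real^'n^'n"
  assumes "det M \<noteq> 0"
  shows "matrix_inv M $ i $ j = det (\<chi> r s. if s = i then axis j 1 $ r else M $ r $ s) / det M"
proof -
  have "invertible M" using assms invertible_det_nz by blast
  then have "M ** matrix_inv M = mat 1"
    unfolding invertible_def matrix_inv_def by (rule someI2_ex) simp
  then have "M *v (matrix_inv M *v axis j 1) = axis j 1"
    by (simp add: matrix_vector_mul_assoc)
  then have "matrix_inv M *v axis j 1 =
      (\<chi> k. det (\<chi> r s. if s = k then axis j 1 $ r else M $ r $ s) / det M)"
    using cramer[OF assms] by blast
  moreover have "(matrix_inv M *v axis j 1) $ i = matrix_inv M $ i $ j"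
    by (simp add: matrix_vector_mult_basis column_def)
  ultimately show ?thesis by simp
qed

subsection \<open>Tangent vectors of products\<close>

context smooth_atlas_pair
begin

lemma smooth_at_prod_box:
  assumes U: "(U, \<phi>) \<in> A" "a \<in> U" and V: "(V, \<psi>) \<in> B" "b \<in> V"
    and F: "smooth_at (prod_atlas A B) (a, b) F"
  obtains N M where "open N" "\<phi> a \<in> N" "N \<subseteq> \<phi> ` U" "open M" "\<psi> b \<in> M" "M \<subseteq> \<psi> ` V"
    "smooth_on (N \<times> M) (\<lambda>z. F (inv_into U \<phi> (fst z), inv_into V \<psi> (snd z)))"
proof -
  obtain O' where O: "open O'" "(\<phi> a, \<psi> b) \<in> O'" "O' \<subseteq> map_prod \<phi> \<psi> ` (U \<times> V)"
    "smooth_on O' (F \<circ> inv_into (U \<times> V) (map_prod \<phi> \<psi>))"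
    using F P.smooth_at_iff_chart[OF prod_chart[OF U(1) V(1)], of "(a, b)"] U V by auto
  obtain N M where NM: "open N" "open M" "(\<phi> a, \<psi> b) \<in> N \<times> M" "N \<times> M \<subseteq> O'"
    using open_prod_elim[OF O(1,2)] by blast
  have sub: "N \<subseteq> \<phi> ` U" "M \<subseteq> \<psi> ` V" using NM(3,4) O(3) by auto
  have "smooth_on (N \<times> M) (F \<circ> inv_into (U \<times> V) (map_prod \<phi> \<psi>))"
    using O(4) NM(4) by (rule smooth_on_subset)
  then have "smooth_on (N \<times> M) (\<lambda>z. F (inv_into U \<phi> (fst z), inv_into V \<psi> (snd z)))"
    by (subst (asm) smooth_on_cong[OF open_Times[OF NM(1,2)],
          where g = "\<lambda>z. F (inv_into U \<phi> (fst z), inv_into V \<psi> (snd z))"])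
      (use sub inv_prod_chart[OF U(1) V(1)] in \<open>auto simp: subset_iff\<close>)
  then show thesis using that NM sub by auto
qed

text \<open>In a box of product charts the two vectors become the directions (v, 0) and (0, w) for a
  single function on the box, and the third claim is Schwarz's theorem there. It is the source of
  [X_a, V_i] = 0.\<close>

lemma partial_tangent:
  assumes xi: "\<xi> \<in> tangent_space A a" and eta: "\<eta> \<in> tangent_space B b"
    and F: "smooth_at (prod_atlas A B) (a, b) F"
  shows "smooth_at B b (\<lambda>p. \<xi> (\<lambda>h. F (h, p)))"
    and "smooth_at A a (\<lambda>h. \<eta> (\<lambda>p. F (h, p)))"
    and "\<eta> (\<lambda>p. \<xi> (\<lambda>h. F (h, p))) = \<xi> (\<lambda>h. \<eta> (\<lambda>p. F (h, p)))"
proof -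
  obtain U \<phi> v where U: "(U, \<phi>) \<in> A" "a \<in> U" and v: "\<xi> = dir_deriv A U \<phi> a v"
    using A.tangentE[OF xi] by blast
  obtain V \<psi> w where V: "(V, \<psi>) \<in> B" "b \<in> V" and w: "\<eta> = dir_deriv B V \<psi> b w"
    using B.tangentE[OF eta] by blast
  obtain N M where N: "open N" "\<phi> a \<in> N" "N \<subseteq> \<phi> ` U" and M: "open M" "\<psi> b \<in> M" "M \<subseteq> \<psi> ` V"
    and G: "smooth_on (N \<times> M) (\<lambda>z. F (inv_into U \<phi> (fst z), inv_into V \<psi> (snd z)))"
    using smooth_at_prod_box[OF U V F] by blast
  define G where "G = (\<lambda>z. F (inv_into U \<phi> (fst z), inv_into V \<psi> (snd z)))"
  let ?D = "\<lambda>u z. frechet_derivative G (at z) u"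
  have sG: "smooth_on (N \<times> M) G" using G by (simp add: G_def)
  have sD: "smooth_on (N \<times> M) (?D u)" for u using smooth_on_frechet_derivative[OF sG] .
  have 1: "\<xi> (\<lambda>h. F (h, inv_into V \<psi> z)) = ?D (v, 0) (\<phi> a, z)" if z: "z \<in> M" for z
  proof -
    have "(\<lambda>h. F (h, inv_into V \<psi> z)) \<circ> inv_into U \<phi> = (\<lambda>y. G (y, z))" by (auto simp: G_def)
    moreover have "smooth_at A a (\<lambda>h. F (h, inv_into V \<psi> z))"
      unfolding A.smooth_at_iff_chart[OF U] \<open>_ \<circ> _ = _\<close>
      using N smooth_on_slices(1)[OF N(1) M(1) sG z] by blast
    ultimately show ?thesis unfolding v
      using has_derivative_slices(1)[OF sG, of "\<phi> a" z] N z by (intro A.dir_deriv_eqI[OF U]) auto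
  qed
  have 2: "\<eta> (\<lambda>p. F (inv_into U \<phi> y, p)) = ?D (0, w) (y, \<psi> b)" if y: "y \<in> N" for y
  proof -
    have "(\<lambda>p. F (inv_into U \<phi> y, p)) \<circ> inv_into V \<psi> = (\<lambda>z. G (y, z))" by (auto simp: G_def)
    moreover have "smooth_at B b (\<lambda>p. F (inv_into U \<phi> y, p))"
      unfolding B.smooth_at_iff_chart[OF V] \<open>_ \<circ> _ = _\<close>
      using M smooth_on_slices(2)[OF N(1) M(1) sG y] by blast
    ultimately show ?thesis unfolding w
      using has_derivative_slices(2)[OF sG, of y "\<psi> b"] M y by (intro B.dir_deriv_eqI[OF V]) auto
  qed
  have "smooth_on M (\<lambda>z. ?D (v, 0) (\<phi> a, z))" by (rule smooth_on_slices(2)[OF N(1) M(1) sD N(2)])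
  then have "smooth_on M ((\<lambda>p. \<xi> (\<lambda>h. F (h, p))) \<circ> inv_into V \<psi>)"
    by (subst smooth_on_cong[OF M(1)]) (auto simp: 1)
  then show s1: "smooth_at B b (\<lambda>p. \<xi> (\<lambda>h. F (h, p)))"
    unfolding B.smooth_at_iff_chart[OF V] using M by blast
  have "smooth_on N (\<lambda>y. ?D (0, w) (y, \<psi> b))" by (rule smooth_on_slices(1)[OF N(1) M(1) sD M(2)])
  then have "smooth_on N ((\<lambda>h. \<eta> (\<lambda>p. F (h, p))) \<circ> inv_into U \<phi>)"
    by (subst smooth_on_cong[OF N(1)]) (auto simp: 2)
  then show s2: "smooth_at A a (\<lambda>h. \<eta> (\<lambda>p. F (h, p)))"
    unfolding A.smooth_at_iff_chart[OF U] using N by blast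
  have ab: "(\<phi> a, \<psi> b) \<in> N \<times> M" using N M by simp
  have "\<eta> (\<lambda>p. \<xi> (\<lambda>h. F (h, p))) = frechet_derivative (?D (v, 0)) (at (\<phi> a, \<psi> b)) (0, w)"
    unfolding w
  proof (rule B.dir_deriv_eqI[OF V s1])
    show "((\<lambda>p. \<xi> (\<lambda>h. F (h, p))) \<circ> inv_into V \<psi> has_derivative
       (\<lambda>w. frechet_derivative (?D (v, 0)) (at (\<phi> a, \<psi> b)) (0, w))) (at (\<psi> b))"
      by (rule has_derivative_transform_within_open[OF has_derivative_slices(2)[OF sD ab] M(1,2)])
        (simp add: 1)
  qed
  moreover have "\<xi> (\<lambda>h. \<eta> (\<lambda>p. F (h, p))) = frechet_derivative (?D (0, w)) (at (\<phi> a, \<psi> b)) (v, 0)"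
    unfolding v
  proof (rule A.dir_deriv_eqI[OF U s2])
    show "((\<lambda>h. \<eta> (\<lambda>p. F (h, p))) \<circ> inv_into U \<phi> has_derivative
       (\<lambda>v. frechet_derivative (?D (0, w)) (at (\<phi> a, \<psi> b)) (v, 0))) (at (\<phi> a))"
      by (rule has_derivative_transform_within_open[OF has_derivative_slices(1)[OF sD ab] N(1,2)])
        (simp add: 2)
  qed
  ultimately show "\<eta> (\<lambda>p. \<xi> (\<lambda>h. F (h, p))) = \<xi> (\<lambda>h. \<eta> (\<lambda>p. F (h, p)))"
    using frechet_derivative_commute[OF open_Times[OF N(1) M(1)] sG ab] by simp
qed

text \<open>In coordinates \<open>v\<close> is a pair, and the derivative of \<open>F\<close> is
  additive on (fst w, 0) + (0, snd w).\<close>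

lemma tangent_prod_split:
  assumes v: "v \<in> tangent_space (prod_atlas A B) (a, b)"
    and F: "smooth_at (prod_atlas A B) (a, b) F"
  shows "v F = v (\<lambda>z. F (fst z, b)) + v (\<lambda>z. F (a, snd z))"
proof -
  have ab: "(a, b) \<in> mcarrier (prod_atlas A B)" using P.smooth_at_mcarrier[OF F] .
  then have ab': "a \<in> mcarrier A" "b \<in> mcarrier B" by (auto simp: mcarrier_prod_atlas)
  obtain U \<phi> where U: "(U, \<phi>) \<in> A" "a \<in> U" using A.ex_chart ab' by blast
  obtain V \<psi> where V: "(V, \<psi>) \<in> B" "b \<in> V" using B.ex_chart ab' by blast
  note UV = prod_chart[OF U(1) V(1)]
  have ab'': "(a, b) \<in> U \<times> V" using U V by simp
  obtain w where w: "v = dir_deriv (prod_atlas A B) (U \<times> V) (map_prod \<phi> \<psi>) (a, b) w"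
    using v P.tangent_space_chart[OF UV ab''] by auto
  obtain N M where N: "open N" "\<phi> a \<in> N" "N \<subseteq> \<phi> ` U" and M: "open M" "\<psi> b \<in> M" "M \<subseteq> \<psi> ` V"
    and G: "smooth_on (N \<times> M) (\<lambda>z. F (inv_into U \<phi> (fst z), inv_into V \<psi> (snd z)))"
    using smooth_at_prod_box[OF U V F] by blast
  define G where "G = (\<lambda>z. F (inv_into U \<phi> (fst z), inv_into V \<psi> (snd z)))"
  have sG: "smooth_on (N \<times> M) G" using G by (simp add: G_def)
  have pt: "map_prod \<phi> \<psi> (a, b) = (\<phi> a, \<psi> b)" "(\<phi> a, \<psi> b) \<in> N \<times> M" using N M by auto
  have inv: "inv_into (U \<times> V) (map_prod \<phi> \<psi>) z = (inv_into U \<phi> (fst z), inv_into V \<psi> (snd z))"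
    if "z \<in> N \<times> M" for z
    using that inv_prod_chart[OF U(1) V(1), of "fst z" "snd z"] N(3) M(3)
    by (auto simp: mem_Times_iff subset_iff)
  let ?D = "frechet_derivative G (at (\<phi> a, \<psi> b))"
  have D: "(G has_derivative ?D) (at (\<phi> a, \<psi> b))" using smooth_on_has_derivative[OF sG pt(2)] .
  have o: "open (N \<times> M)" using N(1) M(1) by (rule open_Times)
  have "v F = ?D w" unfolding w
    by (rule P.dir_deriv_eqI[OF UV ab'' F], unfold pt(1),
        rule has_derivative_transform_within_open[OF D o pt(2)]) (auto simp: inv G_def)
  moreover have "v (\<lambda>z. F (fst z, b)) = ?D (fst w, 0)" unfolding w
  proof (rule P.dir_deriv_eqI[OF UV ab''])
    have "smooth_germ (prod_atlas A B) (prod_atlas A B) (\<lambda>z. (fst z, b)) (a, b)"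
      using smooth_germ_compose[OF smooth_germ_fst[OF ab]] smooth_germ_Pair_left[OF ab'] by simp
    from smooth_germD[OF this] F show "smooth_at (prod_atlas A B) (a, b) (\<lambda>z. F (fst z, b))" by simp
    have "((\<lambda>z. (fst z, \<psi> b)) has_derivative (\<lambda>w. (fst w, 0))) (at (\<phi> a, \<psi> b))"
      by (auto intro!: derivative_eq_intros)
    from has_derivative_compose[OF this] D
    have "((\<lambda>z. G (fst z, \<psi> b)) has_derivative (\<lambda>w. ?D (fst w, 0))) (at (\<phi> a, \<psi> b))" by simp
    then show "((\<lambda>z. F (fst z, b)) \<circ> inv_into (U \<times> V) (map_prod \<phi> \<psi>) has_derivative
        (\<lambda>w. ?D (fst w, 0))) (at (map_prod \<phi> \<psi> (a, b)))"
      unfolding pt(1)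
      by (rule has_derivative_transform_within_open[OF _ o pt(2)]) (auto simp: inv G_def B.inv_chart[OF V])
  qed
  moreover have "v (\<lambda>z. F (a, snd z)) = ?D (0, snd w)" unfolding w
  proof (rule P.dir_deriv_eqI[OF UV ab''])
    have "smooth_germ (prod_atlas A B) (prod_atlas A B) (\<lambda>z. (a, snd z)) (a, b)"
      using smooth_germ_compose[OF smooth_germ_snd[OF ab]] smooth_germ_Pair_right[OF ab'] by simp
    from smooth_germD[OF this] F show "smooth_at (prod_atlas A B) (a, b) (\<lambda>z. F (a, snd z))" by simp
    have "((\<lambda>z. (\<phi> a, snd z)) has_derivative (\<lambda>w. (0, snd w))) (at (\<phi> a, \<psi> b))"
      by (auto intro!: derivative_eq_intros)
    from has_derivative_compose[OF this] D
    have "((\<lambda>z. G (\<phi> a, snd z)) has_derivative (\<lambda>w. ?D (0, snd w))) (at (\<phi> a, \<psi> b))" by simp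
    then show "((\<lambda>z. F (a, snd z)) \<circ> inv_into (U \<times> V) (map_prod \<phi> \<psi>) has_derivative
        (\<lambda>w. ?D (0, snd w))) (at (map_prod \<phi> \<psi> (a, b)))"
      unfolding pt(1)
      by (rule has_derivative_transform_within_open[OF _ o pt(2)]) (auto simp: inv G_def A.inv_chart[OF U])
  qed
  moreover have "?D w = ?D (fst w, 0) + ?D (0, snd w)"
    using linear_add[OF has_derivative_linear[OF D], of "(fst w, 0)" "(0, snd w)"] by simp
  ultimately show ?thesis by simp
qed

text \<open>The total derivative as a sum of partial ones, obtained by splitting the push-forward of
  \<open>u\<close> along the paired map. It separates base and group directions in a local
  trivialisation.\<close>

lemma tangent_Pair_split:
  assumes C: "smooth_atlas C" and p: "h p \<in> mcarrier A" "k p \<in> mcarrier B"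
    and h: "smooth_germ C A h p" and k: "smooth_germ C B k p"
    and u: "u \<in> tangent_space C p" and F: "smooth_at (prod_atlas A B) (h p, k p) F"
  shows "u (\<lambda>x. F (h x, k x)) = u (\<lambda>x. F (h x, k p)) + u (\<lambda>x. F (h p, k x))"
proof -
  interpret C: smooth_atlas C by fact
  interpret CP: smooth_atlas_pair C "prod_atlas A B" ..
  let ?g = "\<lambda>x. (h x, k x)"
  have g: "smooth_germ C (prod_atlas A B) ?g p"
    by (rule smooth_germ_Pair[OF C C.tangent_mcarrier[OF u] p h k])
  have pm: "(h p, k p) \<in> mcarrier (prod_atlas A B)" using p by (simp add: mcarrier_prod_atlas)
  have v: "push (prod_atlas A B) ?g p u \<in> tangent_space (prod_atlas A B) (h p, k p)"
    using CP.push_tangent[OF g u] pm by simp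
  have "smooth_germ (prod_atlas A B) (prod_atlas A B) (\<lambda>z. (fst z, k p)) (h p, k p)"
    using smooth_germ_compose[OF smooth_germ_fst[OF pm]] smooth_germ_Pair_left[OF p] by simp
  from smooth_germD[OF this] F have F1: "smooth_at (prod_atlas A B) (h p, k p) (\<lambda>z. F (fst z, k p))" by simp
  have "smooth_germ (prod_atlas A B) (prod_atlas A B) (\<lambda>z. (h p, snd z)) (h p, k p)"
    using smooth_germ_compose[OF smooth_germ_snd[OF pm]] smooth_germ_Pair_right[OF p] by simp
  from smooth_germD[OF this] F have F2: "smooth_at (prod_atlas A B) (h p, k p) (\<lambda>z. F (h p, snd z))" by simp
  show ?thesis using tangent_prod_split[OF v F] F F1 F2 by (simp add: push_def o_def)
qed

end

subsection \<open>The tangent bundle\<close>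

context smooth_atlas
begin

definition tchart :: "('p \<Rightarrow> 'e) \<Rightarrow> 'p \<times> 'p tvec \<Rightarrow> 'e \<times> 'e" where
  "tchart \<phi> = (\<lambda>(x, v). (\<phi> x, \<Sum>b\<in>Basis. v (\<lambda>y. \<phi> y \<bullet> b) *\<^sub>R b))"

lemma tangent_atlas_eq: "tangent_atlas A = (\<lambda>(U, \<phi>). (Sigma U (tangent_space A), tchart \<phi>)) ` A"
  unfolding tangent_atlas_def tchart_def by simp

lemma tchart_dir_deriv:
  "(U, \<phi>) \<in> A \<Longrightarrow> x \<in> U \<Longrightarrow> tchart \<phi> (x, dir_deriv A U \<phi> x w) = (\<phi> x, w)"
  by (simp add: tchart_def dir_deriv_coord euclidean_representation)

lemma tangent_eq_dir_deriv:
  assumes "(U, \<phi>) \<in> A" "x \<in> U" "v \<in> tangent_space A x"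
  shows "v = dir_deriv A U \<phi> x (snd (tchart \<phi> (x, v)))"
  using assms tangent_space_chart[OF assms(1,2)] tchart_dir_deriv[OF assms(1,2)] by auto

lemma inj_on_tchart:
  assumes "(U, \<phi>) \<in> A"
  shows "inj_on (tchart \<phi>) (Sigma U (tangent_space A))"
proof (rule inj_onI, clarify, intro conjI)
  fix x v y w
  assume *: "x \<in> U" "v \<in> tangent_space A x" "y \<in> U" "w \<in> tangent_space A y"
    "tchart \<phi> (x, v) = tchart \<phi> (y, w)"
  then have "\<phi> x = \<phi> y" by (simp add: tchart_def)
  then show "x = y" using * inj_chart[OF assms] by (auto simp: inj_on_def)
  then show "v = w" using * tangent_eq_dir_deriv[OF assms] by metis
qed

lemma tchart_image:
  assumes "(U, \<phi>) \<in> A" "W \<subseteq> U"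
  shows "tchart \<phi> ` Sigma W (tangent_space A) = \<phi> ` W \<times> UNIV"
proof (intro equalityI subsetI)
  fix z assume "z \<in> \<phi> ` W \<times> (UNIV :: 'e set)"
  then obtain x w where z: "x \<in> W" "z = (\<phi> x, w)" by auto
  then have "dir_deriv A U \<phi> x w \<in> tangent_space A x" "z = tchart \<phi> (x, dir_deriv A U \<phi> x w)"
    using assms tangent_space_chart[OF assms(1)] tchart_dir_deriv[OF assms(1)] by auto
  then show "z \<in> tchart \<phi> ` Sigma W (tangent_space A)" using z(1) by blast
qed (auto simp: tchart_def)

lemma inv_tchart:
  assumes "(U, \<phi>) \<in> A" "y \<in> \<phi> ` U"
  shows "inv_into (Sigma U (tangent_space A)) (tchart \<phi>) (y, w) =
    (inv_into U \<phi> y, dir_deriv A U \<phi> (inv_into U \<phi> y) w)"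
proof -
  have x: "inv_into U \<phi> y \<in> U" "\<phi> (inv_into U \<phi> y) = y"
    using assms(2) by (auto intro: inv_into_into f_inv_into_f)
  have "(inv_into U \<phi> y, dir_deriv A U \<phi> (inv_into U \<phi> y) w) \<in> Sigma U (tangent_space A)"
    using x tangent_space_chart[OF assms(1) x(1)] by auto
  then show ?thesis
    using inv_into_f_f[OF inj_on_tchart[OF assms(1)]] tchart_dir_deriv[OF assms(1) x(1)] x(2) by metis
qed

text \<open>A transition map of the tangent bundle consists of the transition map below and of its
  derivative applied to the fibre coordinate. Expanding that coordinate over \<open>Basis\<close>
  leaves derivatives along fixed directions, which are smooth in the base point.\<close>

lemma smooth_atlas_tangent: "smooth_atlas (tangent_atlas A)"
proof
  fix X \<zeta> assume "(X, \<zeta>) \<in> tangent_atlas A"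
  then obtain U \<phi> where X: "X = Sigma U (tangent_space A)" "\<zeta> = tchart \<phi>" "(U, \<phi>) \<in> A"
    by (auto simp: tangent_atlas_eq)
  show "inj_on \<zeta> X" using X inj_on_tchart by simp
  fix X' \<zeta>' assume "(X', \<zeta>') \<in> tangent_atlas A"
  then obtain V \<psi> where X': "X' = Sigma V (tangent_space A)" "\<zeta>' = tchart \<psi>" "(V, \<psi>) \<in> A"
    by (auto simp: tangent_atlas_eq)
  have "X \<inter> X' = Sigma (U \<inter> V) (tangent_space A)" using X X' by auto
  then have im: "\<zeta> ` (X \<inter> X') = \<phi> ` (U \<inter> V) \<times> UNIV" using tchart_image[OF X(3)] X(2) by simp
  have oUV: "open (\<phi> ` (U \<inter> V))" using open_overlap[OF X(3) X'(3)] .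
  show o: "open (\<zeta> ` (X \<inter> X'))" unfolding im by (intro open_Times oUV open_UNIV)
  let ?t = "\<lambda>b. (\<lambda>x. \<psi> x \<bullet> b) \<circ> inv_into U \<phi>"
  have st: "smooth_on (\<phi> ` (U \<inter> V)) (?t b)" for b
    using smooth_on_bounded_linear[OF oUV bounded_linear_inner_left smooth_transition[OF X(3) X'(3)]]
    by (simp add: o_def)
  have fst': "smooth_on (\<zeta> ` (X \<inter> X')) (\<lambda>z. h (fst z))"
    if "smooth_on (\<phi> ` (U \<inter> V)) h" for h :: "'e \<Rightarrow> 'c::real_normed_vector"
    by (rule smooth_on_compose[OF o oUV _ smooth_on_bounded_linear[OF o bounded_linear_fst smooth_on_ident] that])
      (auto simp: im)
  have snd': "smooth_on (\<zeta> ` (X \<inter> X')) (\<lambda>z. snd z \<bullet> c)" for c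
    by (intro smooth_on_bounded_linear[OF o bounded_linear_inner_left]
        smooth_on_bounded_linear[OF o bounded_linear_snd] smooth_on_ident)
  have "smooth_on (\<zeta> ` (X \<inter> X')) (\<lambda>z. ((\<psi> \<circ> inv_into U \<phi>) (fst z),
      \<Sum>b\<in>Basis. (\<Sum>c\<in>Basis. (snd z \<bullet> c) * frechet_derivative (?t b) (at (fst z)) c) *\<^sub>R b))"
    by (intro smooth_on_Pair smooth_on_sum smooth_on_scaleR smooth_on_mult o smooth_on_const fst' snd'
        smooth_transition[OF X(3) X'(3)] smooth_on_frechet_derivative st)
  then show "smooth_on (\<zeta> ` (X \<inter> X')) (\<zeta>' \<circ> inv_into X \<zeta>)"
  proof (subst (asm) smooth_on_cong[OF o, where g = "\<zeta>' \<circ> inv_into X \<zeta>"])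
    fix z assume "z \<in> \<zeta> ` (X \<inter> X')"
    then obtain x w where z: "x \<in> U" "x \<in> V" "z = (\<phi> x, w)" by (auto simp: im)
    have inv: "inv_into X \<zeta> z = (x, dir_deriv A U \<phi> x w)"
      using z(1) inv_tchart[OF X(3), of "\<phi> x" w] inv_chart[OF X(3) z(1)] by (simp add: X z(3))
    have "dir_deriv A U \<phi> x w (\<lambda>y. \<psi> y \<bullet> b) =
        (\<Sum>c\<in>Basis. (w \<bullet> c) * frechet_derivative (?t b) (at (\<phi> x)) c)" for b
    proof -
      have s: "smooth_at A x (\<lambda>y. \<psi> y \<bullet> b)" using smooth_at_chart_coord[OF X'(3) z(2)] .
      have "dir_deriv A U \<phi> x w (\<lambda>y. \<psi> y \<bullet> b) =
          dir_deriv A U \<phi> x (\<Sum>c\<in>Basis. (w \<bullet> c) *\<^sub>R c) (\<lambda>y. \<psi> y \<bullet> b)"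
        by (simp add: euclidean_representation)
      then show ?thesis unfolding dir_deriv_linear[OF X(3) z(1)] by (simp add: dir_deriv_smooth[OF s])
    qed
    then show "((\<psi> \<circ> inv_into U \<phi>) (fst z),
      \<Sum>b\<in>Basis. (\<Sum>c\<in>Basis. (snd z \<bullet> c) * frechet_derivative (?t b) (at (fst z)) c) *\<^sub>R b) =
      (\<zeta>' \<circ> inv_into X \<zeta>) z"
      unfolding o_apply inv by (simp add: X'(2) tchart_def z(3) inv_chart[OF X(3) z(1)])
  qed
qed

text \<open>In a bundle chart \<open>f \<circ> fst\<close> does not depend on the fibre coordinate,
  so the fibre component of \<open>w\<close> contributes nothing. This evaluates dq^b and the
  pulled-back df.\<close>

lemma tangent_tangent_fst:
  assumes U: "(U, \<phi>) \<in> A" "x \<in> U" and v: "v \<in> tangent_space A x" and f: "smooth_at A x f"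
  shows "dir_deriv (tangent_atlas A) (Sigma U (tangent_space A)) (tchart \<phi>) (x, v) w (f \<circ> fst) =
    dir_deriv A U \<phi> x (fst w) f"
proof -
  interpret T: smooth_atlas "tangent_atlas A" by (rule smooth_atlas_tangent)
  let ?X = "Sigma U (tangent_space A)"
  have X: "(?X, tchart \<phi>) \<in> tangent_atlas A" "(x, v) \<in> ?X"
    using U v by (force simp: tangent_atlas_eq)+
  obtain N where N: "open N" "\<phi> x \<in> N" "N \<subseteq> \<phi> ` U" "smooth_on N (f \<circ> inv_into U \<phi>)"
    using f smooth_at_iff_chart[OF U] by meson
  have o: "open (N \<times> (UNIV :: 'e set))" using N(1) by (intro open_Times open_UNIV)
  have s: "smooth_on (N \<times> UNIV) (\<lambda>z :: 'e \<times> 'e. (f \<circ> inv_into U \<phi>) (fst z))"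
    by (rule smooth_on_compose[OF o N(1) _ smooth_on_bounded_linear[OF o bounded_linear_fst smooth_on_ident] N(4)])
      auto
  have eq: "(f \<circ> inv_into U \<phi>) (fst z) = ((f \<circ> fst) \<circ> inv_into ?X (tchart \<phi>)) z"
    if "z \<in> N \<times> UNIV" for z
    using that N(3) inv_tchart[OF U(1)] by (cases z) auto
  have "smooth_on (N \<times> UNIV) ((f \<circ> fst) \<circ> inv_into ?X (tchart \<phi>))"
    using s by (subst (asm) smooth_on_cong[OF o eq])
  moreover have pt: "tchart \<phi> (x, v) \<in> N \<times> UNIV" using N(2) by (simp add: tchart_def)
  moreover have "N \<times> UNIV \<subseteq> tchart \<phi> ` ?X" using tchart_image[OF U(1) subset_refl] N(3) by auto
  ultimately have sm: "smooth_at (tangent_atlas A) (x, v) (f \<circ> fst)"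
    unfolding T.smooth_at_iff_chart[OF X] using o by (intro exI[of _ "N \<times> UNIV"] conjI)
  have "((f \<circ> inv_into U \<phi>) has_derivative (\<lambda>w. dir_deriv A U \<phi> x w f)) (at (fst (tchart \<phi> (x, v))))"
    using smooth_at_has_derivative[OF U f] by (simp add: tchart_def)
  with has_derivative_compose[OF has_derivative_fst[OF has_derivative_ident]]
  have "((\<lambda>z. (f \<circ> inv_into U \<phi>) (fst z)) has_derivative (\<lambda>w. dir_deriv A U \<phi> x (fst w) f))
      (at (tchart \<phi> (x, v)))" by blast
  then have "((f \<circ> fst) \<circ> inv_into ?X (tchart \<phi>) has_derivative (\<lambda>w. dir_deriv A U \<phi> x (fst w) f))
      (at (tchart \<phi> (x, v)))"
    by (rule has_derivative_transform_within_open[OF _ o pt eq])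
  then show ?thesis by (rule T.dir_deriv_eqI[OF X sm])
qed

lemma tangent_tangent_space:
  assumes U: "(U, \<phi>) \<in> A" "x \<in> U" and v: "v \<in> tangent_space A x"
  shows "tangent_space (tangent_atlas A) (x, v) =
    range (dir_deriv (tangent_atlas A) (Sigma U (tangent_space A)) (tchart \<phi>) (x, v))"
proof -
  interpret T: smooth_atlas "tangent_atlas A" by (rule smooth_atlas_tangent)
  show ?thesis by (rule T.tangent_space_chart) (use U v in \<open>force simp: tangent_atlas_eq\<close>)+
qed

subsection \<open>Smoothness of the inverse matrix\<close>

lemma smooth_at_det:
  fixes M :: "'p \<Rightarrow> real^'n^'n"
  assumes "p \<in> mcarrier A" "\<And>r s. smooth_at A p (\<lambda>q. M q $ r $ s)"
  shows "smooth_at A p (\<lambda>q. det (M q))"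
  unfolding det_def
  by (intro smooth_at_sum smooth_at_mult smooth_at_prod smooth_at_const assms)

lemma smooth_at_matrix_inv:
  fixes M :: "'p \<Rightarrow> real^'n^'n"
  assumes "openin (mtopology A) W" "p \<in> W" "\<And>q. q \<in> W \<Longrightarrow> det (M q) \<noteq> 0"
    and "\<And>r s. smooth_at A p (\<lambda>q. M q $ r $ s)"
  shows "smooth_at A p (\<lambda>q. matrix_inv (M q) $ i $ j)"
proof -
  have p: "p \<in> mcarrier A" using assms openin_subset_mcarrier by blast
  have "smooth_at A p (\<lambda>q. (\<chi> r s. if s = i then axis j 1 $ r else M q $ r $ s) $ r $ s)" for r s
    using assms(4) smooth_at_const[OF p] by (cases "s = i") simp_all
  then have "smooth_at A p (\<lambda>q. det (\<chi> r s. if s = i then axis j 1 $ r else M q $ r $ s) * inverse (det (M q)))"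
    using assms by (intro smooth_at_mult smooth_at_inverse smooth_at_det p) auto
  then show ?thesis
    by (subst smooth_at_cong[OF assms(1,2)]) (auto simp: matrix_inv_cramer assms(3) divide_inverse)
qed

end

section \<open>Quadratic forms\<close>

text \<open>Brings the product of the values of df and \<open>theta_l\<close> into the index order
  of \<open>gamma_G\<close>.\<close>

lemma product_of_sums:
  fixes x p z y :: "'a::finite \<Rightarrow> real" and M :: "'a \<Rightarrow> 'a \<Rightarrow> real"
  shows "(\<Sum>b\<in>UNIV. x b * p b) * (\<Sum>a\<in>UNIV. \<Sum>c\<in>UNIV. M a c * z a * y c) =
    (\<Sum>a\<in>UNIV. \<Sum>b\<in>UNIV. \<Sum>c\<in>UNIV. p b * M a c * z a * (x b * y c))"
  unfolding sum_product by (subst sum.swap) (simp add: sum_distrib_left mult_ac)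

lemma sum_mult_of_bool_eq:
  fixes f :: "'a::finite \<Rightarrow> real"
  shows "(\<Sum>i\<in>UNIV. f i * of_bool (i = a)) = f a" "(\<Sum>i\<in>UNIV. f i * of_bool (a = i)) = f a"
proof -
  have "(\<Sum>i\<in>UNIV. f i * of_bool (i = a)) = (\<Sum>i\<in>UNIV. if i = a then f i else 0)"
    by (rule sum.cong) auto
  then show "(\<Sum>i\<in>UNIV. f i * of_bool (i = a)) = f a" by simp
  then show "(\<Sum>i\<in>UNIV. f i * of_bool (a = i)) = f a" by (simp add: eq_commute)
qed

text \<open>Polarisation: the unit vector of a isolates the diagonal entry, and the sum of the unit
  vectors of a and b isolates the symmetric part.\<close>

lemma quadratic_form_eq_0_iff:
  fixes M :: "'a::finite \<Rightarrow> 'a \<Rightarrow> real"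
  shows "(\<forall>v. (\<Sum>a\<in>UNIV. \<Sum>b\<in>UNIV. M a b * v a * v b) = 0) \<longleftrightarrow> (\<forall>a b. M a b + M b a = 0)"
    (is "?L \<longleftrightarrow> ?R")
proof
  assume L: ?L
  show ?R
  proof (intro allI)
    fix a b
    have diag: "M a a = 0" for a
      using L[rule_format, of "\<lambda>i. of_bool (i = a)"] by (simp add: sum_mult_of_bool_eq del: of_bool_eq_iff)
    have "(\<Sum>i\<in>UNIV. \<Sum>j\<in>UNIV. M i j * (of_bool (i = a) + of_bool (i = b)) * (of_bool (j = a) + of_bool (j = b)))
      = M a a + M a b + M b a + M b b"
      by (simp add: distrib_left distrib_right sum.distrib sum_mult_of_bool_eq)
    then show "M a b + M b a = 0"
      using L[rule_format, of "\<lambda>i. of_bool (i = a) + of_bool (i = b)"] diag by simp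
  qed
next
  assume R: ?R
  show ?L
  proof
    fix v :: "'a \<Rightarrow> real"
    let ?S = "\<Sum>a\<in>UNIV. \<Sum>b\<in>UNIV. M a b * v a * v b"
    have "?S = (\<Sum>a\<in>UNIV. \<Sum>b\<in>UNIV. M b a * v a * v b)"
      by (subst sum.swap) (simp add: mult_ac)
    then have "?S + ?S = (\<Sum>a\<in>UNIV. \<Sum>b\<in>UNIV. (M a b + M b a) * v a * v b)"
      by (simp add: sum.distrib distrib_right)
    then show "?S = 0" using R by simp
  qed
qed

text \<open>The form sees only the part of \<open>K\<close> that is antisymmetric in its last two
  indices, and unit vectors isolate this part.\<close>

lemma alternating_form_eq_0_iff:
  fixes K :: "'a::finite \<Rightarrow> 'a \<Rightarrow> 'a \<Rightarrow> real"
  shows "(\<forall>v x y. (\<Sum>a\<in>UNIV. \<Sum>b\<in>UNIV. \<Sum>c\<in>UNIV. K a b c * v a * (x b * y c - y b * x c)) = 0) \<longleftrightarrow>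
    (\<forall>a b c. K a b c = K a c b)" (is "?L \<longleftrightarrow> ?R")
proof
  assume L: ?L
  show ?R
  proof (intro allI)
    fix a b c
    have "(\<Sum>i\<in>UNIV. \<Sum>j\<in>UNIV. \<Sum>k\<in>UNIV. K i j k * of_bool (i = a) *
       (of_bool (j = b) * of_bool (k = c) - of_bool (j = c) * of_bool (k = b))) = K a b c - K a c b"
      by (simp add: right_diff_distrib mult.assoc[symmetric] sum_subtractf sum_mult_of_bool_eq
          del: mult.assoc)
    then show "K a b c = K a c b"
      using L[rule_format, of "\<lambda>i. of_bool (i = a)" "\<lambda>i. of_bool (i = b)" "\<lambda>i. of_bool (i = c)"] by simp
  qed
next
  assume R: ?R
  show ?L
  proof (intro allI)
    fix v x y :: "'a \<Rightarrow> real"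
    have "(\<Sum>b\<in>UNIV. \<Sum>c\<in>UNIV. K a b c * v a * (y b * x c)) =
        (\<Sum>b\<in>UNIV. \<Sum>c\<in>UNIV. K a b c * v a * (x b * y c))" for a
      by (subst sum.swap) (simp add: R[rule_format, of a] mult_ac)
    then show "(\<Sum>a\<in>UNIV. \<Sum>b\<in>UNIV. \<Sum>c\<in>UNIV. K a b c * v a * (x b * y c - y b * x c)) = 0"
      by (simp add: right_diff_distrib sum_subtractf)
  qed
qed

section \<open>Vector fields and symmetric tensors\<close>

context smooth_atlas
begin

lemma smooth_vf_open: "smooth_vf A W Y \<Longrightarrow> openin (mtopology A) W"
  by (simp add: smooth_vf_def)

lemma smooth_vf_tangent: "smooth_vf A W Y \<Longrightarrow> p \<in> W \<Longrightarrow> Y p \<in> tangent_space A p"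
  by (simp add: smooth_vf_def)

lemma smooth_vf_smooth_at:
  assumes "smooth_vf A W Y" "p \<in> W" "smooth_at A p f"
  shows "smooth_at A p (\<lambda>q. Y q f)"
proof -
  obtain W' where W': "p \<in> W'" "smooth_fun A W' f" using assms(3) by (auto simp: smooth_at_def)
  then have "openin (mtopology A) (W' \<inter> W)"
    using smooth_vf_open[OF assms(1)] by (auto simp: smooth_fun_def)
  then have "smooth_fun A (W' \<inter> W) f" using W'(2) smooth_fun_subset by blast
  then have "smooth_fun A (W' \<inter> W) (\<lambda>q. Y q f)" using assms(1) by (auto simp: smooth_vf_def)
  then show ?thesis using W'(1) assms(2) by (auto simp: smooth_at_def)
qed

lemma sym_tensor2_sym:
  "sym_tensor2 A W h \<Longrightarrow> p \<in> W \<Longrightarrow> u \<in> tangent_space A p \<Longrightarrow> v \<in> tangent_space A p \<Longrightarrow>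
    h p u v = h p v u"
  by (simp add: sym_tensor2_def)

lemma sym_tensor2_lincomb:
  assumes h: "sym_tensor2 A W h" "p \<in> W" and w: "w \<in> tangent_space A p"
    and E: "\<And>i. i \<in> I \<Longrightarrow> E i \<in> tangent_space A p" and "finite I"
  shows "h p (lincomb I c E) w = (\<Sum>i\<in>I. c i * h p (E i) w)"
proof -
  have lin: "h p (\<lambda>f. r * u f + v f) w = r * h p u w + h p v w"
    if "u \<in> tangent_space A p" "v \<in> tangent_space A p" for u v r
    using h that w by (simp add: sym_tensor2_def)
  have p: "p \<in> mcarrier A" using tangent_mcarrier[OF w] .
  show ?thesis using assms(5) E
  proof (induction I rule: finite_induct)
    case empty
    have "h p (\<lambda>_. 0) w = 0"
      \<comment> \<open>With \<open>r = 1\<close> and two zero vectors, linearity says that the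
        value at 0 equals its own double.\<close>
      using lin[OF zero_tangent[OF p] zero_tangent[OF p], of 1] by simp
    then show ?case by (simp add: lincomb_def)
  next
    case (insert i I)
    have "lincomb (insert i I) c E = (\<lambda>f. c i * E i f + lincomb I c E f)"
      using insert by (simp add: lincomb_def)
    then show ?case using insert lin[of "E i" "lincomb I c E" "c i"] lincomb_tangent[OF p, of I E c]
      by simp
  qed
qed

lemma sym_tensor2_smooth_at:
  assumes "sym_tensor2 A W h" "W' \<subseteq> W" "smooth_vf A W' Y" "smooth_vf A W' Z" "p \<in> W'"
  shows "smooth_at A p (\<lambda>q. h q (Y q) (Z q))"
  using assms unfolding sym_tensor2_def smooth_at_def by blast

end

lemma lincomb_lincomb:
  "lincomb I c (\<lambda>i. lincomb J (d i) E) = lincomb J (\<lambda>j. \<Sum>i\<in>I. c i * d i j) E"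
proof
  fix f
  have "(\<Sum>i\<in>I. c i * (\<Sum>j\<in>J. d i j * E j f)) = (\<Sum>j\<in>J. \<Sum>i\<in>I. c i * d i j * E j f)"
    by (subst sum.swap) (simp add: sum_distrib_left mult.assoc)
  then show "lincomb I c (\<lambda>i. lincomb J (d i) E) f = lincomb J (\<lambda>j. \<Sum>i\<in>I. c i * d i j) E f"
    by (simp add: lincomb_def sum_distrib_right)
qed

lemma sum_UNIV_Plus:
  fixes f :: "'a::finite + 'b::finite \<Rightarrow> 'c::comm_monoid_add"
  shows "(\<Sum>x\<in>UNIV. f x) = (\<Sum>a\<in>UNIV. f (Inl a)) + (\<Sum>b\<in>UNIV. f (Inr b))"
  unfolding UNIV_Plus_UNIV[symmetric] by (subst sum.Plus) simp_all

section \<open>Chaplygin systems\<close>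

context principal_bundle
begin

sublocale Gm: smooth_atlas AG by (rule smooth_manifold_smooth_atlas[OF manifold])
sublocale Q: smooth_atlas AQ by (rule smooth_manifold_smooth_atlas[OF manifold_Q])
sublocale B: smooth_atlas AB by (rule smooth_manifold_smooth_atlas[OF manifold_B])
sublocale GQ: smooth_atlas_pair AG AQ ..
sublocale GG: smooth_atlas_pair AG AG ..
sublocale QG: smooth_atlas_pair AQ AG ..
sublocale QB: smooth_atlas_pair AQ AB ..
sublocale QQ: smooth_atlas_pair AQ AQ ..
sublocale PQ: smooth_atlas_pair "prod_atlas AG AQ" AQ ..
sublocale PG: smooth_atlas_pair "prod_atlas AG AG" AG ..

lemma act_closed: "h \<in> carrier G \<Longrightarrow> q \<in> mcarrier AQ \<Longrightarrow> act h q \<in> mcarrier AQ"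
  using element_image by blast

lemma act_one: "q \<in> mcarrier AQ \<Longrightarrow> act \<one> q = q"
  using id_eq_one by (metis restrict_apply')

lemma orbit_act:
  assumes "h \<in> carrier G" "q \<in> mcarrier AQ"
  shows "orbit G act (act h q) = orbit G act q"
proof -
  have 1: "act k (act h q) = act (k \<otimes> h) q" if "k \<in> carrier G" for k
    using composition_rule[OF assms(2) that assms(1)] by simp
  have 2: "act k q = act (k \<otimes> inv h) (act h q)" if "k \<in> carrier G" for k
    using composition_rule[OF assms(2), of "k \<otimes> inv h" h] that assms by (simp add: m_assoc)
  show ?thesis
  proof (intro equalityI subsetI)
    fix y assume "y \<in> orbit G act (act h q)"
    then obtain k where k: "k \<in> carrier G" "y = act k (act h q)" by (auto simp: orbit_def)
    then show "y \<in> orbit G act q" using 1[OF k(1)] m_closed[OF k(1) assms(1)] unfolding orbit_def by blast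
  next
    fix y assume "y \<in> orbit G act q"
    then obtain k where k: "k \<in> carrier G" "y = act k q" by (auto simp: orbit_def)
    then show "y \<in> orbit G act (act h q)"
      using 2[OF k(1)] m_closed[OF k(1) inv_closed[OF assms(1)]] unfolding orbit_def by blast
  qed
qed

lemma act2_germ:
  "h \<in> carrier G \<Longrightarrow> q \<in> mcarrier AQ \<Longrightarrow>
    smooth_germ (prod_atlas AG AQ) AQ (\<lambda>(h, q). act h q) (h, q)"
  using PQ.smooth_map_germ[OF smooth_act] by (simp add: mcarrier_prod_atlas carrier)

lemma smooth_at_act2:
  assumes "q \<in> mcarrier AQ" "smooth_at AQ q k"
  shows "smooth_at (prod_atlas AG AQ) (\<one>, q) (\<lambda>(h, p). k (act h p))"
  using smooth_germD[OF act2_germ[OF one_closed assms(1)], of k] assms act_one by (simp add: case_prod_unfold)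

lemma act_germ:
  assumes "h \<in> carrier G" "q \<in> mcarrier AQ"
  shows "smooth_germ AQ AQ (act h) q"
  using smooth_germ_compose[OF GQ.smooth_germ_Pair_right, of h q AQ "\<lambda>(h, q). act h q"]
    act2_germ[OF assms] assms by (simp add: carrier)

lemma orbit_map_germ:
  assumes "h \<in> carrier G" "q \<in> mcarrier AQ"
  shows "smooth_germ AG AQ (\<lambda>h. act h q) h"
  using smooth_germ_compose[OF GQ.smooth_germ_Pair_left, of h q AQ "\<lambda>(h, q). act h q"]
    act2_germ[OF assms] assms by (simp add: carrier)

lemma proj_germ: "q \<in> mcarrier AQ \<Longrightarrow> smooth_germ AQ AB (orbit G act) q"
  by (rule QB.smooth_map_germ[OF smooth_proj])

lemma proj_mcarrier: "q \<in> mcarrier AQ \<Longrightarrow> orbit G act q \<in> mcarrier AB"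
  by (rule QB.smooth_map_image[OF smooth_proj])

lemma on_quotient_orbit:
  assumes "q \<in> mcarrier AQ" "\<And>h. h \<in> carrier G \<Longrightarrow> F (act h q) = F q"
  shows "on_quotient F (orbit G act q) = F q"
proof -
  have "q \<in> orbit G act q" using assms(1) orbit_refl by blast
  moreover have "F y = F q" if "y \<in> orbit G act q" for y
    using that assms(2) by (auto simp: orbit_def)
  ultimately have "F ` orbit G act q = {F q}" by blast
  then show ?thesis by (simp add: on_quotient_def)
qed

lemma inf_generator_eq:
  assumes "q \<in> mcarrier AQ" "smooth_at AQ q k"
  shows "inf_generator G AQ act \<xi> q k = \<xi> (\<lambda>h. k (act h q))"
  using assms act_one by (simp add: inf_generator_def push_def o_def)

lemma inf_generator_tangent:
  assumes "\<xi> \<in> tangent_space AG \<one>" "q \<in> mcarrier AQ"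
  shows "inf_generator G AQ act \<xi> q \<in> tangent_space AQ q"
  using GQ.push_tangent[OF orbit_map_germ[OF one_closed assms(2)] assms(1)] assms(2)
  by (simp add: inf_generator_def act_one)

lemma inf_generator_invariant:
  assumes "\<xi> \<in> tangent_space AG \<one>" "q \<in> mcarrier AQ" "smooth_at AQ q k"
    and "\<And>h. h \<in> carrier G \<Longrightarrow> k (act h q) = k q"
  shows "inf_generator G AQ act \<xi> q k = 0"
proof -
  have "\<xi> (\<lambda>h. k (act h q)) = \<xi> (\<lambda>h. k q)"
    by (rule Gm.tangent_local[OF assms(1) Gm.openin_mcarrier])
      (use assms(4) in \<open>auto simp: carrier\<close>)
  then show ?thesis using inf_generator_eq[OF assms(2,3)] Gm.tangent_const[OF assms(1)] by simp
qed

lemma smooth_at_inf_generator: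
  assumes "\<xi> \<in> tangent_space AG \<one>" "q \<in> mcarrier AQ" "smooth_at AQ q k"
  shows "smooth_at AQ q (\<lambda>p. inf_generator G AQ act \<xi> p k)"
proof -
  obtain W where W: "openin (mtopology AQ) W" "q \<in> W" "\<And>p. p \<in> W \<Longrightarrow> smooth_at AQ p k"
    using Q.smooth_at_nhd[OF assms(3)] by blast
  \<comment> \<open>\<open>partial_tangent\<close> asks for a tangent vector on each factor; the
    zero vector is taken on Q.\<close>
  have "smooth_at AQ q (\<lambda>p. \<xi> (\<lambda>h. k (act h p)))"
    using GQ.partial_tangent(1)[OF assms(1) Q.zero_tangent[OF assms(2)] smooth_at_act2[OF assms(2,3)]]
    by simp
  then show ?thesis
    by (subst Q.smooth_at_cong[OF W(1,2)])
      (use inf_generator_eq W Q.smooth_at_mcarrier in auto)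
qed

lemma smooth_vf_inf_generator:
  assumes "\<xi> \<in> tangent_space AG \<one>" "openin (mtopology AQ) W"
  shows "smooth_vf AQ W (inf_generator G AQ act \<xi>)"
  unfolding smooth_vf_def
proof (intro conjI ballI allI impI)
  have W: "W \<subseteq> mcarrier AQ" using Q.openin_subset_mcarrier[OF assms(2)] .
  show "inf_generator G AQ act \<xi> p \<in> tangent_space AQ p" if "p \<in> W" for p
    using inf_generator_tangent[OF assms(1)] W that by blast
  fix W' k assume *: "W' \<subseteq> W \<and> smooth_fun AQ W' k"
  then have o: "openin (mtopology AQ) W'" by (simp add: smooth_fun_def)
  show "smooth_fun AQ W' (\<lambda>p. inf_generator G AQ act \<xi> p k)"
    unfolding Q.smooth_fun_iff_smooth_at[OF o]
    using smooth_at_inf_generator[OF assms(1)] * W Q.smooth_fun_iff_smooth_at[OF o] by blast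
qed (rule assms(2))

lemma inf_generator_vertical:
  assumes "\<xi> \<in> tangent_space AG \<one>" "q \<in> mcarrier AQ"
  shows "inf_generator G AQ act \<xi> q \<in> vertical_space AQ AB (orbit G act) q"
proof -
  have "push AB (orbit G act) q (inf_generator G AQ act \<xi> q) f = 0" for f
  proof (cases "smooth_at AB (orbit G act q) f")
    case True
    have "inf_generator G AQ act \<xi> q (f \<circ> orbit G act) = 0"
      using proj_germ[OF assms(2)] True assms(2) orbit_act
      by (intro inf_generator_invariant[OF assms]) (auto simp: smooth_germ_def)
    then show ?thesis by (simp add: push_def)
  qed (simp add: push_def)
  then show ?thesis using inf_generator_tangent[OF assms] by (auto simp: vertical_space_def)
qed

lemma push_proj_act:
  assumes h: "h \<in> carrier G" and u: "u \<in> tangent_space AQ q"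
  shows "push AB (orbit G act) (act h q) (push AQ (act h) q u) = push AB (orbit G act) q u"
proof
  fix f
  have q: "q \<in> mcarrier AQ" using Q.tangent_mcarrier[OF u] .
  show "push AB (orbit G act) (act h q) (push AQ (act h) q u) f = push AB (orbit G act) q u f"
  proof (cases "smooth_at AB (orbit G act q) f")
    case True
    then have "smooth_at AQ (act h q) (f \<circ> orbit G act)"
      using proj_germ[OF act_closed[OF h q]] orbit_act[OF h q] by (simp add: smooth_germ_def)
    moreover have "u ((f \<circ> orbit G act) \<circ> act h) = u (f \<circ> orbit G act)"
      by (rule Q.tangent_local[OF u Q.openin_mcarrier q]) (simp add: orbit_act[OF h])
    ultimately show ?thesis using True orbit_act[OF h q] by (simp add: push_def)
  qed (simp add: push_def orbit_act[OF h q])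
qed

lemma vertical_lincomb:
  assumes "q \<in> mcarrier AQ" "\<And>i. i \<in> I \<Longrightarrow> Y i \<in> vertical_space AQ AB (orbit G act) q"
  shows "lincomb I c Y \<in> vertical_space AQ AB (orbit G act) q"
proof -
  have "push AB (orbit G act) q (lincomb I c Y) f = (\<Sum>i\<in>I. c i * push AB (orbit G act) q (Y i) f)" for f
    by (simp add: push_def lincomb_def)
  then have "push AB (orbit G act) q (lincomb I c Y) = (\<lambda>_. 0)"
    using assms by (auto simp: vertical_space_def)
  then show ?thesis using assms Q.lincomb_tangent[OF assms(1), of I Y c] by (simp add: vertical_space_def)
qed

text \<open>In a local trivialisation \<open>p \<mapsto> (\<pi> p, s p)\<close>, a vertical vector at \<open>q\<close> only sees the second
  component, and the curve it follows stays in the orbit of \<open>q\<close>: \<open>p\<close> may be replaced by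
  \<open>(s p * inv (s q)) q\<close>.\<close>

lemma vertical_eq_inf_generator:
  assumes q: "q \<in> mcarrier AQ" and u: "u \<in> vertical_space AQ AB (orbit G act) q"
  obtains \<eta> where "\<eta> \<in> tangent_space AG \<one>" "u = inf_generator G AQ act \<eta> q"
proof -
  let ?p = "orbit G act"
  have uT: "u \<in> tangent_space AQ q" and u0: "\<And>f. push AB ?p q u f = 0"
    using u by (auto simp: vertical_space_def)
  obtain U s where U: "?p q \<in> U" "openin (mtopology AB) U"
    and s: "\<And>h q'. h \<in> carrier G \<Longrightarrow> q' \<in> mcarrier AQ \<Longrightarrow> ?p q' \<in> U \<Longrightarrow> s (act h q') = h \<otimes> s q'"
    and d: "diffeo (restrict_atlas AQ {q \<in> mcarrier AQ. ?p q \<in> U})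
               (prod_atlas (restrict_atlas AB U) AG) (\<lambda>q. (?p q, s q))"
    using local_triv[OF proj_mcarrier[OF q]] by blast
  define W where "W = {q \<in> mcarrier AQ. ?p q \<in> U}"
  have W: "openin (mtopology AQ) W" "q \<in> W" "W \<subseteq> mcarrier AQ"
    unfolding W_def using QB.openin_preimage[OF smooth_proj U(2)] q U(1) by auto
  let ?RQ = "restrict_atlas AQ W" and ?RB = "restrict_atlas AB U"
  interpret RQ: smooth_atlas ?RQ by (rule Q.smooth_atlas_restrict[OF W(1)])
  interpret RB: smooth_atlas ?RB by (rule B.smooth_atlas_restrict[OF U(2)])
  interpret P: smooth_atlas_pair ?RB AG ..
  interpret QP: smooth_atlas_pair ?RQ "prod_atlas ?RB AG" ..
  interpret PQ': smooth_atlas_pair "prod_atlas ?RB AG" ?RQ ..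
  define Phi where "Phi = (\<lambda>q. (?p q, s q))"
  have mRQ: "mcarrier ?RQ = W" using Q.mcarrier_restrict_atlas W(3) by auto
  have mRB: "mcarrier ?RB = U"
    using B.mcarrier_restrict_atlas B.openin_subset_mcarrier[OF U(2)] by auto
  have bij: "bij_betw Phi W (mcarrier (prod_atlas ?RB AG))"
    and sm: "smooth_map ?RQ (prod_atlas ?RB AG) Phi"
    and sm': "smooth_map (prod_atlas ?RB AG) ?RQ (inv_into W Phi)"
    using d by (auto simp: diffeo_def W_def[symmetric] Phi_def[symmetric] mRQ)
  have s_car: "s p \<in> carrier G" if "p \<in> W" for p
    using bij_betwE[OF bij] that by (auto simp: Phi_def mcarrier_prod_atlas carrier)
  have inv_Phi: "inv_into W Phi (Phi p) = p" if "p \<in> W" for p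
    using bij_betw_inv_into_left[OF bij that] .
  have Phi_q: "Phi q \<in> mcarrier (prod_atlas ?RB AG)" using bij_betwE[OF bij] W(2) by blast
  have "smooth_germ ?RQ AG s q"
    using smooth_germ_compose[OF QP.smooth_map_germ[OF sm, of q] P.smooth_germ_snd[OF Phi_q]] W(2) mRQ
    by (simp add: Phi_def)
  then have sg: "smooth_germ AQ AG s q"
    using Q.smooth_at_restrict_atlas[OF W(1,2)] by (simp add: smooth_germ_def)
  have pg: "smooth_germ AQ ?RB ?p q"
    using proj_germ[OF q] B.smooth_at_restrict_atlas[OF U(2,1)] by (simp add: smooth_germ_def)
  define r where "r = (\<lambda>p. s p \<otimes> inv (s q))"
  have rq: "r q = \<one>" using s_car[OF W(2)] by (simp add: r_def)
  have rg: "smooth_germ AQ AG r q"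
  proof -
    have "smooth_germ AQ (prod_atlas AG AG) (\<lambda>p. (s p, inv (s q))) q"
      using s_car[OF W(2)] carrier q
      by (intro GG.smooth_germ_Pair Q.smooth_atlas_axioms sg Q.smooth_germ_const) auto
    moreover have "smooth_germ (prod_atlas AG AG) AG (\<lambda>(x, y). x \<otimes> y) (s q, inv (s q))"
      using s_car[OF W(2)] carrier
      by (intro PG.smooth_map_germ[OF smooth_mult]) (simp add: mcarrier_prod_atlas)
    ultimately show ?thesis using smooth_germ_compose by (fastforce simp: r_def)
  qed
  have key: "u k = u (\<lambda>p. k (act (r p) q))" if k: "smooth_at AQ q k" for k
  proof -
    let ?F = "\<lambda>z. k (inv_into W Phi z)"
    have F: "smooth_at (prod_atlas ?RB AG) (?p q, s q) ?F"
    proof -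
      have "smooth_at ?RQ (inv_into W Phi (Phi q)) k"
        using k inv_Phi[OF W(2)] Q.smooth_at_restrict_atlas[OF W(1,2)] by simp
      from smooth_germD[OF PQ'.smooth_map_germ[OF sm' Phi_q] this] show ?thesis by (simp add: Phi_def)
    qed
    have "u k = u (\<lambda>p. ?F (?p p, s p))"
      by (rule Q.tangent_local[OF uT W(1,2)]) (simp add: inv_Phi[unfolded Phi_def] Phi_def)
    also have "\<dots> = u (\<lambda>p. ?F (?p p, s q)) + u (\<lambda>p. ?F (?p q, s p))"
      using P.tangent_Pair_split[OF Q.smooth_atlas_axioms _ _ pg sg uT F] s_car[OF W(2)] U(1)
      by (simp add: mRB carrier)
    \<comment> \<open>With the group coordinate frozen, the function factors through the projection,
      whose tangent map kills \<open>u\<close>.\<close>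
    also have "u (\<lambda>p. ?F (?p p, s q)) = 0"
    proof -
      have "smooth_at ?RB (?p q) (\<lambda>y. ?F (y, s q))"
        using smooth_germD[OF P.smooth_germ_Pair_left[of "?p q" "s q"] F] s_car[OF W(2)] U(1)
        by (simp add: mRB carrier)
      then have "smooth_at AB (?p q) (\<lambda>y. ?F (y, s q))"
        using B.smooth_at_restrict_atlas[OF U(2,1)] by simp
      then show ?thesis using u0[of "\<lambda>y. ?F (y, s q)"] by (simp add: push_def o_def)
    qed
    \<comment> \<open>Equivariance gives \<open>s (act (r p) q) = r p \<otimes> s q = s p\<close>,
      so \<open>act (r p) q\<close> is the point of the orbit of \<open>q\<close> with group
      coordinate \<open>s p\<close>.\<close>
    also have "u (\<lambda>p. ?F (?p q, s p)) = u (\<lambda>p. k (act (r p) q))"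
    proof (rule Q.tangent_local[OF uT W(1,2)])
      fix p assume p: "p \<in> W"
      have rp: "r p \<in> carrier G" using s_car[OF p] s_car[OF W(2)] by (simp add: r_def)
      have aW: "act (r p) q \<in> W" using act_closed[OF rp q] orbit_act[OF rp q] U(1) by (simp add: W_def)
      have "s (act (r p) q) = s p"
        using s[OF rp q U(1)] s_car[OF p] s_car[OF W(2)] by (simp add: r_def m_assoc)
      then have "Phi (act (r p) q) = (?p q, s p)" by (simp add: Phi_def orbit_act[OF rp q])
      then show "?F (?p q, s p) = k (act (r p) q)" using inv_Phi[OF aW] by simp
    qed
    finally show ?thesis by simp
  qed
  let ?\<eta> = "push AG r q u"
  have eta: "?\<eta> \<in> tangent_space AG \<one>"
    using QG.push_tangent[OF rg uT] rq carrier by simp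
  have "u k = inf_generator G AQ act ?\<eta> q k" for k
  proof (cases "smooth_at AQ q k")
    case True
    have "smooth_at AG \<one> (\<lambda>h. k (act h q))"
      using smooth_germD[OF orbit_map_germ[OF one_closed q], of k] True act_one[OF q] by simp
    then show ?thesis using inf_generator_eq[OF q True] key[OF True] rq by (simp add: push_def o_def)
  next
    case False
    then show ?thesis
      using Q.tangent_nonsmooth[OF uT] Q.tangent_nonsmooth[OF inf_generator_tangent[OF eta q]] by metis
  qed
  then show thesis using eta that by blast
qed

end

section \<open>Horizontal vectors\<close>

context chaplygin_system
begin

lemma g_sym2: "sym_tensor2 AQ (mcarrier AQ) g"
  using metric by (simp add: riemannian_metric_def)

text \<open>In the decomposition of the tangent space the vertical part is taken to be 0, which is
  vertical since it lies in the intersection with \<open>D q\<close>.\<close>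

lemma D_tangent: "q \<in> mcarrier AQ \<Longrightarrow> u \<in> D q \<Longrightarrow> u \<in> tangent_space AQ q"
proof -
  assume q: "q \<in> mcarrier AQ" and u: "u \<in> D q"
  have "(\<lambda>_. 0) \<in> vertical_space AQ AB (orbit G act) q" using D_vertical_inter[OF q] by blast
  then have "(\<lambda>f. u f + (\<lambda>_. 0) f) \<in> tangent_space AQ q"
    unfolding D_vertical_sum[OF q] using u by (intro CollectI exI[of _ u] exI[of _ "\<lambda>_. 0"] conjI refl)
  then show ?thesis by simp
qed

text \<open>\<open>D q\<close> is given merely as a set of operators; its linear structure comes
  from the local frames of the distribution.\<close>

lemma D_lincomb:
  assumes q: "q \<in> mcarrier AQ" and Y: "\<And>i. i \<in> I \<Longrightarrow> Y i \<in> D q"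
  shows "lincomb I c Y \<in> D q"
proof -
  obtain W Z where "q \<in> W" and "\<forall>q\<in>W. tbasis {..<CARD('m)} (\<lambda>i. Z i q) (D q)"
    using distribution_D q unfolding distribution_def by meson
  then have D: "D q = range (\<lambda>c. lincomb {..<CARD('m)} c (\<lambda>i. Z i q))" by (simp add: tbasis_def)
  then have "\<forall>i\<in>I. \<exists>d. Y i = lincomb {..<CARD('m)} d (\<lambda>i. Z i q)" using Y by auto
  then obtain d where d: "\<And>i. i \<in> I \<Longrightarrow> Y i = lincomb {..<CARD('m)} (d i) (\<lambda>i. Z i q)" by metis
  have "lincomb I c Y = lincomb I c (\<lambda>i. lincomb {..<CARD('m)} (d i) (\<lambda>i. Z i q))"
    using d by (simp add: lincomb_def)
  then show ?thesis unfolding lincomb_lincomb D by blast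
qed

text \<open>Uniqueness of horizontal lifts: the difference is both horizontal and vertical.
  Equivariance of the fields \<open>X a\<close> rests on it.\<close>

lemma D_vertical_eq:
  assumes q: "q \<in> mcarrier AQ" and u: "u \<in> D q" and v: "v \<in> D q"
    and "push AB (orbit G act) q u = push AB (orbit G act) q v"
  shows "u = v"
proof -
  let ?Y = "\<lambda>b. if b then u else v" and ?c = "\<lambda>b. if b then 1 else -1 :: real"
  have eq: "lincomb UNIV ?c ?Y = (\<lambda>f. u f - v f)" by (auto simp: lincomb_def UNIV_bool)
  have 1: "(\<lambda>f. u f - v f) \<in> D q" using D_lincomb[OF q, of UNIV ?Y ?c] u v by (simp add: eq)
  moreover have "push AB (orbit G act) q (\<lambda>f. u f - v f) f = 0" for f
    using fun_cong[OF assms(4), of f] by (simp add: push_def split: if_splits)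
  then have "(\<lambda>f. u f - v f) \<in> vertical_space AQ AB (orbit G act) q"
    using D_tangent[OF q 1] by (auto simp: vertical_space_def)
  ultimately have "(\<lambda>f. u f - v f) = (\<lambda>_. 0)" using D_vertical_inter[OF q] by blast
  then show ?thesis by (auto simp: fun_eq_iff)
qed

end

text \<open>Gathers the data on which (i), (ii) and (A') depend; the connection is added later, for
  (B').\<close>

locale chaplygin_frame = chaplygin_system G AG AQ act AB g D
  for G :: "('g, 'c) monoid_scheme" (structure)
    and AG :: "('g, real^'k) atlas"
    and AQ :: "('q, 'e::euclidean_space) atlas"
    and act :: "'g \<Rightarrow> 'q \<Rightarrow> 'q"
    and AB :: "('q set, real^'m) atlas"
    and g :: "'q \<Rightarrow> 'q tvec \<Rightarrow> 'q tvec \<Rightarrow> real"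
    and D :: "'q \<Rightarrow> 'q tvec set" +
  fixes U :: "'q set set" and \<phi> :: "'q set \<Rightarrow> real^'m" and W :: "'q set"
    and \<xi> :: "'k \<Rightarrow> 'g tvec"
    and V :: "'k \<Rightarrow> 'q vfield" and X :: "'m \<Rightarrow> 'q vfield"
    and E :: "'m + 'k \<Rightarrow> 'q vfield"
    and R :: "'m + 'k \<Rightarrow> 'm + 'k \<Rightarrow> 'm + 'k \<Rightarrow> 'q \<Rightarrow> real"
    and f :: "'q set \<Rightarrow> real"
  assumes chart: "(U, \<phi>) \<in> AB"
    and W_def: "W = {q \<in> mcarrier AQ. orbit G act q \<in> U}"
    and xi_basis: "tbasis UNIV \<xi> (tangent_space AG \<one>)"
    and V_def: "V = (\<lambda>i. inf_generator G AQ act (\<xi> i))"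
    and X_lift: "\<And>a. horizontal_lift AQ AB (orbit G act) D W (coord_vf AB U \<phi> a) (X a)"
    and E_def: "E = adapted_frame g X V"
    and R: "structure_functions AQ W E R"
    and smooth_f: "smooth_fun AB (mcarrier AB) f"
begin

abbreviation "proj \<equiv> orbit G act"

lemma W_open: "openin (mtopology AQ) W"
  unfolding W_def by (rule QB.openin_preimage[OF smooth_proj B.openin_chart[OF chart]])

lemma W_mcarrier: "q \<in> W \<Longrightarrow> q \<in> mcarrier AQ" and W_proj: "q \<in> W \<Longrightarrow> proj q \<in> U"
  by (auto simp: W_def)

lemma W_act: "h \<in> carrier G \<Longrightarrow> q \<in> W \<Longrightarrow> act h q \<in> W"
  by (auto simp: W_def act_closed orbit_act)

lemma U_mcarrier: "x \<in> U \<Longrightarrow> x \<in> mcarrier AB"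
  using B.chart_subset[OF chart] by blast

lemma U_proj: "x \<in> U \<Longrightarrow> \<exists>q\<in>W. x = proj q"
  using U_mcarrier[of x] carrier_B by (auto simp: orbits_def W_def)

lemma f_smooth_at: "x \<in> mcarrier AB \<Longrightarrow> smooth_at AB x f"
  using smooth_f B.smooth_fun_iff_smooth_at[OF B.openin_mcarrier] by blast

lemma X_smooth_vf: "smooth_vf AQ W (X a)"
  and X_D: "q \<in> W \<Longrightarrow> X a q \<in> D q"
  and X_push: "q \<in> W \<Longrightarrow> push AB proj q (X a q) = coord_vf AB U \<phi> a (proj q)"
  using X_lift by (auto simp: horizontal_lift_def)

lemma X_tangent: "q \<in> W \<Longrightarrow> X a q \<in> tangent_space AQ q"
  using Q.smooth_vf_tangent[OF X_smooth_vf] .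

lemma X_proj:
  "q \<in> W \<Longrightarrow> smooth_at AB (proj q) k \<Longrightarrow> X a q (\<lambda>p. k (proj p)) = coord_vf AB U \<phi> a (proj q) k"
  using fun_cong[OF X_push, of q a k] by (simp add: push_def o_def)

lemma X_smooth_at: "q \<in> W \<Longrightarrow> smooth_at AQ q k \<Longrightarrow> smooth_at AQ q (\<lambda>p. X a p k)"
  using Q.smooth_vf_smooth_at[OF X_smooth_vf] .

lemma xi_tangent: "\<xi> i \<in> tangent_space AG \<one>"
proof -
  have "\<xi> i k = lincomb UNIV (\<lambda>j. of_bool (j = i)) \<xi> k" for k
    unfolding lincomb_def mult.commute[of "of_bool _"] by (rule sum_mult_of_bool_eq(1)[symmetric])
  then have "\<xi> i = lincomb UNIV (\<lambda>j. of_bool (j = i)) \<xi>" by blast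
  then show ?thesis using xi_basis unfolding tbasis_def by (metis rangeI)
qed

lemma V_tangent: "q \<in> mcarrier AQ \<Longrightarrow> V i q \<in> tangent_space AQ q"
  and V_vertical: "q \<in> mcarrier AQ \<Longrightarrow> V i q \<in> vertical_space AQ AB proj q"
  and V_smooth_vf: "smooth_vf AQ W (V i)"
  and V_smooth_at: "q \<in> mcarrier AQ \<Longrightarrow> smooth_at AQ q k \<Longrightarrow> smooth_at AQ q (\<lambda>p. V i p k)"
  and V_invariant: "q \<in> mcarrier AQ \<Longrightarrow> smooth_at AQ q k \<Longrightarrow>
    (\<And>h. h \<in> carrier G \<Longrightarrow> k (act h q) = k q) \<Longrightarrow> V i q k = 0"
  unfolding V_def
  by (rule inf_generator_tangent[OF xi_tangent] inf_generator_vertical[OF xi_tangent]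
    smooth_vf_inf_generator[OF xi_tangent W_open] smooth_at_inf_generator[OF xi_tangent]
    inf_generator_invariant[OF xi_tangent]; assumption)+

lemma V_span:
  assumes "q \<in> mcarrier AQ" "u \<in> vertical_space AQ AB proj q"
  obtains c where "u = lincomb UNIV c (\<lambda>i. V i q)"
proof -
  obtain \<eta> where eta: "\<eta> \<in> tangent_space AG \<one>" "u = inf_generator G AQ act \<eta> q"
    using vertical_eq_inf_generator[OF assms] by blast
  obtain c where c: "\<eta> = lincomb UNIV c \<xi>" using eta(1) xi_basis by (auto simp: tbasis_def)
  have "u = lincomb UNIV c (\<lambda>i. V i q)"
    by (auto simp: eta(2) c V_def inf_generator_def push_def lincomb_def)
  then show thesis by (rule that)
qed

lemma lincomb_coord_vf:
  assumes "x \<in> U"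
  shows "dir_deriv AB U \<phi> x w = lincomb UNIV (\<lambda>a. w $ a) (\<lambda>a. coord_vf AB U \<phi> a x)"
proof
  fix k
  have "dir_deriv AB U \<phi> x w k = dir_deriv AB U \<phi> x (\<Sum>a\<in>UNIV. w $ a *\<^sub>R axis a 1) k"
    by (simp add: basis_expansion scalar_mult_eq_scaleR[symmetric])
  then show "dir_deriv AB U \<phi> x w k = lincomb UNIV (\<lambda>a. w $ a) (\<lambda>a. coord_vf AB U \<phi> a x) k"
    unfolding B.dir_deriv_linear[OF chart assms] by (simp add: lincomb_def coord_vf_def)
qed

lemma push_lincomb_X:
  assumes "q \<in> W"
  shows "push AB proj q (lincomb UNIV c (\<lambda>a. X a q)) = dir_deriv AB U \<phi> (proj q) (\<chi> a. c a)"
proof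
  fix k
  have "push AB proj q (lincomb UNIV c (\<lambda>a. X a q)) k = (\<Sum>a\<in>UNIV. c a * push AB proj q (X a q) k)"
    by (simp add: push_def lincomb_def)
  then show "push AB proj q (lincomb UNIV c (\<lambda>a. X a q)) k = dir_deriv AB U \<phi> (proj q) (\<chi> a. c a) k"
    using assms by (simp add: X_push lincomb_coord_vf[OF W_proj] lincomb_def)
qed

text \<open>Expand the projection of \<open>u\<close> in the coordinate fields. The combination of
  the \<open>X a\<close> with the same coefficients is horizontal and has the same projection, so it
  is \<open>u\<close>.\<close>

lemma X_span:
  assumes "q \<in> W" "u \<in> D q"
  obtains c where "u = lincomb UNIV c (\<lambda>a. X a q)"
proof -
  note q = W_mcarrier[OF assms(1)]
  have "push AB proj q u \<in> tangent_space AB (proj q)"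
    using QB.push_tangent[OF proj_germ[OF q] D_tangent[OF q assms(2)] proj_mcarrier[OF q]] .
  then obtain w where "push AB proj q u = dir_deriv AB U \<phi> (proj q) w"
    using B.tangent_space_chart[OF chart W_proj[OF assms(1)]] by auto
  then have "push AB proj q u = push AB proj q (lincomb UNIV (\<lambda>a. w $ a) (\<lambda>a. X a q))"
    by (simp add: push_lincomb_X[OF assms(1)])
  then have "u = lincomb UNIV (\<lambda>a. w $ a) (\<lambda>a. X a q)"
    by (intro D_vertical_eq[OF q assms(2)] D_lincomb q X_D assms(1))
  then show thesis by (rule that)
qed

lemma X_independent:
  assumes "q \<in> W" "lincomb UNIV c (\<lambda>a. X a q) = (\<lambda>_. 0)"
  shows "c a = 0"
proof -
  have "push AB proj q (\<lambda>_. 0) = (\<lambda>_. 0)" by (simp add: push_def)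
  then have "dir_deriv AB U \<phi> (proj q) (\<chi> a. c a) (\<lambda>x. \<phi> x \<bullet> axis a 1) = 0"
    using push_lincomb_X[OF assms(1), of c] assms(2) by metis
  then show ?thesis
    unfolding B.dir_deriv_coord[OF chart W_proj[OF assms(1)]] by (simp add: inner_axis)
qed

text \<open>Both sides are horizontal lifts, at \<open>act h q\<close>, of one and the same vector
  of Q/G.\<close>

lemma X_equivariant:
  assumes "h \<in> carrier G" "q \<in> W"
  shows "push AQ (act h) q (X a q) = X a (act h q)"
proof (rule D_vertical_eq)
  note q = W_mcarrier[OF assms(2)] and hq = W_act[OF assms]
  show "act h q \<in> mcarrier AQ" using act_closed[OF assms(1) q] .
  show "push AQ (act h) q (X a q) \<in> D (act h q)" using D_invariant[OF assms(1) q] X_D[OF assms(2)] by blast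
  show "X a (act h q) \<in> D (act h q)" using X_D[OF hq] .
  show "push AB proj (act h q) (push AQ (act h) q (X a q)) = push AB proj (act h q) (X a (act h q))"
    using push_proj_act[OF assms(1) X_tangent[OF assms(2)]] X_push[OF assms(2)] X_push[OF hq]
      orbit_act[OF assms(1) q] by simp
qed

text \<open>The field \<open>V i\<close> differentiates along the orbit map. By equivariance, moving
  \<open>X a\<close> along the orbit is the same as keeping it at \<open>q\<close> and moving the
  argument, and then derivatives in G and in Q are interchanged by
  \<open>partial_tangent\<close>.\<close>

lemma V_X_commute:
  assumes "q \<in> W" "smooth_at AQ q k"
  shows "V i q (\<lambda>p. X a p k) = X a q (\<lambda>p. V i p k)"
proof -
  note q = W_mcarrier[OF assms(1)]
  obtain N where N: "openin (mtopology AQ) N" "q \<in> N" "\<And>p. p \<in> N \<Longrightarrow> smooth_at AQ p k"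
    using Q.smooth_at_nhd[OF assms(2)] by blast
  \<comment> \<open>Equivariance can be evaluated on \<open>k\<close> only where \<open>k\<close> is
    smooth, since \<open>push\<close> is 0 elsewhere; \<open>O'\<close> keeps the translates of
    \<open>q\<close> in such a neighbourhood.\<close>
  obtain O' where O: "openin (mtopology AG) O'" "\<one> \<in> O'" "\<And>h. h \<in> O' \<Longrightarrow> act h q \<in> N"
    using GQ.smooth_germ_continuous[OF orbit_map_germ[OF one_closed q] N(1)] N(2) act_one[OF q] by auto
  have "V i q (\<lambda>p. X a p k) = \<xi> i (\<lambda>h. X a (act h q) k)"
    unfolding V_def by (rule inf_generator_eq[OF q X_smooth_at[OF assms]])
  also have "\<dots> = \<xi> i (\<lambda>h. X a q (\<lambda>p. k (act h p)))"
  proof (rule Gm.tangent_local[OF xi_tangent O(1,2)])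
    fix h assume h: "h \<in> O'"
    then have "h \<in> carrier G" using Gm.openin_subset_mcarrier[OF O(1)] carrier by auto
    from X_equivariant[OF this assms(1), of a] show "X a (act h q) k = X a q (\<lambda>p. k (act h p))"
      using N(3)[OF O(3)[OF h]] by (auto simp: push_def o_def dest: fun_cong[of _ _ k])
  qed
  also have "\<dots> = X a q (\<lambda>p. \<xi> i (\<lambda>h. k (act h p)))"
    using GQ.partial_tangent(3)[OF xi_tangent[of i] X_tangent[OF assms(1), of a] smooth_at_act2[OF q assms(2)]]
    by simp
  also have "\<dots> = X a q (\<lambda>p. V i p k)"
    unfolding V_def
    by (rule Q.tangent_local[OF X_tangent[OF assms(1)] N(1,2)])
      (use inf_generator_eq N Q.smooth_at_mcarrier in auto)
  finally show ?thesis .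
qed

subsection \<open>The curvature\<close>

abbreviation "brk b c \<equiv> lie_bracket AQ (X b) (X c)"

lemma X_X_proj:
  assumes "q \<in> W" "smooth_at AB (proj q) k"
  shows "X b q (\<lambda>p. X c p (\<lambda>p. k (proj p))) =
    coord_vf AB U \<phi> b (proj q) (\<lambda>x. coord_vf AB U \<phi> c x k)"
proof -
  note q = W_mcarrier[OF assms(1)]
  obtain N where N: "openin (mtopology AB) N" "proj q \<in> N" "\<And>x. x \<in> N \<Longrightarrow> smooth_at AB x k"
    using B.smooth_at_nhd[OF assms(2)] by blast
  have o: "openin (mtopology AQ) (W \<inter> {p \<in> mcarrier AQ. proj p \<in> N})"
    using W_open QB.openin_preimage[OF smooth_proj N(1)] by blast
  have "X b q (\<lambda>p. X c p (\<lambda>p. k (proj p))) = X b q (\<lambda>p. coord_vf AB U \<phi> c (proj p) k)"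
    by (rule Q.tangent_local[OF X_tangent[OF assms(1)] o]) (use assms q N in \<open>auto intro: X_proj\<close>)
  then show ?thesis
    using X_proj[OF assms(1), of "\<lambda>x. coord_vf AB U \<phi> c x k" b]
      B.smooth_at_dir_deriv[OF chart W_proj[OF assms(1)] assms(2)] by (simp add: coord_vf_def)
qed

lemma brk_proj:
  assumes "q \<in> W" "smooth_at AB (proj q) k"
  shows "brk b c q (\<lambda>p. k (proj p)) = 0"
  using X_X_proj[OF assms] B.dir_deriv_commute[OF chart W_proj[OF assms(1)] assms(2)]
  by (simp add: lie_bracket_def coord_vf_def)

lemma brk_equivariant:
  assumes "h \<in> carrier G" "q \<in> W"
  shows "push AQ (act h) q (brk b c q) = brk b c (act h q)"
proof
  fix k
  note q = W_mcarrier[OF assms(2)] and hq = W_act[OF assms]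
  show "push AQ (act h) q (brk b c q) k = brk b c (act h q) k"
  proof (cases "smooth_at AQ (act h q) k")
    case True
    obtain N where N: "openin (mtopology AQ) N" "act h q \<in> N" "\<And>p. p \<in> N \<Longrightarrow> smooth_at AQ p k"
      using Q.smooth_at_nhd[OF True] by blast
    obtain M where M: "openin (mtopology AQ) M" "q \<in> M" "\<And>p. p \<in> M \<Longrightarrow> act h p \<in> N"
      using QQ.smooth_germ_continuous[OF act_germ[OF assms(1) q] N(1,2)] by blast
    \<comment> \<open>Equivariance is used twice: for \<open>X c\<close> on a neighbourhood of
      \<open>q\<close>, because \<open>X b\<close> differentiates there, and then for
      \<open>X b\<close> at \<open>q\<close> itself.\<close>
    have *: "X b q (\<lambda>p. X c p (\<lambda>p. k (act h p))) = X b (act h q) (\<lambda>p. X c p k)" for b c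
    proof -
      have "X b q (\<lambda>p. X c p (\<lambda>p. k (act h p))) = X b q (\<lambda>p. X c (act h p) k)"
      proof (rule Q.tangent_local[OF X_tangent[OF assms(2)], of "W \<inter> M"])
        fix p assume p: "p \<in> W \<inter> M"
        from X_equivariant[OF assms(1), of p c] show "X c p (\<lambda>p. k (act h p)) = X c (act h p) k"
          using N(3)[OF M(3)] p by (auto simp: push_def o_def dest: fun_cong[of _ _ k])
      qed (use W_open M assms(2) in auto)
      also have "\<dots> = X b (act h q) (\<lambda>p. X c p k)"
        using X_equivariant[OF assms, of b] X_smooth_at[OF hq True, of c]
        by (auto simp: push_def o_def dest: fun_cong[of _ _ "\<lambda>p. X c p k"])
      finally show ?thesis .
    qed
    have "smooth_at AQ q (\<lambda>p. k (act h p))" using smooth_germD[OF act_germ[OF assms(1) q] True] .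
    then show ?thesis using True by (simp add: push_def o_def lie_bracket_def *)
  qed (simp add: push_def lie_bracket_def)
qed

lemma E_simps: "E (Inl a) = X a" "E (Inr i) = orth_frame g X V i"
  by (simp_all add: E_def adapted_frame_def)

lemma E_Inr: "E (Inr i) q k = V i q k + (\<Sum>b\<in>UNIV. Kcoef g X V b i q * X b q k)"
  by (simp add: E_simps orth_frame_def)

text \<open>As a single combination over the sum type, the field is accessible to
  \<open>lincomb_tangent\<close> and to linearity of symmetric tensors.\<close>

lemma E_Inr_lincomb:
  "E (Inr i) q = lincomb UNIV (\<lambda>s. case s of Inl b \<Rightarrow> Kcoef g X V b i q | Inr j \<Rightarrow> of_bool (j = i))
    (\<lambda>s. case s of Inl b \<Rightarrow> X b q | Inr j \<Rightarrow> V j q)"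
proof
  fix k
  show "E (Inr i) q k = lincomb UNIV (\<lambda>s. case s of Inl b \<Rightarrow> Kcoef g X V b i q | Inr j \<Rightarrow> of_bool (j = i))
    (\<lambda>s. case s of Inl b \<Rightarrow> X b q | Inr j \<Rightarrow> V j q) k"
    using sum_mult_of_bool_eq(1)[of "\<lambda>j. V j q k" i]
    by (simp add: lincomb_def sum_UNIV_Plus E_Inr mult.commute)
qed

lemma E_tangent: "q \<in> W \<Longrightarrow> E s q \<in> tangent_space AQ q"
proof (cases s)
  case (Inr i)
  assume q: "q \<in> W"
  show ?thesis unfolding Inr E_Inr_lincomb
    by (rule Q.lincomb_tangent[OF W_mcarrier[OF q]])
      (use X_tangent[OF q] V_tangent[OF W_mcarrier[OF q]] in \<open>auto split: sum.split\<close>)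
qed (simp add: E_simps X_tangent)

lemma R_eq:
  "q \<in> W \<Longrightarrow> lie_bracket AQ (E s) (E t) q = lincomb UNIV (\<lambda>r. R r s t q) (\<lambda>r. E r q)"
  using R by (simp add: structure_functions_def)

text \<open>\<open>lie_bracket\<close> is by definition just an operator; the structure functions
  exhibit it as a combination of tangent vectors.\<close>

lemma brk_tangent: "q \<in> W \<Longrightarrow> brk b c q \<in> tangent_space AQ q"
  using R_eq[of q "Inl b" "Inl c"] Q.lincomb_tangent[OF W_mcarrier E_tangent] by (simp add: E_simps(1))

lemma brk_vertical: "q \<in> W \<Longrightarrow> brk b c q \<in> vertical_space AQ AB proj q"
  using brk_tangent brk_proj by (auto simp: vertical_space_def push_def o_def)

text \<open>Modulo \<open>D\<close>, the frame field \<open>E (Inr i)\<close> is \<open>V i\<close>.\<close>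

lemma lincomb_E:
  "lincomb UNIV c (\<lambda>r. E r q) k =
    (\<Sum>i\<in>UNIV. c (Inr i) * V i q k) +
    (\<Sum>b\<in>UNIV. (c (Inl b) + (\<Sum>i\<in>UNIV. c (Inr i) * Kcoef g X V b i q)) * X b q k)"
proof -
  have "(\<Sum>i\<in>UNIV. c (Inr i) * (\<Sum>b\<in>UNIV. Kcoef g X V b i q * X b q k)) =
      (\<Sum>b\<in>UNIV. (\<Sum>i\<in>UNIV. c (Inr i) * Kcoef g X V b i q) * X b q k)"
    by (simp add: sum_distrib_left sum_distrib_right mult.assoc) (rule sum.swap)
  then show ?thesis
    by (simp add: lincomb_def sum_UNIV_Plus E_simps(1) E_Inr distrib_left distrib_right sum.distrib)
qed

text \<open>The common value of a vertical and a horizontal combination lies in the intersection,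
  which is 0.\<close>

lemma D_V_eq_0:
  assumes q: "q \<in> W" and "\<And>k. (\<Sum>i\<in>UNIV. c i * V i q k) = (\<Sum>b\<in>UNIV. d b * X b q k)"
  shows "(\<Sum>i\<in>UNIV. c i * V i q k) = 0"
proof -
  have eq: "lincomb UNIV c (\<lambda>i. V i q) = lincomb UNIV d (\<lambda>b. X b q)"
    by (simp add: lincomb_def assms(2))
  have "lincomb UNIV d (\<lambda>b. X b q) \<in> D q" by (intro D_lincomb W_mcarrier[OF q] X_D[OF q])
  moreover have "lincomb UNIV c (\<lambda>i. V i q) \<in> vertical_space AQ AB proj q"
    by (intro vertical_lincomb W_mcarrier[OF q] V_vertical)
  ultimately have "lincomb UNIV c (\<lambda>i. V i q) = (\<lambda>_. 0)"
    using D_vertical_inter[OF W_mcarrier[OF q]] eq by auto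
  then show ?thesis by (simp add: lincomb_def fun_eq_iff)
qed

text \<open>Being vertical, the bracket is a combination of the \<open>V i\<close> with some
  coefficients \<open>e\<close>, while \<open>R\<close> expands it in the frame \<open>E\<close>.
  The two expansions are compared modulo \<open>D\<close>: the difference of their \<open>V\<close>
  parts is horizontal, hence 0.\<close>

lemma brk_eq:
  assumes q: "q \<in> W"
  shows "brk b c q = lincomb UNIV (\<lambda>i. R (Inr i) (Inl b) (Inl c) q) (\<lambda>i. V i q)"
proof -
  let ?r = "\<lambda>i. R (Inr i) (Inl b) (Inl c) q"
  obtain e where e: "brk b c q = lincomb UNIV e (\<lambda>i. V i q)"
    using V_span[OF W_mcarrier[OF q] brk_vertical[OF q]] by blast
  have "(\<Sum>i\<in>UNIV. (e i - ?r i) * V i q k) = (\<Sum>d\<in>UNIV. (R (Inl d) (Inl b) (Inl c) q +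
      (\<Sum>i\<in>UNIV. ?r i * Kcoef g X V d i q)) * X d q k)" for k
  proof -
    have "brk b c q k = lincomb UNIV (\<lambda>r. R r (Inl b) (Inl c) q) (\<lambda>r. E r q) k"
      using fun_cong[OF R_eq[OF q, of "Inl b" "Inl c"], of k] by (simp only: E_simps(1))
    moreover have "brk b c q k = (\<Sum>i\<in>UNIV. e i * V i q k)" by (simp only: e lincomb_def)
    ultimately show ?thesis unfolding lincomb_E left_diff_distrib sum_subtractf by linarith
  qed
  from D_V_eq_0[OF q this] have "(\<Sum>i\<in>UNIV. e i * V i q k) = (\<Sum>i\<in>UNIV. ?r i * V i q k)" for k
    by (simp add: left_diff_distrib sum_subtractf)
  then show ?thesis unfolding e by (simp add: lincomb_def)
qed

end

text \<open>Makes a scalar multiple a case of the rules for \<open>lincomb\<close>.\<close>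

lemma lincomb_single: "lincomb {()} (\<lambda>_. c) (\<lambda>_. u) = (\<lambda>f. c * u f)"
  by (simp add: lincomb_def)

section \<open>The metric in the adapted frame and the invariant coefficients\<close>

context chaplygin_frame
begin

lemma g_lincomb_left:
  assumes "q \<in> mcarrier AQ" "w \<in> tangent_space AQ q" "\<And>i. i \<in> I \<Longrightarrow> Y i \<in> tangent_space AQ q" "finite I"
  shows "g q (lincomb I c Y) w = (\<Sum>i\<in>I. c i * g q (Y i) w)"
  using Q.sym_tensor2_lincomb[OF g_sym2 assms(1,2,3,4)] .

lemma g_commute:
  "u \<in> tangent_space AQ q \<Longrightarrow> v \<in> tangent_space AQ q \<Longrightarrow> g q u v = g q v u"
  using Q.sym_tensor2_sym[OF g_sym2] Q.tangent_mcarrier by blast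

lemma g_lincomb_right:
  assumes "q \<in> mcarrier AQ" "w \<in> tangent_space AQ q" "\<And>i. i \<in> I \<Longrightarrow> Y i \<in> tangent_space AQ q" "finite I"
  shows "g q w (lincomb I c Y) = (\<Sum>i\<in>I. c i * g q w (Y i))"
proof -
  have "g q w (lincomb I c Y) = g q (lincomb I c Y) w"
    by (rule g_commute[OF assms(2) Q.lincomb_tangent[OF assms(1,3)]])
  also have "\<dots> = (\<Sum>i\<in>I. c i * g q (Y i) w)" by (rule g_lincomb_left[OF assms])
  also have "\<dots> = (\<Sum>i\<in>I. c i * g q w (Y i))"
    by (intro sum.cong refl arg_cong[of _ _ "(*) _"] g_commute[OF assms(3,2)])
  finally show ?thesis .
qed

text \<open>Stated for an arbitrary symmetric tensor because it serves twice: for \<open>g\<close>,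
  to obtain orthogonality of the frame, and for \<open>gbar\<close>, to recover its values on the
  \<open>V i\<close>.\<close>

lemma g_X_E:
  assumes "sym_tensor2 AQ W h" "q \<in> W"
  shows "h q (X a q) (E (Inr i) q) =
    h q (X a q) (V i q) + (\<Sum>b\<in>UNIV. Kcoef g X V b i q * h q (X b q) (X a q))"
proof -
  note q = W_mcarrier[OF assms(2)]
  note T = X_tangent[OF assms(2)] V_tangent[OF q]
  have "h q (E (Inr i) q) (X a q) = (\<Sum>b\<in>UNIV. Kcoef g X V b i q * h q (X b q) (X a q)) +
      (\<Sum>j\<in>UNIV. h q (V j q) (X a q) * of_bool (j = i))"
    unfolding E_Inr_lincomb
    by (subst Q.sym_tensor2_lincomb[OF assms])
      (use T in \<open>auto simp: sum_UNIV_Plus mult.commute split: sum.split\<close>)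
  then show ?thesis
    unfolding sum_mult_of_bool_eq
    using Q.sym_tensor2_sym[OF assms T(1) E_tangent[OF assms(2)], of a "Inr i"]
      Q.sym_tensor2_sym[OF assms T(1) T(2), of a i] by simp
qed

text \<open>By \<open>S_eq\<close> this is g(X_a, [X_b, X_c]), up to sign the curvature of the
  connection paired with X_a. That form, free of the frame coefficients, yields antisymmetry and
  invariance.\<close>

definition S :: "'m \<Rightarrow> 'm \<Rightarrow> 'm \<Rightarrow> 'q \<Rightarrow> real" where
  "S a b c q = (\<Sum>k\<in>UNIV. gcomp g X V a k q * R (Inr k) (Inl b) (Inl c) q)"

lemma S_eq: "q \<in> W \<Longrightarrow> S a b c q = g q (X a q) (brk b c q)"
  by (simp add: S_def gcomp_def brk_eq g_lincomb_right[OF W_mcarrier X_tangent V_tangent[OF W_mcarrier]] mult.commute)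

lemma S_antisym: "q \<in> W \<Longrightarrow> S a c b q = - S a b c q"
proof -
  assume q: "q \<in> W"
  have "brk c b q = lincomb {()} (\<lambda>_. -1) (\<lambda>_. brk b c q)"
    unfolding lincomb_single by (auto simp: lie_bracket_def)
  then show ?thesis
    using g_lincomb_right[OF W_mcarrier[OF q] X_tangent[OF q], of "{()}" "\<lambda>_. brk b c q" a "\<lambda>_. -1"]
      brk_tangent[OF q] by (simp add: S_eq[OF q])
qed

lemma gXX_invariant:
  "h \<in> carrier G \<Longrightarrow> q \<in> W \<Longrightarrow> gcomp g X X a b (act h q) = gcomp g X X a b q"
  using metric_invariant[OF _ W_mcarrier X_tangent X_tangent] by (simp add: gcomp_def X_equivariant)

lemma S_invariant: "h \<in> carrier G \<Longrightarrow> q \<in> W \<Longrightarrow> S a b c (act h q) = S a b c q"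
  using metric_invariant[OF _ W_mcarrier X_tangent brk_tangent]
  by (simp add: S_eq W_act X_equivariant brk_equivariant)

lemma red_metric_proj: "q \<in> W \<Longrightarrow> red_metric g X a b (proj q) = gcomp g X X a b q"
  unfolding red_metric_def by (rule on_quotient_orbit[OF W_mcarrier gXX_invariant])

lemma GR_proj: "q \<in> W \<Longrightarrow> GR g X V R a b c (proj q) = S a b c q"
  unfolding GR_def S_def[symmetric] by (rule on_quotient_orbit[OF W_mcarrier S_invariant])

definition df :: "'m \<Rightarrow> 'q \<Rightarrow> real" where
  "df a q = coord_vf AB U \<phi> a (proj q) f"

lemma X_f: "q \<in> W \<Longrightarrow> X a q (f \<circ> proj) = df a q"
  using X_proj f_smooth_at[OF proj_mcarrier[OF W_mcarrier]] by (simp add: df_def o_def)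

text \<open>Every point of \<open>U\<close> is an orbit that meets \<open>W\<close>, and all
  coefficients are constant on orbits, so (i) can be tested on Q.\<close>

lemma cond_AG_iff:
  "cond_AG AB U \<phi> g X V R f \<longleftrightarrow> (\<forall>q\<in>W. \<forall>a b c.
     S b a c q + S a b c q + gcomp g X X b c q * df a q + gcomp g X X a c q * df b q -
     2 * gcomp g X X a b q * df c q = 0)"
  unfolding cond_AG_def
  using U_proj W_proj by (fastforce simp: GR_proj red_metric_proj df_def)

lemma gXX_commute: "q \<in> W \<Longrightarrow> gcomp g X X a b q = gcomp g X X b a q"
  by (simp add: gcomp_def g_commute[OF X_tangent X_tangent])

subsection \<open>The condition on the quotient and the projective geodesic condition\<close>

lemma theta_R_sum:
  "(\<Sum>k\<in>UNIV. theta (\<lambda>a i q. - gcomp g X V a i q) k q v * r k) =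
    (\<Sum>b\<in>UNIV. - (\<Sum>k\<in>UNIV. gcomp g X V b k q * r k) * v b)"
proof -
  have "(\<Sum>k\<in>UNIV. theta (\<lambda>a i q. - gcomp g X V a i q) k q v * r k) =
      (\<Sum>k\<in>UNIV. \<Sum>b\<in>UNIV. - gcomp g X V b k q * v b * r k)"
    by (simp add: theta_def sum_distrib_right)
  also have "\<dots> = (\<Sum>b\<in>UNIV. \<Sum>k\<in>UNIV. - gcomp g X V b k q * v b * r k)" by (rule sum.swap)
  also have "\<dots> = (\<Sum>b\<in>UNIV. - (\<Sum>k\<in>UNIV. gcomp g X V b k q * r k) * v b)"
    by (simp add: sum_distrib_left sum_distrib_right sum_negf mult_ac)
  finally show ?thesis .
qed

text \<open>After contraction of the Kronecker symbols, (A') is a quadratic form in v with matrix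
  \<open>M\<close>. Its symmetrisation is the negative of the left-hand side of (i).\<close>

lemma cond_A_iff:
  "cond_A W g E R (\<lambda>a i q. - gcomp g X V a i q) (f \<circ> proj) \<longleftrightarrow> cond_AG AB U \<phi> g X V R f"
proof -
  define M where "M q c a b = gcomp g X X b a q * df c q - gcomp g X X b c q * df a q - S b a c q" for q c a b
  have 1: "(\<Sum>a\<in>UNIV. \<Sum>b\<in>UNIV. \<Sum>e\<in>UNIV.
           g q (E (Inl b) q) (E (Inl e) q) *
           (of_bool (a = e) * E (Inl c) q (f \<circ> proj) - of_bool (c = e) * E (Inl a) q (f \<circ> proj)) * v a * v b) +
        (\<Sum>a\<in>UNIV. \<Sum>k\<in>UNIV. theta (\<lambda>a i q. - gcomp g X V a i q) k q v * R (Inr k) (Inl a) (Inl c) q * v a)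
      = (\<Sum>a\<in>UNIV. \<Sum>b\<in>UNIV. M q c a b * v a * v b)" if q: "q \<in> W" for q v c
  proof -
    have A: "(\<Sum>e\<in>UNIV. g q (E (Inl b) q) (E (Inl e) q) *
           (of_bool (a = e) * E (Inl c) q (f \<circ> proj) - of_bool (c = e) * E (Inl a) q (f \<circ> proj)) * v a * v b)
        = (gcomp g X X b a q * df c q - gcomp g X X b c q * df a q) * v a * v b" for a b
    proof -
      have "(\<Sum>e\<in>UNIV. g q (E (Inl b) q) (E (Inl e) q) *
           (of_bool (a = e) * E (Inl c) q (f \<circ> proj) - of_bool (c = e) * E (Inl a) q (f \<circ> proj)) * v a * v b)
        = (\<Sum>e\<in>UNIV. gcomp g X X b e q * df c q * v a * v b * of_bool (a = e)) -
          (\<Sum>e\<in>UNIV. gcomp g X X b e q * df a q * v a * v b * of_bool (c = e))"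
        unfolding sum_subtractf[symmetric]
        by (rule sum.cong) (auto simp: E_simps X_f[OF q] gcomp_def algebra_simps)
      then show ?thesis unfolding sum_mult_of_bool_eq by (simp add: algebra_simps)
    qed
    have "(\<Sum>k\<in>UNIV. theta (\<lambda>a i q. - gcomp g X V a i q) k q v * R (Inr k) (Inl a) (Inl c) q * v a) =
        (\<Sum>b\<in>UNIV. - S b a c q * v a * v b)" for a
      unfolding sum_distrib_right[symmetric] theta_R_sum S_def
      by (simp add: sum_distrib_left sum_distrib_right sum_negf mult_ac)
    then show ?thesis unfolding A
      by (simp add: M_def sum.distrib[symmetric] distrib_right[symmetric] algebra_simps)
  qed
  have "cond_A W g E R (\<lambda>a i q. - gcomp g X V a i q) (f \<circ> proj) \<longleftrightarrow>
      (\<forall>q\<in>W. \<forall>c. \<forall>v. (\<Sum>a\<in>UNIV. \<Sum>b\<in>UNIV. M q c a b * v a * v b) = 0)"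
    unfolding cond_A_def using 1 by auto
  also have "\<dots> \<longleftrightarrow> (\<forall>q\<in>W. \<forall>c a b. M q c a b + M q c b a = 0)"
    by (simp only: quadratic_form_eq_0_iff)
  also have "\<dots> \<longleftrightarrow> cond_AG AB U \<phi> g X V R f"
  proof -
    have "M q c a b + M q c b a = - (S b a c q + S a b c q + gcomp g X X b c q * df a q +
        gcomp g X X a c q * df b q - 2 * gcomp g X X a b q * df c q)" if "q \<in> W" for q a b c
      using gXX_commute[OF that, of b a] by (simp add: M_def)
    then show ?thesis unfolding cond_AG_iff by (simp only: neg_equal_0_iff_equal cong: ball_cong) blast
  qed
  finally show ?thesis .
qed

subsection \<open>The condition on the quotient and differential forms\<close>

abbreviation "tvec_at z P \<equiv>
  dir_deriv (tangent_atlas AB) (Sigma U (tangent_space AB)) (B.tchart \<phi>) P z"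

text \<open>All forms involved are built from df and dq^b, which see only the base components of
  \<open>w\<close> and \<open>w'\<close>. The point of the fibre enters through its coordinate
  vector \<open>z\<close>, so a trilinear expression remains.\<close>

lemma form_difference:
  fixes w w' :: "(real^'m) \<times> (real^'m)"
  assumes q: "q \<in> W" and P: "P = (proj q, dir_deriv AB U \<phi> (proj q) z)"
  shows "wedge (ext_d (f \<circ> fst)) (theta_l \<phi> g X) P (tvec_at w P) (tvec_at w' P) -
      gamma_G \<phi> g X V R P (tvec_at w P) (tvec_at w' P) =
    (\<Sum>a\<in>UNIV. \<Sum>b\<in>UNIV. \<Sum>c\<in>UNIV.
      (df b q * gcomp g X X a c q - 1 / 6 * (- S b a c q + S c a b q - 2 * S a b c q)) *
      z $ a * (fst w $ b * fst w' $ c - fst w' $ b * fst w $ c))"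
proof -
  note x = W_proj[OF q]
  have v: "dir_deriv AB U \<phi> (proj q) z \<in> tangent_space AB (proj q)"
    using B.tangent_space_chart[OF chart x] by blast
  have f: "tvec_at w P (f \<circ> fst) = (\<Sum>b\<in>UNIV. fst w $ b * df b q)" for w
  proof -
    have "tvec_at w P (f \<circ> fst) = dir_deriv AB U \<phi> (proj q) (fst w) f"
      unfolding P by (rule B.tangent_tangent_fst[OF chart x v f_smooth_at[OF U_mcarrier[OF x]]])
    then show ?thesis by (simp add: lincomb_coord_vf[OF x] lincomb_def df_def)
  qed
  have qc: "tvec_at w P (qco \<phi> b) = fst w $ b" for w b
  proof -
    have eq: "qco \<phi> b = (\<lambda>y. \<phi> y \<bullet> axis b 1) \<circ> (fst :: 'q set \<times> 'q set tvec \<Rightarrow> _)"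
      by (auto simp: qco_def inner_axis)
    have "tvec_at w P ((\<lambda>y. \<phi> y \<bullet> axis b 1) \<circ> fst) = fst w \<bullet> axis b 1"
      unfolding P B.tangent_tangent_fst[OF chart x v B.smooth_at_chart_coord[OF chart x]]
      by (rule B.dir_deriv_coord[OF chart x])
    then show ?thesis unfolding eq by (simp only: inner_axis) simp
  qed
  have qd: "qdot \<phi> a P = z $ a" for a
    using B.dir_deriv_coord[OF chart x, of z "axis a 1"] by (simp add: qdot_def P inner_axis)
  have th: "theta_l \<phi> g X P (tvec_at w P) = (\<Sum>a\<in>UNIV. \<Sum>c\<in>UNIV. gcomp g X X a c q * z $ a * fst w $ c)" for w
    unfolding theta_l_def ext_d_def qc qd by (simp add: P red_metric_proj[OF q])
  have w: "wedge (ext_d (f \<circ> fst)) (theta_l \<phi> g X) P (tvec_at w P) (tvec_at w' P) =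
    (\<Sum>a\<in>UNIV. \<Sum>b\<in>UNIV. \<Sum>c\<in>UNIV. df b q * gcomp g X X a c q * z $ a * (fst w $ b * fst w' $ c)) -
    (\<Sum>a\<in>UNIV. \<Sum>b\<in>UNIV. \<Sum>c\<in>UNIV. df b q * gcomp g X X a c q * z $ a * (fst w' $ b * fst w $ c))"
    unfolding wedge_def th unfolding ext_d_def f product_of_sums ..
  have ga: "gamma_G \<phi> g X V R P (tvec_at w P) (tvec_at w' P) =
    (\<Sum>a\<in>UNIV. \<Sum>b\<in>UNIV. \<Sum>c\<in>UNIV. 1 / 6 * (- S b a c q + S c a b q - 2 * S a b c q) *
      z $ a * (fst w $ b * fst w' $ c - fst w' $ b * fst w $ c))"
    unfolding gamma_G_def qd wedge_def ext_d_def qc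
    by (simp add: P GR_proj[OF q] sum_distrib_left mult_ac)
  show ?thesis
    unfolding w ga sum_subtractf[symmetric] by (intro sum.cong refl) (simp add: algebra_simps)
qed

text \<open>Points of the fibre and base components of tangent vectors run through all of R^m, which
  turns the equality of forms into the vanishing of an alternating form for all arguments.\<close>

lemma form_condition_iff:
  "(\<forall>P\<in>Sigma U (tangent_space AB).
      \<forall>u\<in>tangent_space (tangent_atlas AB) P. \<forall>w\<in>tangent_space (tangent_atlas AB) P.
        wedge (ext_d (f \<circ> fst)) (theta_l \<phi> g X) P u w = gamma_G \<phi> g X V R P u w) \<longleftrightarrow>
   cond_AG AB U \<phi> g X V R f" (is "?L \<longleftrightarrow> _")
proof -
  define K where "K q a b c = df b q * gcomp g X X a c q - 1 / 6 * (- S b a c q + S c a b q - 2 * S a b c q)"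
    for q a b c
  let ?sum = "\<lambda>q v x y. \<Sum>a\<in>UNIV. \<Sum>b\<in>UNIV. \<Sum>c\<in>UNIV. K q a b c * v a * (x b * y c - y b * x c)"
  have T: "tangent_space (tangent_atlas AB) (proj q, v) = range (\<lambda>w. tvec_at w (proj q, v))"
    if "q \<in> W" "v \<in> tangent_space AB (proj q)" for q v
    using B.tangent_tangent_space[OF chart W_proj[OF that(1)] that(2)] .
  have "?L \<longleftrightarrow> (\<forall>q\<in>W. \<forall>v x y. ?sum q v x y = 0)"
  proof
    assume L: ?L
    show "\<forall>q\<in>W. \<forall>v x y. ?sum q v x y = 0"
    proof (intro ballI allI)
      fix q and v x y :: "'m \<Rightarrow> real" assume q: "q \<in> W"
      let ?v = "dir_deriv AB U \<phi> (proj q) (\<chi> a. v a)"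
      have v: "?v \<in> tangent_space AB (proj q)" using B.tangent_space_chart[OF chart W_proj[OF q]] by blast
      then have "(proj q, ?v) \<in> Sigma U (tangent_space AB)" using W_proj[OF q] by simp
      \<comment> \<open>The fibre components are set to 0; by \<open>form_difference\<close> they do
        not affect the value.\<close>
      then have "wedge (ext_d (f \<circ> fst)) (theta_l \<phi> g X) (proj q, ?v)
          (tvec_at (\<chi> a. x a, 0) (proj q, ?v)) (tvec_at (\<chi> a. y a, 0) (proj q, ?v)) =
        gamma_G \<phi> g X V R (proj q, ?v)
          (tvec_at (\<chi> a. x a, 0) (proj q, ?v)) (tvec_at (\<chi> a. y a, 0) (proj q, ?v))"
        using L T[OF q v] by blast
      then show "?sum q v x y = 0"
        using form_difference[OF q refl, of "\<chi> a. v a" "(\<chi> a. x a, 0)" "(\<chi> a. y a, 0)"]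
        by (simp add: K_def)
    qed
  next
    assume R: "\<forall>q\<in>W. \<forall>v x y. ?sum q v x y = 0"
    show ?L
    proof (intro ballI)
      fix P u w
      assume P: "P \<in> Sigma U (tangent_space AB)"
        and uw: "u \<in> tangent_space (tangent_atlas AB) P" "w \<in> tangent_space (tangent_atlas AB) P"
      obtain x v where xv: "P = (x, v)" "x \<in> U" "v \<in> tangent_space AB x" using P by auto
      obtain q where q: "q \<in> W" "x = proj q" using U_proj[OF xv(2)] by blast
      obtain z where z: "v = dir_deriv AB U \<phi> (proj q) z"
        using xv(3) B.tangent_space_chart[OF chart W_proj[OF q(1)]] unfolding q(2) by blast
      obtain u' w' where "u = tvec_at u' P" "w = tvec_at w' P"
        using uw T[OF q(1)] xv q(2) by auto
      then show "wedge (ext_d (f \<circ> fst)) (theta_l \<phi> g X) P u w = gamma_G \<phi> g X V R P u w"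
        using form_difference[OF q(1), of P z u' w'] xv(1) q(2) z
          R[rule_format, OF q(1), of "\<lambda>a. z $ a" "\<lambda>a. fst u' $ a" "\<lambda>a. fst w' $ a"]
        by (simp add: K_def)
    qed
  qed
  also have "\<dots> \<longleftrightarrow> (\<forall>q\<in>W. \<forall>a b c. K q a b c = K q a c b)"
    by (simp only: alternating_form_eq_0_iff)
  also have "\<dots> \<longleftrightarrow> cond_AG AB U \<phi> g X V R f"
  proof -
    define I where "I q a b c = S b a c q + S a b c q + gcomp g X X b c q * df a q +
      gcomp g X X a c q * df b q - 2 * gcomp g X X a b q * df c q" for q a b c
    text \<open>\<open>I\<close> is symmetric in \<open>a, b\<close> with vanishing cyclic sum, so it is recovered from its
      antisymmetrisation \<open>J\<close> in \<open>b, c\<close> as \<open>3 I a b c = J a b c + J b a c\<close>.\<close>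
    have J: "3 * (K q a b c - K q a c b) = I q a b c - I q a c b" if "q \<in> W" for q a b c
      using S_antisym[OF that, of a b c] gXX_commute[OF that, of b c]
      by (simp add: K_def I_def algebra_simps)
    have IJ: "(I q a b c - I q a c b) + (I q b a c - I q b c a) = 3 * I q a b c" if "q \<in> W" for q a b c
      using S_antisym[OF that, of a b c] S_antisym[OF that, of b a c] S_antisym[OF that, of c a b]
        gXX_commute[OF that, of a b] gXX_commute[OF that, of b c] gXX_commute[OF that, of a c]
      by (simp add: I_def algebra_simps)
    have "(\<forall>a b c. K q a b c = K q a c b) \<longleftrightarrow> (\<forall>a b c. I q a b c = 0)" if q: "q \<in> W" for q
    proof
      assume K: "\<forall>a b c. K q a b c = K q a c b"
      then have "I q a b c = I q a c b" for a b c using J[OF q, of a b c] by simp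
      then show "\<forall>a b c. I q a b c = 0" using IJ[OF q] by (metis (no_types) diff_self add_0 mult_eq_0_iff zero_neq_numeral)
    next
      assume "\<forall>a b c. I q a b c = 0"
      then show "\<forall>a b c. K q a b c = K q a c b" using J[OF q] by simp
    qed
    then show ?thesis unfolding cond_AG_iff I_def by blast
  qed
  finally show ?thesis .
qed

subsection \<open>Orthogonality\<close>

text \<open>A vector x in the kernel gives a combination of the \<open>X a\<close> of length 0;
  positivity of \<open>g\<close> and independence of the \<open>X a\<close> force x = 0.\<close>

lemma gram_matrix_det:
  assumes q: "q \<in> W"
  shows "det (\<chi> c e. gcomp g X X c e q) \<noteq> 0"
proof -
  let ?M = "\<chi> c e. gcomp g X X c e q"
  have "x = 0" if x: "?M *v x = 0" for x
  proof (rule ccontr)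
    assume "x \<noteq> 0"
    let ?u = "lincomb UNIV (\<lambda>a. x $ a) (\<lambda>a. X a q)"
    have u: "?u \<in> tangent_space AQ q"
      using Q.lincomb_tangent[OF W_mcarrier[OF q] X_tangent[OF q]] .
    have "g q ?u ?u = (\<Sum>a\<in>UNIV. x $ a * (\<Sum>b\<in>UNIV. x $ b * gcomp g X X a b q))"
      using g_lincomb_left[OF W_mcarrier[OF q] u, where I = UNIV and Y = "\<lambda>a. X a q" and c = "\<lambda>a. x $ a"]
        g_lincomb_right[OF W_mcarrier[OF q] X_tangent[OF q],
          where I = UNIV and Y = "\<lambda>a. X a q" and c = "\<lambda>a. x $ a"] X_tangent[OF q]
      by (simp add: gcomp_def)
    also have "\<dots> = (\<Sum>a\<in>UNIV. x $ a * (?M *v x) $ a)"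
      by (simp add: matrix_vector_mult_def mult.commute)
    finally have "g q ?u ?u = 0" using x by simp
    moreover have "?u \<noteq> (\<lambda>_. 0)"
      using X_independent[OF q, of "\<lambda>a. x $ a"] \<open>x \<noteq> 0\<close> by (auto simp: vec_eq_iff)
    ultimately show False
      using metric u W_mcarrier[OF q] unfolding riemannian_metric_def by force
  qed
  then have "invertible ?M" unfolding invertible_left_inverse matrix_left_invertible_ker by blast
  then show ?thesis using invertible_det_nz by blast
qed

text \<open>The defining property of K^b_i. It makes \<open>E (Inr i)\<close> orthogonal to the
  \<open>X a\<close>, and in (B') it trades G_ai for terms in K, so that (A') can be
  recognised.\<close>

lemma Kcoef_gXX:
  assumes q: "q \<in> W"
  shows "(\<Sum>b\<in>UNIV. Kcoef g X V b i q * gcomp g X X b c q) = - gcomp g X V c i q"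
proof -
  define M where "M = (\<chi> c e. gcomp g X X c e q)"
  have "invertible M" using gram_matrix_det[OF q] invertible_det_nz unfolding M_def by blast
  then have "matrix_inv M ** M = mat 1"
    unfolding invertible_def matrix_inv_def by (rule someI2_ex) simp
  then have I: "(\<Sum>b\<in>UNIV. matrix_inv M $ a $ b * M $ b $ c) = of_bool (a = c)" for a
    by (simp add: matrix_matrix_mult_def mat_def vec_eq_iff)
  have "(\<Sum>b\<in>UNIV. Kcoef g X V b i q * gcomp g X X b c q) =
      - (\<Sum>b\<in>UNIV. \<Sum>a\<in>UNIV. gcomp g X V a i q * (matrix_inv M $ a $ b * M $ b $ c))"
    by (simp add: Kcoef_def M_def sum_negf sum_distrib_left sum_distrib_right mult_ac)
  also have "\<dots> = - (\<Sum>a\<in>UNIV. gcomp g X V a i q * (\<Sum>b\<in>UNIV. matrix_inv M $ a $ b * M $ b $ c))"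
    by (subst sum.swap) (simp add: sum_distrib_left)
  finally show ?thesis unfolding I sum_mult_of_bool_eq .
qed

lemma E_orthogonal: "q \<in> W \<Longrightarrow> g q (X a q) (E (Inr i) q) = 0"
proof -
  assume q: "q \<in> W"
  have "sym_tensor2 AQ W g" using g_sym2 W_mcarrier unfolding sym_tensor2_def by (meson subsetI subset_trans)
  from g_X_E[OF this q] show ?thesis using Kcoef_gXX[OF q, of i a] by (simp add: gcomp_def)
qed

text \<open>By \<open>g_X_E\<close> and \<open>Kcoef_gXX\<close>, h(X_a, X_i) = h(X_a, V_i) - G_ai,
  as \<open>h\<close> and \<open>g\<close> agree on \<open>D\<close>. The prescribed value -G_ai
  thus means h(X_a, V_i) = 0, and the \<open>V i\<close> and \<open>X a\<close> span the two
  spaces.\<close>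

lemma VD_orthogonal_frame:
  assumes h: "sym_tensor2 AQ W h"
    and hD: "\<And>q u v. \<lbrakk>q \<in> W; u \<in> D q; v \<in> D q\<rbrakk> \<Longrightarrow> h q u v = g q u v"
    and hE: "\<And>a i q. q \<in> W \<Longrightarrow> h q (X a q) (E (Inr i) q) = - gcomp g X V a i q"
  shows "VD_orthogonal W (vertical_space AQ AB proj) D h"
  unfolding VD_orthogonal_def
proof (intro ballI)
  fix q u w assume q: "q \<in> W" and u: "u \<in> vertical_space AQ AB proj q" and w: "w \<in> D q"
  note qm = W_mcarrier[OF q]
  have 0: "h q (X a q) (V i q) = 0" for a i
    using g_X_E[OF h q, of a i] hE[OF q, of a i] Kcoef_gXX[OF q, of i a] hD[OF q X_D[OF q] X_D[OF q]]
    by (simp add: gcomp_def)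
  obtain c where c: "u = lincomb UNIV c (\<lambda>i. V i q)" using V_span[OF qm u] by blast
  obtain d where d: "w = lincomb UNIV d (\<lambda>a. X a q)" using X_span[OF q w] by blast
  have wT: "w \<in> tangent_space AQ q" using D_tangent[OF qm w] .
  have uT: "u \<in> tangent_space AQ q" using u by (simp add: vertical_space_def)
  have "h q (V i q) w = 0" for i
    using Q.sym_tensor2_sym[OF h q wT V_tangent[OF qm], of i]
      Q.sym_tensor2_lincomb[OF h q V_tangent[OF qm, of i] X_tangent[OF q], of UNIV d]
    by (simp add: d 0)
  then show "h q u w = 0"
    using Q.sym_tensor2_lincomb[OF h q wT V_tangent[OF qm], of UNIV c] by (simp add: c)
qed

end

context chaplygin_frame
begin

subsection \<open>The remaining projective geodesic condition\<close>

lemma gX_smooth_at: "q \<in> W \<Longrightarrow> smooth_at AQ q (gcomp g X X a b)"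
  and gV_smooth_at: "q \<in> W \<Longrightarrow> smooth_at AQ q (gcomp g X V a i)"
  using Q.sym_tensor2_smooth_at[OF g_sym2 _ X_smooth_vf X_smooth_vf]
    Q.sym_tensor2_smooth_at[OF g_sym2 _ X_smooth_vf V_smooth_vf] Q.openin_subset_mcarrier[OF W_open]
  by (simp_all add: gcomp_def)

lemma Kcoef_smooth_at:
  assumes q: "q \<in> W"
  shows "smooth_at AQ q (Kcoef g X V b i)"
  unfolding Kcoef_def
  by (intro Q.smooth_at_minus Q.smooth_at_sum Q.smooth_at_mult W_mcarrier[OF q] gV_smooth_at[OF q]
      Q.smooth_at_matrix_inv[OF W_open q] gram_matrix_det)
    (simp_all add: gX_smooth_at[OF q])

text \<open>The part from \<open>V i\<close> drops out since it commutes with \<open>X a\<close>;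
  the Leibniz rule for K^d_i X_d gives the two sums.\<close>

lemma bracket_E_X:
  assumes q: "q \<in> W" and k: "smooth_at AQ q k"
  shows "lie_bracket AQ (E (Inr i)) (E (Inl a)) q k =
    (\<Sum>d\<in>UNIV. Kcoef g X V d i q * brk d a q k) - (\<Sum>d\<in>UNIV. X a q (Kcoef g X V d i) * X d q k)"
proof -
  note qm = W_mcarrier[OF q]
  have s: "smooth_at AQ q (\<lambda>p. Kcoef g X V d i p * X d p k)" for d
    by (intro Q.smooth_at_mult Kcoef_smooth_at[OF q] X_smooth_at[OF q k])
  have "X a q (\<lambda>p. E (Inr i) p k) =
      X a q (\<lambda>p. V i p k) + (\<Sum>d\<in>UNIV. X a q (\<lambda>p. Kcoef g X V d i p * X d p k))"
    unfolding E_Inr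
    by (subst Q.tangent_add[OF X_tangent[OF q] V_smooth_at[OF qm k] Q.smooth_at_sum[OF qm s]])
      (simp add: Q.tangent_sum[OF X_tangent[OF q] s])
  also have "\<dots> = V i q (\<lambda>p. X a p k) + (\<Sum>d\<in>UNIV. Kcoef g X V d i q * X a q (\<lambda>p. X d p k)) +
      (\<Sum>d\<in>UNIV. X a q (Kcoef g X V d i) * X d q k)"
    by (simp add: V_X_commute[OF q k] sum.distrib
        Q.tangent_mult[OF X_tangent[OF q] Kcoef_smooth_at[OF q] X_smooth_at[OF q k]])
  finally show ?thesis
    using k by (simp add: lie_bracket_def E_Inr E_simps(1) right_diff_distrib sum_subtractf)
qed

text \<open>Only the vertical part of the bracket matters, and \<open>V k\<close> commutes with \<open>X a\<close>: the coefficients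
  satisfy $R^k_{ia} = K^d_i R^k_{da}$. The contraction with \<open>gcomp g X V b k\<close> makes the linear
  independence of the \<open>V k\<close> unnecessary.\<close>

lemma R_Inr_contract:
  assumes q: "q \<in> W"
  shows "(\<Sum>k\<in>UNIV. gcomp g X V b k q * R (Inr k) (Inr i) (Inl a) q) =
    (\<Sum>d\<in>UNIV. Kcoef g X V d i q * S b d a q)"
proof -
  note qm = W_mcarrier[OF q]
  let ?r = "\<lambda>k. R (Inr k) (Inr i) (Inl a) q" and ?s = "\<lambda>k d. R (Inr k) (Inl d) (Inl a) q"
  let ?c = "\<lambda>k. ?r k - (\<Sum>d\<in>UNIV. Kcoef g X V d i q * ?s k d)"
  let ?e = "\<lambda>b. R (Inl b) (Inr i) (Inl a) q + (\<Sum>k\<in>UNIV. ?r k * Kcoef g X V b k q)"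
  have swap: "(\<Sum>k\<in>UNIV. (\<Sum>d\<in>UNIV. Kcoef g X V d i q * ?s k d) * y k) =
      (\<Sum>d\<in>UNIV. Kcoef g X V d i q * (\<Sum>k\<in>UNIV. ?s k d * y k))" for y
    unfolding sum_distrib_left sum_distrib_right mult.assoc by (rule sum.swap)
  have "(\<Sum>k\<in>UNIV. ?c k * V k q h) = (\<Sum>d\<in>UNIV. (- X a q (Kcoef g X V d i) - ?e d) * X d q h)" for h
  proof (cases "smooth_at AQ q h")
    case True
    have "lie_bracket AQ (E (Inr i)) (E (Inl a)) q h =
        (\<Sum>k\<in>UNIV. ?r k * V k q h) + (\<Sum>d\<in>UNIV. ?e d * X d q h)"
      unfolding R_eq[OF q] lincomb_E ..
    moreover have "(\<Sum>d\<in>UNIV. Kcoef g X V d i q * brk d a q h) =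
        (\<Sum>k\<in>UNIV. (\<Sum>d\<in>UNIV. Kcoef g X V d i q * ?s k d) * V k q h)"
      unfolding swap brk_eq[OF q] lincomb_def ..
    moreover have "(\<Sum>d\<in>UNIV. - X a q (Kcoef g X V d i) * X d q h) =
        - (\<Sum>d\<in>UNIV. X a q (Kcoef g X V d i) * X d q h)"
      by (simp add: sum_negf)
    ultimately show ?thesis
      using bracket_E_X[OF q True, of i a] unfolding left_diff_distrib sum_subtractf by linarith
  next
    case False
    then show ?thesis
      using Q.tangent_nonsmooth[OF V_tangent[OF qm]] Q.tangent_nonsmooth[OF X_tangent[OF q]] by simp
  qed
  \<comment> \<open>The zero vector is written as an empty combination, so that \<open>lin\<close>
    also evaluates \<open>g\<close> on it.\<close>
  from D_V_eq_0[OF q this] have 0: "lincomb UNIV ?c (\<lambda>k. V k q) = lincomb {} ?c (\<lambda>k. V k q)"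
    unfolding lincomb_def by simp
  have lin: "g q (X b q) (lincomb I ?c (\<lambda>k. V k q)) = (\<Sum>k\<in>I. ?c k * g q (X b q) (V k q))"
    if "finite I" for I
    by (rule g_lincomb_right[OF qm X_tangent[OF q] V_tangent[OF qm] that])
  have "(\<Sum>k\<in>UNIV. ?c k * g q (X b q) (V k q)) = 0"
    unfolding lin[OF finite, symmetric] 0 by (subst lin) simp_all
  then have "(\<Sum>k\<in>UNIV. ?r k * g q (X b q) (V k q)) =
      (\<Sum>d\<in>UNIV. Kcoef g X V d i q * (\<Sum>k\<in>UNIV. ?s k d * g q (X b q) (V k q)))"
    unfolding left_diff_distrib sum_subtractf swap by simp
  then show ?thesis by (simp add: S_def gcomp_def mult.commute)
qed

lemma V_f: "q \<in> W \<Longrightarrow> V i q (f \<circ> proj) = 0"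
proof (rule V_invariant)
  assume q: "q \<in> W"
  show "smooth_at AQ q (f \<circ> proj)"
    using smooth_germD[OF proj_germ[OF W_mcarrier[OF q]] f_smooth_at[OF proj_mcarrier[OF W_mcarrier[OF q]]]]
    by (simp add: o_def)
qed (auto simp: W_mcarrier orbit_act)

lemma E_Inr_f: "q \<in> W \<Longrightarrow> E (Inr i) q (f \<circ> proj) = (\<Sum>d\<in>UNIV. Kcoef g X V d i q * df d q)"
  by (simp add: E_Inr V_f X_f)

text \<open>The rest of condition \<open>(B')\<close> is the contraction of \<open>(A')\<close> with \<open>Kcoef\<close>.\<close>

lemma cond_B_algebra:
  assumes AG: "cond_AG AB U \<phi> g X V R f" and q: "q \<in> W"
  shows "(\<Sum>a\<in>UNIV. \<Sum>k\<in>UNIV. theta (\<lambda>a i q. - gcomp g X V a i q) k q v *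
           (R (Inr k) (Inr i) (Inl a) q + of_bool (k = i) * E (Inl a) q (f \<circ> proj)) * v a) -
        (\<Sum>a\<in>UNIV. \<Sum>b\<in>UNIV.
           g q (E (Inl a) q) (E (Inl b) q) * E (Inr i) q (f \<circ> proj) * v a * v b) = 0"
proof -
  let ?K = "\<lambda>d. Kcoef g X V d i q"
  \<comment> \<open>Symmetrised in a and b, this is the left-hand side of (i) with third index
    d.\<close>
  define M where "M d a b = - S b d a q + gcomp g X X d b q * df a q - gcomp g X X a b q * df d q" for d a b
  have A: "(\<Sum>k\<in>UNIV. theta (\<lambda>a i q. - gcomp g X V a i q) k q v *
           (R (Inr k) (Inr i) (Inl a) q + of_bool (k = i) * E (Inl a) q (f \<circ> proj)) * v a) =
      (\<Sum>b\<in>UNIV. (- (\<Sum>d\<in>UNIV. ?K d * S b d a q) + (\<Sum>d\<in>UNIV. ?K d * gcomp g X X d b q) * df a q) * v a * v b)"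
    for a
  proof -
    have 1: "(\<Sum>k\<in>UNIV. gcomp g X V b k q * (R (Inr k) (Inr i) (Inl a) q + of_bool (k = i) * df a q)) =
        (\<Sum>d\<in>UNIV. ?K d * S b d a q) + gcomp g X V b i q * df a q" for b
      using sum_mult_of_bool_eq(1)[of "\<lambda>k. gcomp g X V b k q * df a q" i]
      by (simp add: distrib_left sum.distrib R_Inr_contract[OF q] mult_ac)
    have 2: "gcomp g X V b i q = - (\<Sum>d\<in>UNIV. ?K d * gcomp g X X d b q)" for b
      using Kcoef_gXX[OF q, of i b] by simp
    show ?thesis
      unfolding sum_distrib_right[symmetric, where r = "v a"] theta_R_sum E_simps(1) X_f[OF q] 1 2
      unfolding sum_distrib_right[where r = "v a"]
      by (intro sum.cong refl) (simp add: algebra_simps)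
  qed
  have "(\<Sum>a\<in>UNIV. \<Sum>k\<in>UNIV. theta (\<lambda>a i q. - gcomp g X V a i q) k q v *
           (R (Inr k) (Inr i) (Inl a) q + of_bool (k = i) * E (Inl a) q (f \<circ> proj)) * v a) -
        (\<Sum>a\<in>UNIV. \<Sum>b\<in>UNIV.
           g q (E (Inl a) q) (E (Inl b) q) * E (Inr i) q (f \<circ> proj) * v a * v b) =
      (\<Sum>a\<in>UNIV. \<Sum>b\<in>UNIV. (\<Sum>d\<in>UNIV. ?K d * M d a b) * v a * v b)"
    unfolding A E_Inr_f[OF q] sum_subtractf[symmetric]
  proof (intro sum.cong refl, goal_cases)
    case (1 a b)
    have M: "(\<Sum>d\<in>UNIV. ?K d * M d a b) = - (\<Sum>d\<in>UNIV. ?K d * S b d a q) +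
        (\<Sum>d\<in>UNIV. ?K d * gcomp g X X d b q) * df a q - gcomp g X X a b q * (\<Sum>d\<in>UNIV. ?K d * df d q)"
      by (simp add: M_def sum_distrib_left sum_distrib_right sum_negf[symmetric] sum.distrib[symmetric]
          sum_subtractf[symmetric] algebra_simps)
    show ?case unfolding M by (simp add: E_simps gcomp_def algebra_simps)
  qed
  also have "\<dots> = 0"
  proof -
    have "M d a b + M d b a = 0" for d a b
      using AG[unfolded cond_AG_iff, rule_format, OF q, of a b d] S_antisym[OF q, of b d a]
        S_antisym[OF q, of a d b] gXX_commute[OF q, of d b] gXX_commute[OF q, of d a]
        gXX_commute[OF q, of a b]
      by (simp add: M_def)
    then have "(\<Sum>d\<in>UNIV. ?K d * M d a b) + (\<Sum>d\<in>UNIV. ?K d * M d b a) = 0" for a b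
      unfolding sum.distrib[symmetric] distrib_left[symmetric] by simp
    then show ?thesis
      by (rule quadratic_form_eq_0_iff[of "\<lambda>a b. \<Sum>d\<in>UNIV. ?K d * M d a b", THEN iffD2, rule_format])
  qed
  finally show ?thesis .
qed

section \<open>The Levi-Civita terms of condition (B')\<close>

context
  fixes nabla :: "'q vfield \<Rightarrow> 'q vfield \<Rightarrow> 'q vfield"
    and Gam :: "'m + 'k \<Rightarrow> 'm \<Rightarrow> 'm \<Rightarrow> 'q \<Rightarrow> real"
    and gbar :: "'q \<Rightarrow> 'q tvec \<Rightarrow> 'q tvec \<Rightarrow> real"
  assumes LC: "levi_civita AQ W g nabla"
    and Gam: "\<And>a b q. q \<in> W \<Longrightarrow>
      nabla (X a) (X b) q = lincomb UNIV (\<lambda>\<gamma>. Gam \<gamma> a b q) (\<lambda>\<gamma>. E \<gamma> q)"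
    and gbar_E: "\<And>a i q. q \<in> W \<Longrightarrow> gbar q (X a q) (E (Inr i) q) = - gcomp g X V a i q"
begin

lemma LC_facts:
  assumes "smooth_vf AQ W Y" "smooth_vf AQ W Z" "smooth_vf AQ W Z'" "q \<in> W"
  shows "nabla Y Z q \<in> tangent_space AQ q"
    and "nabla Y Z q k - nabla Z Y q k = lie_bracket AQ Y Z q k"
    and "Y q (\<lambda>q. g q (Z q) (Z' q)) = g q (nabla Y Z q) (Z' q) + g q (Z q) (nabla Y Z' q)"
proof -
  \<comment> \<open>\<open>levi_civita\<close> quantifies over fields and a function jointly; the
    zero function instantiates the latter.\<close>
  have "smooth_fun AQ W (\<lambda>_. 0)"
    using Q.smooth_fun_iff_smooth_at[OF W_open] Q.smooth_at_const W_mcarrier by blast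
  note * = LC[unfolded levi_civita_def, rule_format, OF conjI[OF assms(1) conjI[OF _ conjI[OF _ this]]]]
  show "nabla Y Z q \<in> tangent_space AQ q"
    using *[OF assms(2,3)] assms(4) Q.smooth_vf_tangent by blast
  show "nabla Y Z q k - nabla Z Y q k = lie_bracket AQ Y Z q k"
    using *[OF assms(2,3)] assms(4) by blast
  show "Y q (\<lambda>q. g q (Z q) (Z' q)) = g q (nabla Y Z q) (Z' q) + g q (Z q) (nabla Y Z' q)"
    using *[OF assms(2,3)] assms(4) by blast
qed

lemma nabla_commute:
  assumes q: "q \<in> W"
  shows "nabla (X a) (V i) q = nabla (V i) (X a) q"
proof
  fix k
  have "lie_bracket AQ (X a) (V i) q k = 0"
    using V_X_commute[OF q, of k i a] by (simp add: lie_bracket_def)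
  then show "nabla (X a) (V i) q k = nabla (V i) (X a) q k"
    using LC_facts(2)[OF X_smooth_vf[of a] V_smooth_vf[of i] X_smooth_vf q, of k] by simp
qed

text \<open>\<open>V i\<close> is a Killing field and commutes with the \<open>X a\<close>.\<close>

lemma nabla_V_antisym:
  assumes q: "q \<in> W"
  shows "g q (X b q) (nabla (X a) (V i) q) + g q (X a q) (nabla (X b) (V i) q) = 0"
proof -
  have "V i q (gcomp g X X a b) = 0"
    by (rule V_invariant[OF W_mcarrier[OF q] gX_smooth_at[OF q]]) (rule gXX_invariant[OF _ q])
  then have "g q (nabla (V i) (X a) q) (X b q) + g q (X a q) (nabla (V i) (X b) q) = 0"
    using LC_facts(3)[OF V_smooth_vf[of i] X_smooth_vf[of a] X_smooth_vf[of b] q] by (simp add: gcomp_def)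
  then show ?thesis
    using g_commute[OF X_tangent[OF q] LC_facts(1)[OF V_smooth_vf X_smooth_vf V_smooth_vf q], of b i a]
    by (simp add: nabla_commute[OF q])
qed

text \<open>\<open>V i\<close> and \<open>E (Inr i)\<close> differ by a combination of the
  \<open>X b\<close>, to which \<open>E (Inr k)\<close> is orthogonal.\<close>

lemma g_E_V: "q \<in> W \<Longrightarrow> g q (E (Inr k) q) (V i q) = g q (E (Inr k) q) (E (Inr i) q)"
proof -
  assume q: "q \<in> W"
  note qm = W_mcarrier[OF q]
  have 0: "g q (E (Inr k) q) (X b q) = 0" for b
    using E_orthogonal[OF q, of b k] g_commute[OF X_tangent[OF q] E_tangent[OF q]] by simp
  show ?thesis
    unfolding E_Inr_lincomb[of i]
    by (subst g_lincomb_right[OF qm E_tangent[OF q]])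
      (use X_tangent[OF q] V_tangent[OF qm] sum_mult_of_bool_eq(1)[of "\<lambda>j. g q (E (Inr k) q) (V j q)" i]
        in \<open>auto simp: sum_UNIV_Plus 0 mult.commute split: sum.split\<close>)
qed

text \<open>Compatibility with the metric, applied to -g(X_b, V_i). The three terms are shaped for
  what follows: the first belongs to \<open>Gamma_nh\<close>, the second to \<open>lambda_i\<close>,
  the third is the Killing term.\<close>

lemma X_gbar:
  assumes q: "q \<in> W"
  shows "X a q (\<lambda>p. gbar p (X b p) (E (Inr i) p)) =
    - ((\<Sum>e\<in>UNIV. Gam (Inl e) a b q * gcomp g X V e i q) +
       (\<Sum>k\<in>UNIV. Gam (Inr k) a b q * g q (E (Inr k) q) (E (Inr i) q)) +
       g q (X b q) (nabla (X a) (V i) q))"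
proof -
  have "X a q (\<lambda>p. gbar p (X b p) (E (Inr i) p)) = X a q (\<lambda>p. - gcomp g X V b i p)"
    by (rule Q.tangent_local[OF X_tangent[OF q] W_open q gbar_E])
  also have "\<dots> = - X a q (gcomp g X V b i)"
    by (rule Q.tangent_minus[OF X_tangent[OF q] gV_smooth_at[OF q]])
  also have "X a q (gcomp g X V b i) =
      g q (nabla (X a) (X b) q) (V i q) + g q (X b q) (nabla (X a) (V i) q)"
    using LC_facts(3)[OF X_smooth_vf[of a] X_smooth_vf[of b] V_smooth_vf[of i] q] by (simp add: gcomp_def)
  also have "g q (nabla (X a) (X b) q) (V i q) =
      (\<Sum>\<gamma>\<in>UNIV. Gam \<gamma> a b q * g q (E \<gamma> q) (V i q))"
    unfolding Gam[OF q] by (rule g_lincomb_left[OF W_mcarrier[OF q] V_tangent[OF W_mcarrier[OF q]] E_tangent[OF q]]) simp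
  finally show ?thesis by (simp add: sum_UNIV_Plus g_E_V[OF q] E_simps(1) gcomp_def)
qed

text \<open>The horizontal coefficients of X_gbar cancel within \<open>Gamma_nh\<close>, the
  vertical ones against \<open>lambda_i\<close>. What is left is the quadratic form of an
  antisymmetric matrix \<open>N\<close>.\<close>

lemma Gamma_nh_lambda:
  assumes q: "q \<in> W"
  shows "Gamma_nh E Gam (\<lambda>b q. gbar q (X b q) (E (Inr i) q)) q v + lambda_i g E Gam i q v = 0"
proof -
  define N where "N a b = - g q (X b q) (nabla (X a) (V i) q)" for a b
  have "Gamma_nh E Gam (\<lambda>b q. gbar q (X b q) (E (Inr i) q)) q v + lambda_i g E Gam i q v =
      (\<Sum>a\<in>UNIV. \<Sum>b\<in>UNIV. N a b * v a * v b)"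
    unfolding Gamma_nh_def lambda_i_def sum.distrib[symmetric]
  proof (intro sum.cong refl, goal_cases)
    case (1 a b)
    have "E (Inl a) q (\<lambda>p. gbar p (X b p) (E (Inr i) p)) -
        (\<Sum>e\<in>UNIV. gbar q (X e q) (E (Inr i) q) * Gam (Inl e) a b q) =
        N a b - (\<Sum>k\<in>UNIV. g q (E (Inr k) q) (E (Inr i) q) * Gam (Inr k) a b q)"
      unfolding E_simps(1) X_gbar[OF q] gbar_E[OF q] by (simp add: N_def sum_negf mult.commute)
    then show ?case by (simp add: sum_distrib_right[symmetric] left_diff_distrib)
  qed
  also have "\<dots> = 0"
  proof (rule quadratic_form_eq_0_iff[of N, THEN iffD2, rule_format])
    show "N a b + N b a = 0" for a b
      using nabla_V_antisym[OF q, of b a i] unfolding N_def by linarith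
  qed
  finally show ?thesis .
qed

lemma theta_gbar: "q \<in> W \<Longrightarrow> theta (\<lambda>a i q. gbar q (X a q) (E (Inr i) q)) k q v =
    theta (\<lambda>a i q. - gcomp g X V a i q) k q v"
  by (simp add: theta_def gbar_E)

lemma cond_AG_iff_extension:
  "cond_AG AB U \<phi> g X V R f \<longleftrightarrow>
    projective_geodesic_extension W g E R Gam (\<lambda>a i q. gbar q (X a q) (E (Inr i) q)) (f \<circ> proj)"
proof -
  have A: "cond_A W g E R (\<lambda>a i q. gbar q (X a q) (E (Inr i) q)) (f \<circ> proj) \<longleftrightarrow> cond_AG AB U \<phi> g X V R f"
    unfolding cond_A_iff[symmetric] unfolding cond_A_def by (simp add: theta_gbar cong: ball_cong)
  moreover have "cond_B W g E R Gam (\<lambda>a i q. gbar q (X a q) (E (Inr i) q)) (f \<circ> proj)"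
    if "cond_AG AB U \<phi> g X V R f"
    unfolding cond_B_def
  proof (intro ballI allI)
    fix q v i assume q: "q \<in> W"
    show "Gamma_nh E Gam (\<lambda>b q. gbar q (X b q) (E (Inr i) q)) q v + lambda_i g E Gam i q v +
        (\<Sum>a\<in>UNIV. \<Sum>k\<in>UNIV. theta (\<lambda>a i q. gbar q (X a q) (E (Inr i) q)) k q v *
           (R (Inr k) (Inr i) (Inl a) q + of_bool (k = i) * E (Inl a) q (f \<circ> proj)) * v a) -
        (\<Sum>a\<in>UNIV. \<Sum>b\<in>UNIV.
           g q (E (Inl a) q) (E (Inl b) q) * E (Inr i) q (f \<circ> proj) * v a * v b) = 0"
      unfolding Gamma_nh_lambda[OF q] theta_gbar[OF q] add_0 by (rule cond_B_algebra[OF that q])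
  qed
  ultimately show ?thesis by (auto simp: projective_geodesic_extension_def)
qed

end

end

theorem corollary2:
  fixes G :: "('g, 'c) monoid_scheme"
    and AG :: "('g, real^'k) atlas"
    and AQ :: "('q, 'e::euclidean_space) atlas"
    and act :: "'g \<Rightarrow> 'q \<Rightarrow> 'q"
    and AB :: "('q set, real^'m) atlas"
    and g gbar :: "'q \<Rightarrow> 'q tvec \<Rightarrow> 'q tvec \<Rightarrow> real"
    and D :: "'q \<Rightarrow> 'q tvec set"
    and U :: "'q set set" and \<phi> :: "'q set \<Rightarrow> real^'m"
    and W :: "'q set"
    and \<xi> :: "'k \<Rightarrow> 'g tvec"
    and V :: "'k \<Rightarrow> 'q vfield" and X :: "'m \<Rightarrow> 'q vfield"
    and E :: "'m + 'k \<Rightarrow> 'q vfield"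
    and R :: "'m + 'k \<Rightarrow> 'm + 'k \<Rightarrow> 'm + 'k \<Rightarrow> 'q \<Rightarrow> real"
    and nabla :: "'q vfield \<Rightarrow> 'q vfield \<Rightarrow> 'q vfield"
    and Gam :: "'m + 'k \<Rightarrow> 'm \<Rightarrow> 'm \<Rightarrow> 'q \<Rightarrow> real"
    and f :: "'q set \<Rightarrow> real"
  assumes "chaplygin_system G AG AQ act AB g D"
    and "(U, \<phi>) \<in> AB" and "W = {q \<in> mcarrier AQ. orbit G act q \<in> U}"
    and "tbasis UNIV \<xi> (tangent_space AG \<one>\<^bsub>G\<^esub>)"
    and "V = (\<lambda>i. inf_generator G AQ act (\<xi> i))"
    and "\<And>a. horizontal_lift AQ AB (orbit G act) D W (coord_vf AB U \<phi> a) (X a)"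
    and "E = adapted_frame g X V"
    and "structure_functions AQ W E R"
    and "levi_civita AQ W g nabla"
    and "\<And>a b q. q \<in> W \<Longrightarrow>
      nabla (X a) (X b) q = lincomb UNIV (\<lambda>\<gamma>. Gam \<gamma> a b q) (\<lambda>\<gamma>. E \<gamma> q)"
    and "sym_tensor2 AQ W gbar"
    and "\<And>q u v. \<lbrakk>q \<in> W; u \<in> D q; v \<in> D q\<rbrakk> \<Longrightarrow> gbar q u v = g q u v"
    and "\<And>a i q. q \<in> W \<Longrightarrow> gbar q (X a q) (E (Inr i) q) = - gcomp g X V a i q"
    and "smooth_fun AB (mcarrier AB) f"
  shows
    "(cond_AG AB U \<phi> g X V R f \<longleftrightarrow>
        (\<forall>P\<in>Sigma U (tangent_space AB).
           \<forall>u\<in>tangent_space (tangent_atlas AB) P. \<forall>w\<in>tangent_space (tangent_atlas AB) P.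
             wedge (ext_d (f \<circ> fst)) (theta_l \<phi> g X) P u w = gamma_G \<phi> g X V R P u w)) \<and>
     (cond_AG AB U \<phi> g X V R f \<longleftrightarrow>
        cond_A W g E R (\<lambda>a i q. - gcomp g X V a i q) (f \<circ> orbit G act)) \<and>
     (cond_AG AB U \<phi> g X V R f \<longleftrightarrow>
        VD_orthogonal W (vertical_space AQ AB (orbit G act)) D gbar \<and>
        projective_geodesic_extension W g E R Gam (\<lambda>a i q. gbar q (X a q) (E (Inr i) q))
          (f \<circ> orbit G act))"
proof -
  interpret chaplygin_system G AG AQ act AB g D by fact
  interpret chaplygin_frame G AG AQ act AB g D U \<phi> W \<xi> V X E R f
    by unfold_locales (fact assms)+
  \<comment> \<open>Orthogonality follows from the values -G_ai together with agreement of
    \<open>gbar\<close> and \<open>g\<close> on \<open>D\<close>; the third equivalence then reduces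
    to \<open>cond_AG_iff_extension\<close>.\<close>
  have "VD_orthogonal W (vertical_space AQ AB (orbit G act)) D gbar"
    using assms(11-13) by (rule VD_orthogonal_frame)
  then show ?thesis
    using form_condition_iff cond_A_iff cond_AG_iff_extension[OF assms(9,10,13)] by simp
qed

end
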